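(* Let $n\ge1$ and $f_n\in\hat L^2(\mathbb R_+^n)$. Then $$d_W(I_n(f_n),\mathcal N)\le\sqrt{\mathbb E\left[\left(1-\frac1n\|\nabla_\cdot I_n(f_n)\|^2_{L^2(\mathbb R_+,dx/2)}\right)^2\right]}+\frac1{2n}\,\mathbb E\left[\int_0^\infty|\nabla_tI_n(f_n)|^3dt\right]+\frac1{4n}\,\mathbb E\left[\int_0^\infty|\nabla_tI_n(f_n)|\int_{2\lfloor t/2\rfloor}^{2\lfloor t/2\rfloor+2}|\nabla_sI_n(f_n)|^2\,ds\,dt\right].$$
   Context: $\mathbb N=\{0,1,2,\ldots\}$, $\mathbb R_+=[0,\infty)$. $(U_k)_{k\in\mathbb N}$ is an i.i.d. sequence uniformly distributed on $[-1,1]$. Multiple stochastic integrals. $\Delta_n:=\bigcup [2k_1,2k_1+2]\times\cdots\times[2k_n,2k_n+2]$, the union being over pairwise distinct $k_1,\ldots,k_n\in\mathbb N$; $\hat L^2(\mathbb R_+^n)$ is the space of symmetric square-integrable functions on $\mathbb R_+^n$ vanishing outside $\Delta_n$. For $f_n\in\hat L^2(\mathbb R_+^n)$ (integrable, then extended by continuity using $\mathbb E[I_n(f_n)^2]\le n!\|f_n\|^2_{L^2(\mathbb R_+^n,(dx/2)^{\otimes n})}$), $$I_n(f_n):=\sum_{r=0}^n\frac{(-1)^{n-r}}{2^{n-r}}\binom nr\sum_{k_1,\ldots,k_r\ge0\text{ distinct}}\int_{\mathbb R_+^{n-r}}f_n(2k_1+1+U_{k_1},\ldots,2k_r+1+U_{k_r},y_1,\ldots,y_{n-r})\,dy_1\cdots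 dy_{n-r}.$$ Finite difference operator. For $X$ a functional of $(U_k)_{k\in\mathbb N}$ and $t\in\mathbb R_+$, $X\circ\Psi_t$ is obtained from $X$ by replacing $U_{\lfloor t/2\rfloor}$ by $t-2\lfloor t/2\rfloor-1$ and leaving all other $U_j$ unchanged, and $$\nabla_tX:=X\circ\Psi_t-\frac12\int_{2\lfloor t/2\rfloor}^{2\lfloor t/2\rfloor+2}X\circ\Psi_s\,ds.$$ $\|u\|^2_{L^2(\mathbb R_+,dx/2)}=\frac12\int_0^\infty|u_t|^2dt$. $\mathcal N$ is a standard normal random variable, and $d_W(X,Y)=\sup_h|\mathbb E[h(X)]-\mathbb E[h(Y)]|$ over Lipschitz $h:\mathbb R\to\mathbb R$ with constant at most $1$. The right-hand side may be $+\infty$. *)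

theory Defs
  imports "HOL-Probability.Probability" "HOL-Combinatorics.Permutations"
begin

text \<open>
  Points of the n-dimensional space are extensional functions on \<open>{..<n}\<close>, with Lebesgue measure
  \<open>lebn n\<close>. A functional of the sequence \<open>U\<close> is represented by a map
  \<open>F :: (nat \<Rightarrow> real) \<Rightarrow> real\<close>; the random variable itself is \<open>\<lambda>\<omega>. F (\<lambda>k. U k \<omega>)\<close>.
\<close>

abbreviation lebn :: "nat \<Rightarrow> (nat \<Rightarrow> real) measure" where
  "lebn n \<equiv> PiM {..<n} (\<lambda>_. lborel)"

definition iid_uniform :: "'a measure \<Rightarrow> (nat \<Rightarrow> 'a \<Rightarrow> real) \<Rightarrow> bool" where
  "iid_uniform M U \<longleftrightarrow>
     prob_space.indep_vars M (\<lambda>_. borel) U UNIV \<and>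
     (\<forall>k. distr M borel (U k) = uniform_measure lborel {-1..1})"

definition Delta :: "nat \<Rightarrow> (nat \<Rightarrow> real) set" where
  "Delta n = (\<Union>k\<in>{k :: nat \<Rightarrow> nat. inj_on k {..<n}}.
     PiE {..<n} (\<lambda>i. {2 * real (k i) .. 2 * real (k i) + 2}))"

text \<open>Functions on \<open>[0,\<infinity>)\<^sup>n\<close> are extended by zero; this is automatic since they vanish off \<open>Delta n\<close>.\<close>

definition hatL2 :: "nat \<Rightarrow> ((nat \<Rightarrow> real) \<Rightarrow> real) set" where
  "hatL2 n = {f. f \<in> borel_measurable (lebn n) \<and>
     integrable (lebn n) (\<lambda>x. (f x)\<^sup>2) \<and>
     (\<forall>x\<in>space (lebn n). \<forall>p. p permutes {..<n} \<longrightarrow> f (x \<circ> p) = f x) \<and>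
     (\<forall>x\<in>space (lebn n). x \<notin> Delta n \<longrightarrow> f x = 0)}"

text \<open>The squared norm for the product measure \<open>(dx/2)\<^sup>n\<close>, which is \<open>2\<^sup>-\<^sup>n\<close> times Lebesgue measure.\<close>

definition L2_norm_sq :: "nat \<Rightarrow> ((nat \<Rightarrow> real) \<Rightarrow> real) \<Rightarrow> ennreal" where
  "L2_norm_sq n f = (\<integral>\<^sup>+x. ennreal ((f x)\<^sup>2) \<partial>lebn n) / 2 ^ n"

text \<open>
  The defining formula, used for integrable \<open>f\<close>. The tuples of pairwise distinct indices are the
  distinct lists of length \<open>r\<close>.
\<close>

definition mult_int_formula :: "nat \<Rightarrow> ((nat \<Rightarrow> real) \<Rightarrow> real) \<Rightarrow> (nat \<Rightarrow> real) \<Rightarrow> real" where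
  "mult_int_formula n f u = (\<Sum>r\<le>n. (-1) ^ (n - r) / 2 ^ (n - r) * real (n choose r) *
     (\<Sum>\<^sub>\<infinity>ks\<in>{ks :: nat list. length ks = r \<and> distinct ks}.
        LINT y:PiE {..<n - r} (\<lambda>_. {0..})|lebn (n - r).
          f (\<lambda>i\<in>{..<n}. if i < r then 2 * real (ks ! i) + 1 + u (ks ! i) else y (i - r))))"

text \<open>
  Extension by continuity: \<open>F\<close> represents the limit in \<open>L\<^sup>2(M)\<close> of the integrals of some sequence of
  integrable elements of \<open>hatL2 n\<close> converging to \<open>f\<close> in \<open>L\<^sup>2\<close>. It is determined up to almost sure
  equality, and \<open>mult_int\<close> selects a version.
\<close>

definition is_mult_int ::
  "'a measure \<Rightarrow> (nat \<Rightarrow> 'a \<Rightarrow> real) \<Rightarrow> nat \<Rightarrow> ((nat \<Rightarrow> real) \<Rightarrow> real) \<Rightarrow> ((nat \<Rightarrow> real) \<Rightarrow> real) \<Rightarrow> bool" where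
  "is_mult_int M U n f F \<longleftrightarrow>
     F \<in> borel_measurable (PiM UNIV (\<lambda>_. borel)) \<and>
     integrable M (\<lambda>\<omega>. (F (\<lambda>k. U k \<omega>))\<^sup>2) \<and>
     (\<exists>g. (\<forall>m. g m \<in> hatL2 n \<and> integrable (lebn n) (g m)) \<and>
          (\<lambda>m. L2_norm_sq n (\<lambda>x. g m x - f x)) \<longlonglongrightarrow> 0 \<and>
          (\<lambda>m. \<integral>\<^sup>+\<omega>. ennreal ((mult_int_formula n (g m) (\<lambda>k. U k \<omega>) - F (\<lambda>k. U k \<omega>))\<^sup>2) \<partial>M)
            \<longlonglongrightarrow> 0)"

definition mult_int ::
  "'a measure \<Rightarrow> (nat \<Rightarrow> 'a \<Rightarrow> real) \<Rightarrow> nat \<Rightarrow> ((nat \<Rightarrow> real) \<Rightarrow> real) \<Rightarrow> (nat \<Rightarrow> real) \<Rightarrow> real" where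
  "mult_int M U n f = (SOME F. is_mult_int M U n f F)"

definition block :: "real \<Rightarrow> real set" where
  "block t = {2 * of_int \<lfloor>t / 2\<rfloor> .. 2 * of_int \<lfloor>t / 2\<rfloor> + 2}"

definition Psi :: "real \<Rightarrow> (nat \<Rightarrow> real) \<Rightarrow> nat \<Rightarrow> real" where
  "Psi t u = u(nat \<lfloor>t / 2\<rfloor> := t - 2 * of_int \<lfloor>t / 2\<rfloor> - 1)"

definition nabla :: "real \<Rightarrow> ((nat \<Rightarrow> real) \<Rightarrow> real) \<Rightarrow> (nat \<Rightarrow> real) \<Rightarrow> real" where
  "nabla t F u = F (Psi t u) - 1 / 2 * (LBINT s:block t. F (Psi s u))"

definition half_line_norm_sq :: "(real \<Rightarrow> real) \<Rightarrow> ennreal" where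
  "half_line_norm_sq v = (\<integral>\<^sup>+t\<in>{0..}. ennreal (\<bar>v t\<bar>\<^sup>2) \<partial>lborel) / 2"

definition ennreal_sqrt :: "ennreal \<Rightarrow> ennreal" where
  "ennreal_sqrt x = (if x = \<top> then \<top> else ennreal (sqrt (enn2real x)))"

definition wasserstein_dist ::
  "'a measure \<Rightarrow> ('a \<Rightarrow> real) \<Rightarrow> 'b measure \<Rightarrow> ('b \<Rightarrow> real) \<Rightarrow> ennreal" where
  "wasserstein_dist M X P Y =
     (SUP h\<in>{h :: real \<Rightarrow> real. 1-lipschitz_on UNIV h}.
        ennreal \<bar>(\<integral>\<omega>. h (X \<omega>) \<partial>M) - (\<integral>\<omega>. h (Y \<omega>) \<partial>P)\<bar>)"

end

theory Submission
  imports Defs "HOL-Combinatorics.Multiset_Permutations"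
begin

text \<open>
  Let \<open>D\<^sub>k F\<close> be \<open>F\<close> minus its conditional expectation given all coordinates but the \<open>k\<close>-th. A multiple
  integral of order \<open>n\<close> is a limit of finite sums of completely degenerate kernels of \<open>n\<close> coordinates
  (inclusion-exclusion over the coordinates that are integrated out), and on those \<open>\<Sum>k. D\<^sub>k\<close> is
  multiplication by \<open>n\<close>. Hence, for \<open>X = I\<^sub>n(f\<^sub>n)\<close>, the expectation of \<open>X \<phi>(X)\<close> is \<open>1/n\<close> times the sum of
  the expectations of \<open>D\<^sub>k X \<phi>(X)\<close>. Comparing \<open>\<phi>(X)\<close> with \<open>\<phi>(X')\<close>, where \<open>X'\<close> has the \<open>k\<close>-th coordinate
  resampled, and expanding \<open>\<phi>\<close> to second order gives the expectation of \<open>\<phi>'(X) \<parallel>\<nabla>X\<parallel>\<^sup>2 / n\<close> up to a remainder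
  bounded by the last two terms of the estimate. Here \<open>\<phi>\<close> solves Stein's equation
  \<open>\<phi>'(x) - x \<phi>(x) = h(x) - E h(N)\<close> with \<open>\<bar>\<phi>'\<bar> \<le> 1\<close> and \<open>\<phi>'\<close> Lipschitz with constant 2.
\<close>

section \<open>Square-integrable functions\<close>

text \<open>The sum of the operators \<open>dif k\<close> is unbounded, so its eigenvalue relation
  holds for the finite approximants of X but does not simply pass to the limit. What survives is the
  relation tested against \<phi>(X). For an approximant Z the error is the sum over k of <D_k (X -
  Z), \<phi>(X)>; as D_k is an orthogonal projection, this is the sum of <D_k (X - Z), D_k
  \<phi>(X)>. Both families are square summable, because \<phi> is 1-Lipschitz and the energy, the
  sum of ||D_k X||^2, is finite.

  The Taylor expansion is taken around the point that is not resampled, which keeps its coefficients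
  independent of the new coordinate. The remainder carries the weight |D_k X'| (X' - X)^2. Given the
  other coordinates, X' - X is a difference of two independent centred variables, so the mean of its
  square splits in two: this is why the estimate has both a cubic and a mixed term. Its coefficient
  is 1, half the Lipschitz constant of \<phi>'. A block has Lebesgue measure 2 but probability 1,
  whence the factors 1/2 and 1/4. Third moments may be infinite, so remainders live in
  \<open>ennreal\<close>.\<close>

definition L2 :: "'a measure \<Rightarrow> ('a \<Rightarrow> real) set" where
  "L2 M = {f \<in> borel_measurable M. integrable M (\<lambda>x. (f x)\<^sup>2)}"

lemma L2I: "f \<in> borel_measurable M \<Longrightarrow> integrable M (\<lambda>x. (f x)\<^sup>2) \<Longrightarrow> f \<in> L2 M"
  by (simp add: L2_def)

lemma L2D [dest, measurable_dest]:
  assumes "f \<in> L2 M"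
  shows "f \<in> borel_measurable M" "integrable M (\<lambda>x. (f x)\<^sup>2)"
  using assms by (auto simp: L2_def)

lemma L2_mult_integrable:
  assumes "f \<in> L2 M" "g \<in> L2 M"
  shows "integrable M (\<lambda>x. f x * g x)"
proof (rule Bochner_Integration.integrable_bound)
  show "integrable M (\<lambda>x. (f x)\<^sup>2 + (g x)\<^sup>2)"
    using assms by auto
  show "AE x in M. norm (f x * g x) \<le> norm ((f x)\<^sup>2 + (g x)\<^sup>2)"
  proof (rule AE_I2)
    fix x
    have "2 * (\<bar>f x\<bar> * \<bar>g x\<bar>) \<le> \<bar>f x\<bar>\<^sup>2 + \<bar>g x\<bar>\<^sup>2"
      using sum_squares_bound[of "\<bar>f x\<bar>" "\<bar>g x\<bar>"] by (simp add: mult.assoc)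
    then show "norm (f x * g x) \<le> norm ((f x)\<^sup>2 + (g x)\<^sup>2)"
      using mult_nonneg_nonneg[OF abs_ge_zero[of "f x"] abs_ge_zero[of "g x"]]
        zero_le_power2[of "f x"] zero_le_power2[of "g x"]
      unfolding real_norm_def abs_mult power2_abs by linarith
  qed
qed (use assms in auto)

lemma L2_bound:
  assumes "g \<in> L2 M" "f \<in> borel_measurable M" "AE x in M. \<bar>f x\<bar> \<le> \<bar>g x\<bar>"
  shows "f \<in> L2 M"
proof (rule L2I)
  show "integrable M (\<lambda>x. (f x)\<^sup>2)"
  proof (rule Bochner_Integration.integrable_bound[where f="\<lambda>x. (g x)\<^sup>2"])
    show "AE x in M. norm ((f x)\<^sup>2) \<le> norm ((g x)\<^sup>2)"
      using assms(3) by eventually_elim (simp add: abs_le_square_iff)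
  qed (use assms in auto)
qed fact

lemma L2_add:
  assumes "f \<in> L2 M" "g \<in> L2 M"
  shows "(\<lambda>x. f x + g x) \<in> L2 M"
proof (rule L2I)
  have "integrable M (\<lambda>x. (f x)\<^sup>2 + (g x)\<^sup>2 + 2 * (f x * g x))"
    using assms L2_mult_integrable[OF assms]
    by (intro Bochner_Integration.integrable_add integrable_mult_right) auto
  then show "integrable M (\<lambda>x. (f x + g x)\<^sup>2)"
    by (simp add: power2_sum mult.assoc)
qed (use assms in measurable)

lemma L2_cmult: "f \<in> L2 M \<Longrightarrow> (\<lambda>x. c * f x) \<in> L2 M"
  by (auto simp: L2_def power_mult_distrib)

lemma L2_diff: "f \<in> L2 M \<Longrightarrow> g \<in> L2 M \<Longrightarrow> (\<lambda>x. f x - g x) \<in> L2 M"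
  using L2_add[of f M "\<lambda>x. -1 * g x"] L2_cmult[of g M "-1"] by simp

lemma L2_zero: "(\<lambda>x. 0) \<in> L2 M"
  by (simp add: L2_def)

lemma L2_sum: "(\<And>i. i \<in> I \<Longrightarrow> f i \<in> L2 M) \<Longrightarrow> (\<lambda>x. \<Sum>i\<in>I. f i x) \<in> L2 M"
  by (induction I rule: infinite_finite_induct) (auto intro: L2_zero L2_add)

lemma (in prob_space) L2_const: "(\<lambda>x. c) \<in> L2 M"
  by (simp add: L2_def)

lemma (in prob_space) L2_integrable: "f \<in> L2 M \<Longrightarrow> integrable M f"
  by (auto simp: L2_def intro: square_integrable_imp_integrable)

lemma L2_Cauchy_Schwarz:
  assumes "f \<in> L2 M" "g \<in> L2 M"
  shows "\<bar>\<integral>x. f x * g x \<partial>M\<bar> \<le> sqrt (\<integral>x. (f x)\<^sup>2 \<partial>M) * sqrt (\<integral>x. (g x)\<^sup>2 \<partial>M)"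
proof -
  let ?a = "\<integral>x. (f x)\<^sup>2 \<partial>M" and ?b = "\<integral>x. (g x)\<^sup>2 \<partial>M" and ?c = "\<integral>x. f x * g x \<partial>M"
  note [simp] = assms[THEN L2D(2)] L2_mult_integrable[OF assms]
  have ab: "0 \<le> ?a" "0 \<le> ?b" by simp_all
  \<comment> \<open>Nonnegativity of the integral of \<open>(f - s * g)\<^sup>2\<close>, read as a
    quadratic inequality in \<open>s\<close>.\<close>
  have q: "2 * s * ?c \<le> ?a + s\<^sup>2 * ?b" for s
  proof -
    have "0 \<le> (\<integral>x. (f x - s * g x)\<^sup>2 \<partial>M)" by simp
    also have "\<dots> = (\<integral>x. (f x)\<^sup>2 + s\<^sup>2 * (g x)\<^sup>2 - 2 * s * (f x * g x) \<partial>M)"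
      by (simp add: power2_diff power_mult_distrib mult_ac)
    also have "\<dots> = ?a + s\<^sup>2 * ?b - 2 * s * ?c" by simp
    finally show ?thesis by simp
  qed
  have "?c\<^sup>2 \<le> ?a * ?b"
  proof (cases "?b = 0")
    case True
    \<comment> \<open>With \<open>?b = 0\<close> the inequality \<open>q\<close> bounds a linear
      function of \<open>s\<close>; the chosen \<open>s\<close> makes its left-hand side
      \<open>?a + 1\<close>.\<close>
    have "?c = 0"
    proof (rule ccontr)
      assume "?c \<noteq> 0"
      then have "2 * ((?a + 1) / (2 * ?c)) * ?c = ?a + 1" by (simp del: distrib_left_numeral)
      with q[of "(?a + 1) / (2 * ?c)"] True show False by simp
    qed
    then show ?thesis using True by simp
  next
    case False
    with ab(2) have "?b > 0" by linarith
    \<comment> \<open>The minimiser of the quadratic in \<open>s\<close>.\<close>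
    then show ?thesis using q[of "?c / ?b"] by (simp add: field_simps power2_eq_square)
  qed
  then have "sqrt (?c\<^sup>2) \<le> sqrt (?a * ?b)" by (rule real_sqrt_le_mono)
  then show ?thesis by (simp add: real_sqrt_mult)
qed

lemma (in prob_space) square_integral_le:
  assumes "f \<in> L2 M"
  shows "(\<integral>x. f x \<partial>M)\<^sup>2 \<le> (\<integral>x. (f x)\<^sup>2 \<partial>M)"
proof -
  have "\<bar>\<integral>x. f x \<partial>M\<bar> \<le> sqrt (\<integral>x. (f x)\<^sup>2 \<partial>M)"
    using L2_Cauchy_Schwarz[OF assms L2_const[of 1]] by (simp add: prob_space)
  then have "\<bar>\<integral>x. f x \<partial>M\<bar>\<^sup>2 \<le> (sqrt (\<integral>x. (f x)\<^sup>2 \<partial>M))\<^sup>2"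
    by (intro power_mono) auto
  then show ?thesis by simp
qed

section \<open>Resampling coordinates of an i.i.d. sequence\<close>

definition mix :: "'i set \<Rightarrow> ('i \<Rightarrow> 'a) \<Rightarrow> ('i \<Rightarrow> 'a) \<Rightarrow> 'i \<Rightarrow> 'a" where
  "mix B u w = (\<lambda>k. if k \<in> B then u k else w k)"

lemma mix_simps [simp]:
  "mix B u u = u"
  "mix UNIV u w = u"
  "mix B (mix B u w) v = mix B u v"
  by (auto simp: mix_def)

lemma mix_mix: "mix C (mix B u w) v = mix (B \<inter> C) u (mix C w v)"
  by (auto simp: mix_def)

locale iid_product = prob_space R for R :: "'a measure"
begin

abbreviation Q :: "(nat \<Rightarrow> 'a) measure" where
  "Q \<equiv> PiM UNIV (\<lambda>_. R)"

sublocale Q: product_prob_space "\<lambda>_. R" "UNIV :: nat set"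
  by unfold_locales

sublocale QQ: pair_prob_space Q Q
  by unfold_locales

lemma measurable_mix [measurable (raw)]:
  assumes [measurable]: "f \<in> M \<rightarrow>\<^sub>M Q" "g \<in> M \<rightarrow>\<^sub>M Q"
  shows "(\<lambda>x. mix B (f x) (g x)) \<in> M \<rightarrow>\<^sub>M Q"
proof (rule measurable_PiM_single')
  fix i :: nat
  have *: "(\<lambda>x. f x i) \<in> M \<rightarrow>\<^sub>M R" "(\<lambda>x. g x i) \<in> M \<rightarrow>\<^sub>M R"
    by measurable
  show "(\<lambda>x. mix B (f x) (g x) i) \<in> M \<rightarrow>\<^sub>M R"
    using * by (cases "i \<in> B") (simp_all add: mix_def)
  then show "(\<lambda>x. mix B (f x) (g x)) \<in> space M \<rightarrow> (\<Pi>\<^sub>E i\<in>UNIV. space R)"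
    using assms[THEN measurable_space] by (auto simp: mix_def space_PiM PiE_iff)
qed

text \<open>Product measures are determined by cylinders. The preimage of a cylinder is a rectangle:
  its conditions on coordinates in \<open>B\<close> fall on the first factor, the remaining ones on
  the second.\<close>

lemma distr_mix: "distr (Q \<Otimes>\<^sub>M Q) Q (\<lambda>(u, w). mix B u w) = Q"
proof (rule Q.PiM_eq)
  fix J :: "nat set" and F :: "nat \<Rightarrow> 'a set"
  assume J: "finite J" "J \<subseteq> UNIV" and F: "\<And>j. j \<in> J \<Longrightarrow> F j \<in> sets R"
  let ?E = "\<lambda>J. prod_emb UNIV (\<lambda>_. R) J (Pi\<^sub>E J F)"
  have F': "F j \<subseteq> space R" if "j \<in> J" for j
    using F[OF that] sets.sets_into_space by blast
  have S: "?E K \<in> sets Q" if "K \<subseteq> J" for K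
    using that J F by (intro sets_PiM_I) (auto intro: finite_subset)
  have eq: "(\<lambda>(u, w). mix B u w) -` ?E J \<inter> space (Q \<Otimes>\<^sub>M Q) = ?E (J \<inter> B) \<times> ?E (J - B)"
    using F' by (auto simp: prod_emb_def space_pair_measure space_PiM PiE_iff mix_def split: if_splits)
  have "emeasure (distr (Q \<Otimes>\<^sub>M Q) Q (\<lambda>(u, w). mix B u w)) (?E J) = emeasure (Q \<Otimes>\<^sub>M Q) (?E (J \<inter> B) \<times> ?E (J - B))"
    using S[of J] by (subst emeasure_distr) (auto simp: eq)
  also have "\<dots> = emeasure Q (?E (J \<inter> B)) * emeasure Q (?E (J - B))"
    by (intro Q.emeasure_pair_measure_Times S) auto
  also have "\<dots> = (\<Prod>j\<in>J \<inter> B. emeasure R (F j)) * (\<Prod>j\<in>J - B. emeasure R (F j))"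
    using J F by (intro arg_cong2[where f="(*)"] Q.emeasure_PiM_emb) auto
  also have "\<dots> = (\<Prod>j\<in>J. emeasure R (F j))"
    using J by (subst prod.union_disjoint[symmetric]) (auto intro!: prod.cong)
  finally show "emeasure (distr (Q \<Otimes>\<^sub>M Q) Q (\<lambda>(u, w). mix B u w)) (?E J) = (\<Prod>j\<in>J. emeasure R (F j))" .
qed simp

lemma nn_integral_mix:
  assumes [measurable]: "f \<in> borel_measurable Q"
  shows "(\<integral>\<^sup>+u. \<integral>\<^sup>+w. f (mix B u w) \<partial>Q \<partial>Q) = (\<integral>\<^sup>+u. f u \<partial>Q)"
proof -
  have "(\<integral>\<^sup>+u. f u \<partial>Q) = (\<integral>\<^sup>+u. f u \<partial>distr (Q \<Otimes>\<^sub>M Q) Q (\<lambda>(u, w). mix B u w))"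
    by (simp only: distr_mix)
  also have "\<dots> = (\<integral>\<^sup>+z. f (mix B (fst z) (snd z)) \<partial>(Q \<Otimes>\<^sub>M Q))"
    by (subst nn_integral_distr) (auto simp: case_prod_beta')
  also have "\<dots> = (\<integral>\<^sup>+u. \<integral>\<^sup>+w. f (mix B u w) \<partial>Q \<partial>Q)"
    by (subst Q.nn_integral_fst[symmetric]) auto
  finally show ?thesis ..
qed

lemma integrable_mix_iff:
  fixes f :: "(nat \<Rightarrow> 'a) \<Rightarrow> real"
  assumes [measurable]: "f \<in> borel_measurable Q"
  shows "integrable (Q \<Otimes>\<^sub>M Q) (\<lambda>z. f (mix B (fst z) (snd z))) \<longleftrightarrow> integrable Q f"
proof -
  have "integrable Q f \<longleftrightarrow> integrable (distr (Q \<Otimes>\<^sub>M Q) Q (\<lambda>(u, w). mix B u w)) f"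
    by (simp only: distr_mix)
  also have "\<dots> \<longleftrightarrow> integrable (Q \<Otimes>\<^sub>M Q) (\<lambda>z. f (mix B (fst z) (snd z)))"
    by (subst integrable_distr_eq) (auto simp: case_prod_beta')
  finally show ?thesis ..
qed

lemma integral_mix:
  fixes f :: "(nat \<Rightarrow> 'a) \<Rightarrow> real"
  assumes [measurable]: "f \<in> borel_measurable Q"
  shows "(\<integral>z. f (mix B (fst z) (snd z)) \<partial>(Q \<Otimes>\<^sub>M Q)) = (\<integral>u. f u \<partial>Q)"
proof -
  have "(\<integral>u. f u \<partial>Q) = (\<integral>u. f u \<partial>distr (Q \<Otimes>\<^sub>M Q) Q (\<lambda>(u, w). mix B u w))"
    by (simp only: distr_mix)
  also have "\<dots> = (\<integral>z. f (mix B (fst z) (snd z)) \<partial>(Q \<Otimes>\<^sub>M Q))"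
    by (subst integral_distr) (auto simp: case_prod_beta')
  finally show ?thesis ..
qed

lemma AE_mix:
  assumes "AE u in Q. P u"
  shows "AE u in Q. AE w in Q. P (mix B u w)"
proof -
  have "AE z in Q \<Otimes>\<^sub>M Q. P ((\<lambda>(u, w). mix B u w) z)"
    by (rule AE_distrD[where M'=Q and f="\<lambda>(u, w). mix B u w"]) (simp, subst distr_mix, fact)
  from QQ.AE_pair[OF this] show ?thesis by simp
qed

text \<open>Fubini on the pair space. All almost-everywhere qualifiers in the calculus of
  \<open>cexp\<close> come from here.\<close>

lemma AE_integrable_mix:
  fixes f :: "(nat \<Rightarrow> 'a) \<Rightarrow> real"
  assumes "integrable Q f"
  shows "AE u in Q. integrable Q (\<lambda>w. f (mix B u w))"
proof -
  have "integrable (Q \<Otimes>\<^sub>M Q) (\<lambda>z. f (mix B (fst z) (snd z)))"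
    using assms by (subst integrable_mix_iff) auto
  then have "integrable (Q \<Otimes>\<^sub>M Q) (\<lambda>(u, w). f (mix B u w))"
    by (simp add: case_prod_beta')
  from QQ.AE_integrable_fst[OF this] show ?thesis .
qed

section \<open>Conditional expectations as integrals over resampled coordinates\<close>

text \<open>
  Conditional expectation given the coordinates in \<open>B\<close>, as an honest function: the coordinates outside
  \<open>B\<close> are integrated out. It inherits the junk value 0 of the integral where \<open>F (mix B u \<cdot>)\<close> is not integrable.
\<close>

definition cexp :: "nat set \<Rightarrow> ((nat \<Rightarrow> 'a) \<Rightarrow> real) \<Rightarrow> (nat \<Rightarrow> 'a) \<Rightarrow> real" where
  "cexp B F u = (\<integral>w. F (mix B u w) \<partial>Q)"

lemma measurable_cexp [measurable (raw)]:
  assumes [measurable]: "F \<in> borel_measurable Q" "g \<in> M \<rightarrow>\<^sub>M Q"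
  shows "(\<lambda>x. cexp B F (g x)) \<in> borel_measurable M"
proof -
  have "cexp B F \<in> borel_measurable Q"
    unfolding cexp_def by measurable
  from measurable_compose[OF assms(2) this] show ?thesis .
qed

lemma cexp_mix [simp]: "cexp B F (mix B u w) = cexp B F u"
  by (simp add: cexp_def)

lemma cexp_UNIV [simp]: "cexp UNIV F u = F u"
  by (simp add: cexp_def Q.P.prob_space)

lemma integrable_cexp:
  assumes "integrable Q F"
  shows "integrable Q (cexp B F)"
proof -
  have "integrable (Q \<Otimes>\<^sub>M Q) (\<lambda>z. F (mix B (fst z) (snd z)))"
    using assms by (subst integrable_mix_iff) auto
  then have "integrable (Q \<Otimes>\<^sub>M Q) (\<lambda>(u, w). F (mix B u w))"
    by (simp add: case_prod_beta')
  from QQ.integrable_fst[OF this] show ?thesis by (simp add: cexp_def[abs_def])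
qed

lemma integral_cexp:
  assumes "integrable Q F"
  shows "(\<integral>u. cexp B F u \<partial>Q) = (\<integral>u. F u \<partial>Q)"
proof -
  have "integrable (Q \<Otimes>\<^sub>M Q) (\<lambda>z. F (mix B (fst z) (snd z)))"
    using assms by (subst integrable_mix_iff) auto
  then have "integrable (Q \<Otimes>\<^sub>M Q) (\<lambda>(u, w). F (mix B u w))"
    by (simp add: case_prod_beta')
  from QQ.integral_fst[OF this] show ?thesis
    using assms integral_mix[of F B] by (simp add: cexp_def[abs_def] case_prod_beta')
qed

text \<open>Only almost everywhere: where an inner integral diverges, its default value 0 can break
  additivity. Scaling respects the default value, so \<open>cexp_cmult\<close> holds at every
  point.\<close>

lemma cexp_diff:
  assumes "integrable Q F" "integrable Q G"
  shows "AE u in Q. cexp B (\<lambda>u. F u - G u) u = cexp B F u - cexp B G u"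
  using AE_integrable_mix[OF assms(1), of B] AE_integrable_mix[OF assms(2), of B]
  by eventually_elim (simp add: cexp_def)

lemma cexp_cmult: "cexp B (\<lambda>u. c * F u) u = c * cexp B F u"
  by (simp add: cexp_def)

lemma cexp_sum:
  assumes "\<And>i. i \<in> I \<Longrightarrow> integrable Q (F i)"
  shows "AE u in Q. cexp B (\<lambda>u. \<Sum>i\<in>I. F i u) u = (\<Sum>i\<in>I. cexp B (F i) u)"
proof (cases "finite I")
  case True
  have "AE u in Q. \<forall>i\<in>I. integrable Q (\<lambda>w. F i (mix B u w))"
    using True AE_integrable_mix[OF assms, of _ B] by (intro AE_finite_allI) auto
  then show ?thesis
    by eventually_elim (simp add: cexp_def)
qed (simp add: cexp_def)

text \<open>By \<open>mix_mix\<close> the two integration variables enter only through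
  \<open>mix C w v\<close>, which has law \<open>Q\<close> again by \<open>distr_mix\<close>; the
  double integral therefore collapses to one over the coordinates outside
  \<open>B \<inter> C\<close>.\<close>

lemma cexp_cexp:
  assumes "integrable Q F"
  shows "AE u in Q. cexp B (cexp C F) u = cexp (B \<inter> C) F u"
proof -
  have [measurable]: "F \<in> borel_measurable Q" using assms by auto
  show ?thesis
    using AE_integrable_mix[OF assms, of "B \<inter> C"] AE_space
  proof eventually_elim
    case (elim u)
    let ?h = "\<lambda>v. F (mix (B \<inter> C) u v)"
    have [measurable]: "?h \<in> borel_measurable Q" using elim by measurable
    have "integrable (Q \<Otimes>\<^sub>M Q) (\<lambda>z. ?h (mix C (fst z) (snd z)))"
      using elim by (subst integrable_mix_iff) auto
    then have i: "integrable (Q \<Otimes>\<^sub>M Q) (\<lambda>(w, v). ?h (mix C w v))"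
      by (simp add: case_prod_beta')
    have "cexp B (cexp C F) u = (\<integral>w. \<integral>v. ?h (mix C w v) \<partial>Q \<partial>Q)"
      by (simp add: cexp_def mix_mix)
    also have "\<dots> = (\<integral>z. ?h (mix C (fst z) (snd z)) \<partial>(Q \<Otimes>\<^sub>M Q))"
      using QQ.integral_fst[OF i] by (simp add: case_prod_beta')
    also have "\<dots> = cexp (B \<inter> C) F u"
      by (subst integral_mix) (auto simp: cexp_def)
    finally show ?case .
  qed
qed

lemma AE_L2_mix:
  assumes "F \<in> L2 Q"
  shows "AE u in Q. (\<lambda>w. F (mix B u w)) \<in> L2 Q"
  using AE_integrable_mix[OF L2D(2)[OF assms], of B] AE_space
proof eventually_elim
  case (elim u)
  have [measurable]: "F \<in> borel_measurable Q" using assms by auto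
  from elim show ?case by (intro L2I) measurable
qed

lemma cexp_L2:
  assumes "F \<in> L2 Q"
  shows "cexp B F \<in> L2 Q"
proof -
  have [measurable]: "F \<in> borel_measurable Q" using assms by auto
  have le: "AE u in Q. (cexp B F u)\<^sup>2 \<le> cexp B (\<lambda>u. (F u)\<^sup>2) u"
    using AE_L2_mix[OF assms, of B]
    by eventually_elim (simp add: cexp_def Q.P.square_integral_le)
  have int: "integrable Q (cexp B (\<lambda>u. (F u)\<^sup>2))"
    using assms by (intro integrable_cexp) auto
  show "cexp B F \<in> L2 Q"
  proof (rule L2I)
    show "integrable Q (\<lambda>u. (cexp B F u)\<^sup>2)"
      by (rule Bochner_Integration.integrable_bound[OF int]) (use le in auto)
  qed simp
qed

lemma cexp_adjoint:
  assumes F: "F \<in> L2 Q" and G: "G \<in> L2 Q"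
  shows "(\<integral>u. cexp B F u * G u \<partial>Q) = (\<integral>u. F u * cexp B G u \<partial>Q)"
proof -
  \<comment> \<open>Taking out what is known: \<open>cexp B G\<close> is invariant under
    \<open>mix B\<close>, so it leaves the inner integral. The result is symmetric in
    \<open>F\<close> and \<open>G\<close>, which is the adjointness.\<close>
  have pull: "(\<integral>u. F u * cexp B G u \<partial>Q) = (\<integral>u. cexp B F u * cexp B G u \<partial>Q)"
    if "F \<in> L2 Q" "G \<in> L2 Q" for F G
  proof -
    have "(\<integral>u. F u * cexp B G u \<partial>Q) = (\<integral>u. cexp B (\<lambda>u. F u * cexp B G u) u \<partial>Q)"
      using that by (intro integral_cexp[symmetric] L2_mult_integrable cexp_L2)
    then show ?thesis by (simp add: cexp_def)
  qed
  show ?thesis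
    using pull[OF F G] pull[OF G F] by (simp add: mult.commute)
qed

section \<open>The partial differences as orthogonal projections of L2\<close>

definition dif :: "nat \<Rightarrow> ((nat \<Rightarrow> 'a) \<Rightarrow> real) \<Rightarrow> (nat \<Rightarrow> 'a) \<Rightarrow> real" where
  "dif k F u = F u - cexp (- {k}) F u"

lemma measurable_dif [measurable (raw)]:
  assumes [measurable]: "F \<in> borel_measurable Q" "g \<in> M \<rightarrow>\<^sub>M Q"
  shows "(\<lambda>x. dif k F (g x)) \<in> borel_measurable M"
  unfolding dif_def by measurable

text \<open>The subtracted mean is free of coordinate \<open>k\<close>. Hence increments of
  \<open>F\<close> in that coordinate are increments of \<open>dif k F\<close>.\<close>

lemma dif_mix: "dif k F (mix (- {k}) u w) = F (mix (- {k}) u w) - cexp (- {k}) F u"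
  by (simp add: dif_def)

lemma dif_L2: "F \<in> L2 Q \<Longrightarrow> dif k F \<in> L2 Q"
  unfolding dif_def[abs_def] by (intro L2_diff cexp_L2)

lemma cexp_dif:
  assumes "integrable Q F"
  shows "AE u in Q. cexp (- {k}) (dif k F) u = 0"
  using cexp_diff[OF assms integrable_cexp[OF assms], of "- {k}" "- {k}"] cexp_cexp[OF assms, of "- {k}" "- {k}"]
  by eventually_elim (simp add: dif_def[abs_def])

lemma dif_diff:
  assumes "integrable Q F" "integrable Q G"
  shows "AE u in Q. dif k (\<lambda>u. F u - G u) u = dif k F u - dif k G u"
  using cexp_diff[OF assms, of "- {k}"] by eventually_elim (simp add: dif_def)

lemma dif_adjoint:
  assumes F: "F \<in> L2 Q" and G: "G \<in> L2 Q"
  shows "(\<integral>u. dif k F u * G u \<partial>Q) = (\<integral>u. F u * dif k G u \<partial>Q)"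
  using cexp_adjoint[OF F G, of "- {k}"]
    L2_mult_integrable[OF F G] L2_mult_integrable[OF cexp_L2[OF F] G]  L2_mult_integrable[OF F cexp_L2[OF G]]
  by (simp add: dif_def left_diff_distrib right_diff_distrib)

lemma dif_dif:
  assumes F: "F \<in> L2 Q"
  shows "AE u in Q. dif k (dif k F) u = dif k F u"
  using cexp_dif[OF Q.P.L2_integrable[OF F], of k] by eventually_elim (simp add: dif_def)

lemma integral_dif_mult_dif:
  assumes F: "F \<in> L2 Q" and G: "G \<in> L2 Q"
  shows "(\<integral>u. dif k F u * dif k G u \<partial>Q) = (\<integral>u. dif k F u * G u \<partial>Q)"
proof -
  have [measurable]: "F \<in> borel_measurable Q" "G \<in> borel_measurable Q" using F G by auto
  have "(\<integral>u. dif k F u * dif k G u \<partial>Q) = (\<integral>u. dif k (dif k F) u * G u \<partial>Q)"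
    using F G by (intro dif_adjoint[symmetric] dif_L2)
  also have "\<dots> = (\<integral>u. dif k F u * G u \<partial>Q)"
    using dif_dif[OF F, of k] by (intro integral_cong_AE) auto
  finally show ?thesis .
qed

text \<open>A projection is a contraction: the mixed product equals the square norm of
  \<open>dif k F\<close>, so the square norm of \<open>F - dif k F\<close> is the difference of the
  two sides.\<close>

lemma integral_dif_square_le:
  assumes F: "F \<in> L2 Q"
  shows "(\<integral>u. (dif k F u)\<^sup>2 \<partial>Q) \<le> (\<integral>u. (F u)\<^sup>2 \<partial>Q)"
proof -
  note D = dif_L2[OF F, of k]
  have "0 \<le> (\<integral>u. (F u - dif k F u)\<^sup>2 \<partial>Q)" by simp
  also have "\<dots> = (\<integral>u. (F u)\<^sup>2 + (dif k F u)\<^sup>2 - 2 * (dif k F u * F u) \<partial>Q)"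
    by (simp add: power2_diff algebra_simps)
  also have "\<dots> = (\<integral>u. (F u)\<^sup>2 \<partial>Q) + (\<integral>u. (dif k F u)\<^sup>2 \<partial>Q) - 2 * (\<integral>u. dif k F u * F u \<partial>Q)"
    using L2D(2)[OF F] L2D(2)[OF D] L2_mult_integrable[OF D F] by simp
  also have "(\<integral>u. dif k F u * F u \<partial>Q) = (\<integral>u. (dif k F u)\<^sup>2 \<partial>Q)"
    using integral_dif_mult_dif[OF F F] by (simp add: power2_eq_square)
  finally show ?thesis by simp
qed

text \<open>
  \<open>\<phi> (cexp (- {k}) F)\<close> does not depend on coordinate \<open>k\<close>, so it may be subtracted from \<open>\<phi> (F)\<close>
  without changing \<open>dif k\<close>.
\<close>

lemma integral_dif_lipschitz:
  fixes \<phi> :: "real \<Rightarrow> real"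
  assumes F: "F \<in> L2 Q" and \<phi>: "1-lipschitz_on UNIV \<phi>"
  shows "(\<lambda>u. \<phi> (F u)) \<in> L2 Q"
    and "(\<integral>u. (dif k (\<lambda>u. \<phi> (F u)) u)\<^sup>2 \<partial>Q) \<le> (\<integral>u. (dif k F u)\<^sup>2 \<partial>Q)"
proof -
  have lip: "\<bar>\<phi> x - \<phi> y\<bar> \<le> \<bar>x - y\<bar>" for x y
    using lipschitz_onD[OF \<phi>, of x y] by (simp add: dist_real_def)
  have [measurable]: "\<phi> \<in> borel_measurable borel" "F \<in> borel_measurable Q"
    using lipschitz_on_continuous_on[OF \<phi>] F by (auto intro: borel_measurable_continuous_onI)
  have L2: "(\<lambda>u. \<phi> (G u)) \<in> L2 Q" if G: "G \<in> L2 Q" for G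
  proof -
    have [measurable]: "G \<in> borel_measurable Q" using G by auto
    have "(\<lambda>u. \<phi> (G u) - \<phi> 0) \<in> L2 Q"
      using lip[of _ 0] by (intro L2_bound[OF G]) auto
    from L2_add[OF this Q.P.L2_const[of "\<phi> 0"]] show ?thesis by simp
  qed
  show Y: "(\<lambda>u. \<phi> (F u)) \<in> L2 Q" by (rule L2[OF F])
  let ?Z = "\<lambda>u. \<phi> (cexp (- {k}) F u)"
  have Z: "?Z \<in> L2 Q" by (intro L2 cexp_L2 F)
  note YZ = L2_diff[OF Y Z]
  have *: "dif k ?Z u = 0" for u
    by (simp add: dif_def cexp_def[of _ ?Z] Q.P.prob_space)
  have "(\<integral>u. (dif k (\<lambda>u. \<phi> (F u)) u)\<^sup>2 \<partial>Q) = (\<integral>u. (dif k (\<lambda>u. \<phi> (F u) - ?Z u) u)\<^sup>2 \<partial>Q)"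
    using dif_diff[OF Q.P.L2_integrable[OF Y] Q.P.L2_integrable[OF Z], of k]
    by (intro integral_cong_AE) (auto simp: *)
  also have "\<dots> \<le> (\<integral>u. (\<phi> (F u) - ?Z u)\<^sup>2 \<partial>Q)"
    by (rule integral_dif_square_le[OF YZ])
  also have "\<dots> \<le> (\<integral>u. (dif k F u)\<^sup>2 \<partial>Q)"
    using L2D(2)[OF YZ] L2D(2)[OF dif_L2[OF F]] lip
    by (intro integral_mono) (auto simp: dif_def abs_le_square_iff[symmetric])
  finally show "(\<integral>u. (dif k (\<lambda>u. \<phi> (F u)) u)\<^sup>2 \<partial>Q) \<le> (\<integral>u. (dif k F u)\<^sup>2 \<partial>Q)" .
qed

section \<open>Taylor expansion in one resampled coordinate\<close>

lemma L2_pair_mix: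
  assumes "F \<in> L2 Q"
  shows "(\<lambda>z. F (mix B (fst z) (snd z))) \<in> L2 (Q \<Otimes>\<^sub>M Q)"
proof (rule L2I)
  have [measurable]: "F \<in> borel_measurable Q" using assms by auto
  show "(\<lambda>z. F (mix B (fst z) (snd z))) \<in> borel_measurable (Q \<Otimes>\<^sub>M Q)"
    by measurable
  show "integrable (Q \<Otimes>\<^sub>M Q) (\<lambda>z. (F (mix B (fst z) (snd z)))\<^sup>2)"
    using assms by (subst integrable_mix_iff) auto
qed

lemma L2_pair_fst: "F \<in> L2 Q \<Longrightarrow> (\<lambda>z. F (fst z)) \<in> L2 (Q \<Otimes>\<^sub>M Q)"
  using L2_pair_mix[of F UNIV] by simp

text \<open>The resampled coordinate is independent of \<open>u\<close>. Integrating over it first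
  leaves the conditional mean of \<open>dif k F\<close>, which vanishes. This removes every Taylor
  term whose coefficient depends on \<open>u\<close> alone.\<close>

lemma integral_mult_dif_mix:
  assumes F: "F \<in> L2 Q" and G: "G \<in> L2 Q"
  shows "(\<integral>z. G (fst z) * dif k F (mix (- {k}) (fst z) (snd z)) \<partial>(Q \<Otimes>\<^sub>M Q)) = 0"
proof -
  have [measurable]: "F \<in> borel_measurable Q" "G \<in> borel_measurable Q" using F G by auto
  have "integrable (Q \<Otimes>\<^sub>M Q) (\<lambda>(u, w). G u * dif k F (mix (- {k}) u w))"
    using L2_mult_integrable[OF L2_pair_fst[OF G] L2_pair_mix[OF dif_L2[OF F], of k "- {k}"]]
    by (simp add: case_prod_beta')
  from QQ.integral_fst[OF this]
  have "(\<integral>z. G (fst z) * dif k F (mix (- {k}) (fst z) (snd z)) \<partial>(Q \<Otimes>\<^sub>M Q)) =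
      (\<integral>u. G u * cexp (- {k}) (dif k F) u \<partial>Q)"
    by (simp add: case_prod_beta' cexp_def)
  also have "\<dots> = (\<integral>u. 0 \<partial>Q)"
    using cexp_dif[OF Q.P.L2_integrable[OF F], of k] by (intro integral_cong_AE) auto
  finally show ?thesis by simp
qed

text \<open>The Taylor remainder in coordinate \<open>k\<close>: this becomes the \<open>k\<close>-th block of the last two terms of the bound.\<close>

definition rem :: "nat \<Rightarrow> ((nat \<Rightarrow> 'a) \<Rightarrow> real) \<Rightarrow> ennreal" where
  "rem k F = (\<integral>\<^sup>+u. \<integral>\<^sup>+w. ennreal (\<bar>dif k F (mix (- {k}) u w)\<bar> ^ 3) \<partial>Q \<partial>Q) +
     (\<integral>\<^sup>+u. \<integral>\<^sup>+w. ennreal \<bar>dif k F (mix (- {k}) u w)\<bar> *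
        (\<integral>\<^sup>+v. ennreal ((dif k F (mix (- {k}) u v))\<^sup>2) \<partial>Q) \<partial>Q \<partial>Q)"

text \<open>For fixed \<open>v\<close> the cross term of the square is a multiple of the mean of
  \<open>a\<close> and vanishes. The integrals are exchanged because the weight depends on
  \<open>v\<close>.\<close>

lemma nn_integral_centered_square:
  assumes a: "a \<in> L2 Q" "(\<integral>w. a w \<partial>Q) = 0"
  shows "(\<integral>\<^sup>+w. \<integral>\<^sup>+v. ennreal (\<bar>a v\<bar> * (a v - a w)\<^sup>2) \<partial>Q \<partial>Q) =
    (\<integral>\<^sup>+v. ennreal (\<bar>a v\<bar> ^ 3) \<partial>Q) + (\<integral>\<^sup>+v. ennreal \<bar>a v\<bar> * (\<integral>\<^sup>+w. ennreal ((a w)\<^sup>2) \<partial>Q) \<partial>Q)"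
proof -
  have [measurable]: "a \<in> borel_measurable Q" using a by auto
  note int = L2D(2)[OF a(1)] Q.P.L2_integrable[OF a(1)]
  have *: "(\<integral>\<^sup>+w. ennreal ((x - a w)\<^sup>2) \<partial>Q) = ennreal (x\<^sup>2) + (\<integral>\<^sup>+w. ennreal ((a w)\<^sup>2) \<partial>Q)" for x
  proof -
    have i: "integrable Q (\<lambda>w. (x - a w)\<^sup>2)"
      using L2D(2)[OF L2_diff[OF Q.P.L2_const a(1)]] .
    have "(\<integral>w. (x - a w)\<^sup>2 \<partial>Q) = (\<integral>w. x\<^sup>2 + (a w)\<^sup>2 - 2 * x * a w \<partial>Q)"
      by (simp add: power2_diff)
    also have "\<dots> = x\<^sup>2 + (\<integral>w. (a w)\<^sup>2 \<partial>Q)"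
      using int a(2) by (simp add: Q.P.prob_space)
    finally show ?thesis
      using i int by (simp add: nn_integral_eq_integral)
  qed
  have "(\<integral>\<^sup>+w. \<integral>\<^sup>+v. ennreal (\<bar>a v\<bar> * (a v - a w)\<^sup>2) \<partial>Q \<partial>Q) =
    (\<integral>\<^sup>+v. \<integral>\<^sup>+w. ennreal (\<bar>a v\<bar> * (a v - a w)\<^sup>2) \<partial>Q \<partial>Q)"
    by (rule QQ.Fubini') measurable
  also have "\<dots> = (\<integral>\<^sup>+v. ennreal \<bar>a v\<bar> * (ennreal ((a v)\<^sup>2) + (\<integral>\<^sup>+w. ennreal ((a w)\<^sup>2) \<partial>Q)) \<partial>Q)"
    by (simp add: ennreal_mult nn_integral_cmult *)
  also have "\<dots> = (\<integral>\<^sup>+v. ennreal (\<bar>a v\<bar> ^ 3) + ennreal \<bar>a v\<bar> * (\<integral>\<^sup>+w. ennreal ((a w)\<^sup>2) \<partial>Q) \<partial>Q)"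
    by (intro nn_integral_cong)
       (simp add: distrib_left ennreal_mult[symmetric] power3_eq_cube power2_eq_square abs_mult_self_eq mult_ac)
  also have "\<dots> = (\<integral>\<^sup>+v. ennreal (\<bar>a v\<bar> ^ 3) \<partial>Q) + (\<integral>\<^sup>+v. ennreal \<bar>a v\<bar> * (\<integral>\<^sup>+w. ennreal ((a w)\<^sup>2) \<partial>Q) \<partial>Q)"
    by (intro nn_integral_add) measurable
  finally show ?thesis .
qed

text \<open>
  The increment \<open>F (mix (- {k}) u v) - F u\<close> involves coordinate \<open>k\<close> of \<open>u\<close> itself; resampling it by an
  independent \<open>w\<close> makes it the difference of two centred variables.
\<close>

lemma nn_integral_dif_increment:
  assumes F: "F \<in> L2 Q"
  shows "(\<integral>\<^sup>+u. \<integral>\<^sup>+v. ennreal (\<bar>dif k F (mix (- {k}) u v)\<bar> * (F (mix (- {k}) u v) - F u)\<^sup>2) \<partial>Q \<partial>Q) = rem k F"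
proof -
  have [measurable]: "F \<in> borel_measurable Q" using F by auto
  define a where "a u v = dif k F (mix (- {k}) u v)" for u v
  have [measurable]: "(\<lambda>x. a (f x) (g x)) \<in> borel_measurable M"
    if [measurable]: "f \<in> M \<rightarrow>\<^sub>M Q" "g \<in> M \<rightarrow>\<^sub>M Q" for f g and M :: "((nat \<Rightarrow> 'a) \<times> (nat \<Rightarrow> 'a)) measure"
    unfolding a_def by measurable
  have [measurable]: "(\<lambda>x. a (f x) (g x)) \<in> borel_measurable M"
    if [measurable]: "f \<in> M \<rightarrow>\<^sub>M Q" "g \<in> M \<rightarrow>\<^sub>M Q" for f g and M :: "(((nat \<Rightarrow> 'a) \<times> (nat \<Rightarrow> 'a)) \<times> (nat \<Rightarrow> 'a)) measure"
    unfolding a_def by measurable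
  have "(\<integral>\<^sup>+u. \<integral>\<^sup>+v. ennreal (\<bar>a u v\<bar> * (F (mix (- {k}) u v) - F u)\<^sup>2) \<partial>Q \<partial>Q) =
    (\<integral>\<^sup>+u. \<integral>\<^sup>+w. \<integral>\<^sup>+v. ennreal (\<bar>a (mix (- {k}) u w) v\<bar> * (F (mix (- {k}) (mix (- {k}) u w) v) - F (mix (- {k}) u w))\<^sup>2) \<partial>Q \<partial>Q \<partial>Q)"
    by (rule nn_integral_mix[symmetric]) (unfold a_def, measurable)
  \<comment> \<open>Resampling coordinate \<open>k\<close> of \<open>u\<close> does not affect
    \<open>a\<close>, and the conditional mean cancels in the increment by
    \<open>dif_mix\<close>.\<close>
  also have "\<dots> = (\<integral>\<^sup>+u. \<integral>\<^sup>+w. \<integral>\<^sup>+v. ennreal (\<bar>a u v\<bar> * (a u v - a u w)\<^sup>2) \<partial>Q \<partial>Q \<partial>Q)"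
    by (simp add: a_def dif_mix)
  also have "\<dots> = (\<integral>\<^sup>+u. (\<integral>\<^sup>+v. ennreal (\<bar>a u v\<bar> ^ 3) \<partial>Q) +
      (\<integral>\<^sup>+v. ennreal \<bar>a u v\<bar> * (\<integral>\<^sup>+w. ennreal ((a u w)\<^sup>2) \<partial>Q) \<partial>Q) \<partial>Q)"
  proof (rule nn_integral_cong_AE)
    show "AE u in Q. (\<integral>\<^sup>+w. \<integral>\<^sup>+v. ennreal (\<bar>a u v\<bar> * (a u v - a u w)\<^sup>2) \<partial>Q \<partial>Q) =
      (\<integral>\<^sup>+v. ennreal (\<bar>a u v\<bar> ^ 3) \<partial>Q) + (\<integral>\<^sup>+v. ennreal \<bar>a u v\<bar> * (\<integral>\<^sup>+w. ennreal ((a u w)\<^sup>2) \<partial>Q) \<partial>Q)"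
      using AE_L2_mix[OF dif_L2[OF F], of k "- {k}"] cexp_dif[OF Q.P.L2_integrable[OF F], of k]
      by eventually_elim (rule nn_integral_centered_square, auto simp: a_def cexp_def)
  qed
  also have "\<dots> = rem k F"
    unfolding rem_def a_def[symmetric] by (rule nn_integral_add) (unfold a_def, measurable)
  finally show ?thesis by (simp add: a_def)
qed

text \<open>The expectation of \<open>dif k F * \<phi> (F)\<close> is computed at the resampled
  point, and \<phi> is expanded around the original one. The term with \<open>\<phi> (F u)\<close>
  vanishes. The increment is \<open>dif k F\<close> at the new point plus
  \<open>cexp (- {k}) F - F\<close> at the old one: the latter contributes 0, the former gives the
  square, and the Taylor error is bounded by \<open>rem k F\<close>.\<close>

lemma integral_dif_mult_chain:
  fixes \<phi> \<phi>' :: "real \<Rightarrow> real"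
  assumes F: "F \<in> L2 Q" and lip: "1-lipschitz_on UNIV \<phi>"
    and [measurable]: "\<phi>' \<in> borel_measurable borel" and bnd: "\<And>x. \<bar>\<phi>' x\<bar> \<le> 1"
    and taylor: "\<And>x y. \<bar>\<phi> y - \<phi> x - \<phi>' x * (y - x)\<bar> \<le> (y - x)\<^sup>2"
  shows "ennreal \<bar>(\<integral>u. dif k F u * \<phi> (F u) \<partial>Q) -
      (\<integral>u. \<phi>' (F u) * cexp (- {k}) (\<lambda>u. (dif k F u)\<^sup>2) u \<partial>Q)\<bar> \<le> rem k F"
proof -
  let ?m = "\<lambda>z. mix (- {k}) (fst z) (snd z)"
  let ?c = "cexp (- {k}) F"
  have [measurable]: "F \<in> borel_measurable Q" "\<phi> \<in> borel_measurable borel"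
    using F lipschitz_on_continuous_on[OF lip] by (auto intro: borel_measurable_continuous_onI)
  note Y = integral_dif_lipschitz(1)[OF F lip]
  note D = dif_L2[OF F, of k]
  note a = L2_pair_mix[OF D, of "- {k}"]
  \<comment> \<open>The part of the first-order coefficient that sees only \<open>u\<close>;
    boundedness of \<phi>' keeps it in L2.\<close>
  have "(\<lambda>u. \<phi>' (F u) * (?c u - F u)) \<in> L2 Q"
    using bnd by (intro L2_bound[OF L2_diff[OF cexp_L2[OF F, of "- {k}"] F]])
      (use F in measurable, simp add: abs_mult mult_left_le_one_le)
  note E = this
  have i1: "integrable (Q \<Otimes>\<^sub>M Q) (\<lambda>z. dif k F (?m z) * \<phi> (F (?m z)))"
    by (rule L2_mult_integrable[OF a L2_pair_mix[OF Y]])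
  have i2: "integrable (Q \<Otimes>\<^sub>M Q) (\<lambda>z. \<phi> (F (fst z)) * dif k F (?m z))"
    by (rule L2_mult_integrable[OF L2_pair_fst[OF Y] a])
  have i3: "integrable (Q \<Otimes>\<^sub>M Q) (\<lambda>z. (\<phi>' (F (fst z)) * (?c (fst z) - F (fst z))) * dif k F (?m z))"
    by (rule L2_mult_integrable[OF L2_pair_fst[OF E] a])
  have i4: "integrable (Q \<Otimes>\<^sub>M Q) (\<lambda>z. \<phi>' (F (fst z)) * (dif k F (?m z))\<^sup>2)"
    by (rule Bochner_Integration.integrable_bound[OF L2D(2)[OF a]])
      (measurable, simp add: abs_mult mult_left_le_one_le bnd)
  let ?R = "\<lambda>z. dif k F (?m z) * (\<phi> (F (?m z)) - \<phi> (F (fst z)) - \<phi>' (F (fst z)) * (F (?m z) - F (fst z)))"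
  have R: "?R z = dif k F (?m z) * \<phi> (F (?m z)) - \<phi> (F (fst z)) * dif k F (?m z)
      - (\<phi>' (F (fst z)) * (?c (fst z) - F (fst z))) * dif k F (?m z) - \<phi>' (F (fst z)) * (dif k F (?m z))\<^sup>2" for z
    by (simp add: dif_mix power2_eq_square algebra_simps)
  have "(\<integral>z. \<phi>' (F (fst z)) * (dif k F (?m z))\<^sup>2 \<partial>(Q \<Otimes>\<^sub>M Q)) =
    (\<integral>u. \<phi>' (F u) * cexp (- {k}) (\<lambda>u. (dif k F u)\<^sup>2) u \<partial>Q)"
    using i4 QQ.integral_fst'[of "\<lambda>z. \<phi>' (F (fst z)) * (dif k F (?m z))\<^sup>2"]
    by (simp add: case_prod_beta' cexp_def)
  then have eq: "(\<integral>z. ?R z \<partial>(Q \<Otimes>\<^sub>M Q)) = (\<integral>u. dif k F u * \<phi> (F u) \<partial>Q) -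
      (\<integral>u. \<phi>' (F u) * cexp (- {k}) (\<lambda>u. (dif k F u)\<^sup>2) u \<partial>Q)"
    unfolding R using i1 i2 i3 i4 integral_mult_dif_mix[OF F Y, of k] integral_mult_dif_mix[OF F E, of k]
      integral_mix[of "\<lambda>u. dif k F u * \<phi> (F u)" "- {k}"]
    by simp
  have "ennreal \<bar>\<integral>z. ?R z \<partial>(Q \<Otimes>\<^sub>M Q)\<bar> \<le> (\<integral>\<^sup>+z. ennreal \<bar>?R z\<bar> \<partial>(Q \<Otimes>\<^sub>M Q))"
  proof -
    have "integrable (Q \<Otimes>\<^sub>M Q) ?R"
      unfolding R using i1 i2 i3 i4 by simp
    from integral_norm_bound_ennreal[OF this] show ?thesis by simp
  qed
  also have "\<dots> \<le> (\<integral>\<^sup>+z. ennreal (\<bar>dif k F (?m z)\<bar> * (F (?m z) - F (fst z))\<^sup>2) \<partial>(Q \<Otimes>\<^sub>M Q))"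
    by (intro nn_integral_mono ennreal_leI) (simp add: abs_mult mult_left_mono taylor)
  also have "\<dots> = rem k F"
    by (subst Q.nn_integral_fst[symmetric]) (simp_all add: nn_integral_dif_increment[OF F])
  finally show ?thesis unfolding eq .
qed

section \<open>Eigenfunctions of the summed differences and their L2 limits\<close>

text \<open>
  Functionals of finitely many coordinates on which the Ornstein-Uhlenbeck type operator
  \<open>\<Sum>k. dif k\<close> acts as multiplication by \<open>n\<close>.
\<close>

definition dif_eigen :: "nat \<Rightarrow> ((nat \<Rightarrow> 'a) \<Rightarrow> real) \<Rightarrow> bool" where
  "dif_eigen n Z \<longleftrightarrow> Z \<in> L2 Q \<and>
     (\<exists>m\<^sub>0. \<forall>m\<ge>m\<^sub>0. AE u in Q. real n * Z u = (\<Sum>k<m. dif k Z u))"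

text \<open>The L2 closure of the eigenfunctions. It asserts no eigenvalue equation, since
  infinitely many \<open>dif k F\<close> may be nonzero.\<close>

definition dif_eigen_lim :: "nat \<Rightarrow> ((nat \<Rightarrow> 'a) \<Rightarrow> real) \<Rightarrow> bool" where
  "dif_eigen_lim n F \<longleftrightarrow> F \<in> L2 Q \<and>
     (\<forall>e>0. \<exists>Z. dif_eigen n Z \<and> (\<integral>u. (F u - Z u)\<^sup>2 \<partial>Q) < e)"

lemma dif_eigen_limD:
  assumes "dif_eigen_lim n F" "e > 0"
  obtains Z where "dif_eigen n Z" "(\<integral>u. (F u - Z u)\<^sup>2 \<partial>Q) < e"
  using assms unfolding dif_eigen_lim_def by blast

lemma dif_eigen_diff:
  assumes "dif_eigen n Y" "dif_eigen n Z"
  shows "dif_eigen n (\<lambda>u. Y u - Z u)"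
proof -
  have Y: "Y \<in> L2 Q" and Z: "Z \<in> L2 Q" using assms by (auto simp: dif_eigen_def)
  from assms obtain a b where
    ab: "\<And>m. m \<ge> a \<Longrightarrow> AE u in Q. real n * Y u = (\<Sum>k<m. dif k Y u)"
        "\<And>m. m \<ge> b \<Longrightarrow> AE u in Q. real n * Z u = (\<Sum>k<m. dif k Z u)"
    by (auto simp: dif_eigen_def)
  have "AE u in Q. real n * (Y u - Z u) = (\<Sum>k<m. dif k (\<lambda>u. Y u - Z u) u)" if "m \<ge> max a b" for m
  proof -
    have "AE u in Q. \<forall>k. dif k (\<lambda>u. Y u - Z u) u = dif k Y u - dif k Z u"
      using dif_diff[OF Y[THEN Q.P.L2_integrable] Z[THEN Q.P.L2_integrable]] by (simp add: AE_all_countable)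
    moreover have "AE u in Q. real n * Y u = (\<Sum>k<m. dif k Y u)" "AE u in Q. real n * Z u = (\<Sum>k<m. dif k Z u)"
      using ab that by auto
    ultimately show ?thesis
      by eventually_elim (simp add: right_diff_distrib sum_subtractf)
  qed
  then show ?thesis
    unfolding dif_eigen_def using L2_diff[OF Y Z] by blast
qed

lemma dif_eigen_lim_diff:
  assumes F: "dif_eigen_lim n F" and Z: "dif_eigen n Z"
  shows "dif_eigen_lim n (\<lambda>u. F u - Z u)"
  unfolding dif_eigen_lim_def
proof (intro conjI allI impI)
  show "(\<lambda>u. F u - Z u) \<in> L2 Q"
    using assms by (intro L2_diff) (auto simp: dif_eigen_lim_def dif_eigen_def)
  fix e :: real assume "e > 0"
  then obtain Y where "dif_eigen n Y" "(\<integral>u. (F u - Y u)\<^sup>2 \<partial>Q) < e"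
    using F by (auto simp: dif_eigen_lim_def)
  then show "\<exists>Y. dif_eigen n Y \<and> (\<integral>u. (F u - Z u - Y u)\<^sup>2 \<partial>Q) < e"
    using Z by (intro exI[of _ "\<lambda>u. Y u - Z u"]) (auto intro: dif_eigen_diff)
qed

text \<open>Each square norm of \<open>dif k Z\<close> is the scalar product of
  \<open>dif k Z\<close> with \<open>Z\<close>, and the eigenvalue relation sums these to
  \<open>n\<close> times the square norm of \<open>Z\<close>. Raising \<open>m\<close> to the
  threshold only adds nonnegative terms.\<close>

lemma dif_eigen_sum_square:
  assumes "dif_eigen n Z"
  shows "(\<Sum>k<m. \<integral>u. (dif k Z u)\<^sup>2 \<partial>Q) \<le> real n * (\<integral>u. (Z u)\<^sup>2 \<partial>Q)"
proof -
  have Z: "Z \<in> L2 Q" using assms by (auto simp: dif_eigen_def)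
  then have [measurable]: "Z \<in> borel_measurable Q" by auto
  from assms obtain a where a: "\<And>m. m \<ge> a \<Longrightarrow> AE u in Q. real n * Z u = (\<Sum>k<m. dif k Z u)"
    by (auto simp: dif_eigen_def)
  let ?m = "max m a"
  have "(\<Sum>k<m. \<integral>u. (dif k Z u)\<^sup>2 \<partial>Q) \<le> (\<Sum>k<?m. \<integral>u. (dif k Z u)\<^sup>2 \<partial>Q)"
    by (intro sum_mono2) auto
  also have "\<dots> = (\<Sum>k<?m. \<integral>u. dif k Z u * Z u \<partial>Q)"
    using integral_dif_mult_dif[OF Z Z] by (simp add: power2_eq_square)
  also have "\<dots> = (\<integral>u. (\<Sum>k<?m. dif k Z u * Z u) \<partial>Q)"
    using L2_mult_integrable[OF dif_L2[OF Z] Z] by simp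
  also have "\<dots> = (\<integral>u. (real n * Z u) * Z u \<partial>Q)"
  proof (rule integral_cong_AE)
    show "AE u in Q. (\<Sum>k<?m. dif k Z u * Z u) = (real n * Z u) * Z u"
      using a[of ?m] by (auto simp: sum_distrib_right[symmetric])
  qed measurable
  finally show ?thesis by (simp add: power2_eq_square mult.assoc)
qed

text \<open>The factor 4 stems from using \<open>two\<close> twice: from \<open>F\<close> to an
  approximant \<open>Z\<close> and back. For fixed \<open>m\<close> only finitely many differences
  are compared, so the error vanishes with \<open>e\<close>, while the bound itself is uniform in
  \<open>m\<close>.\<close>

lemma dif_eigen_lim_sum_square:
  assumes "dif_eigen_lim n F"
  shows "(\<Sum>k<m. \<integral>u. (dif k F u)\<^sup>2 \<partial>Q) \<le> 4 * real n * (\<integral>u. (F u)\<^sup>2 \<partial>Q)"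
proof -
  have F: "F \<in> L2 Q" using assms by (auto simp: dif_eigen_lim_def)
  have two: "(x::real)\<^sup>2 \<le> 2 * y\<^sup>2 + 2 * (x - y)\<^sup>2" for x y
    using zero_le_power2[of "x - 2 * y"] by (simp add: power2_eq_square algebra_simps)
  have Iineq: "(\<integral>u. (X u)\<^sup>2 \<partial>Q) \<le> 2 * (\<integral>u. (Y u)\<^sup>2 \<partial>Q) + 2 * (\<integral>u. (X u - Y u)\<^sup>2 \<partial>Q)"
    if X: "X \<in> L2 Q" and Y: "Y \<in> L2 Q" for X Y
  proof -
    note i = X[THEN L2D(2)] Y[THEN L2D(2)] L2_diff[OF X Y, THEN L2D(2)]
    have "(\<integral>u. (X u)\<^sup>2 \<partial>Q) \<le> (\<integral>u. 2 * (Y u)\<^sup>2 + 2 * (X u - Y u)\<^sup>2 \<partial>Q)"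
      using i by (intro integral_mono two) auto
    also have "\<dots> = 2 * (\<integral>u. (Y u)\<^sup>2 \<partial>Q) + 2 * (\<integral>u. (X u - Y u)\<^sup>2 \<partial>Q)"
      using i by simp
    finally show ?thesis .
  qed
  have main: "(\<Sum>k<m. \<integral>u. (dif k F u)\<^sup>2 \<partial>Q) \<le> 4 * real n * (\<integral>u. (F u)\<^sup>2 \<partial>Q) + (4 * real n + 2 * real m) * e"
    if e: "e > 0" for e
  proof -
    obtain Z where Z: "dif_eigen n Z" "(\<integral>u. (F u - Z u)\<^sup>2 \<partial>Q) < e"
      using assms e unfolding dif_eigen_lim_def by blast
    then have ZL: "Z \<in> L2 Q" by (auto simp: dif_eigen_def)
    have [measurable]: "Z \<in> borel_measurable Q" "F \<in> borel_measurable Q" using F ZL by auto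
    have "(\<Sum>k<m. \<integral>u. (dif k F u)\<^sup>2 \<partial>Q) \<le> (\<Sum>k<m. 2 * (\<integral>u. (dif k Z u)\<^sup>2 \<partial>Q) + 2 * e)"
    proof (rule sum_mono)
      fix k
      have "(\<integral>u. (dif k F u - dif k Z u)\<^sup>2 \<partial>Q) = (\<integral>u. (dif k (\<lambda>u. F u - Z u) u)\<^sup>2 \<partial>Q)"
        using dif_diff[OF F[THEN Q.P.L2_integrable] ZL[THEN Q.P.L2_integrable], of k]
        by (intro integral_cong_AE) auto
      also have "\<dots> \<le> e"
        using integral_dif_square_le[OF L2_diff[OF F ZL], of k] Z(2) by simp
      finally show "(\<integral>u. (dif k F u)\<^sup>2 \<partial>Q) \<le> 2 * (\<integral>u. (dif k Z u)\<^sup>2 \<partial>Q) + 2 * e"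
        using Iineq[OF dif_L2[OF F, of k] dif_L2[OF ZL, of k]] by simp
    qed
    also have "\<dots> = 2 * (\<Sum>k<m. \<integral>u. (dif k Z u)\<^sup>2 \<partial>Q) + 2 * real m * e"
      by (simp add: sum.distrib sum_distrib_left)
    also have "\<dots> \<le> 2 * (real n * (\<integral>u. (Z u)\<^sup>2 \<partial>Q)) + 2 * real m * e"
      using dif_eigen_sum_square[OF Z(1), of m] by simp
    also have "\<dots> \<le> 2 * (real n * (2 * (\<integral>u. (F u)\<^sup>2 \<partial>Q) + 2 * e)) + 2 * real m * e"
      using Iineq[OF ZL F] Z(2) by (intro add_mono mult_left_mono) (auto simp: power2_commute)
    finally show ?thesis by (simp add: algebra_simps)
  qed
  show ?thesis
  proof (rule field_le_epsilon)
    fix e :: real assume e: "e > 0"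
    \<comment> \<open>The sum \<open>?c\<close> may be 0; dividing by \<open>?c + 1\<close> avoids
      that case.\<close>
    let ?c = "4 * real n + 2 * real m"
    have "?c * (e / (?c + 1)) \<le> (?c + 1) * (e / (?c + 1))"
      using e by (intro mult_right_mono) auto
    also have "\<dots> = e" by (simp add: add_nonneg_eq_0_iff)
    finally show "(\<Sum>k<m. \<integral>u. (dif k F u)\<^sup>2 \<partial>Q) \<le> 4 * real n * (\<integral>u. (F u)\<^sup>2 \<partial>Q) + e"
      using main[of "e / (?c + 1)"] e by (simp add: add_nonneg_pos)
  qed
qed

text \<open>For an approximant the identity is exact from some \<open>m\<close> on. The contribution
  of \<open>F - Z\<close> is bounded uniformly in \<open>m\<close> by Cauchy-Schwarz, first in the
  integral and then in \<open>k\<close>, with both energies controlled by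
  \<open>dif_eigen_lim_sum_square\<close>.\<close>

lemma dif_eigen_lim_LIMSEQ:
  fixes \<phi> :: "real \<Rightarrow> real"
  assumes lim: "dif_eigen_lim n F" and lip: "1-lipschitz_on UNIV \<phi>"
  shows "(\<lambda>m. \<Sum>k<m. \<integral>u. dif k F u * \<phi> (F u) \<partial>Q) \<longlonglongrightarrow> real n * (\<integral>u. F u * \<phi> (F u) \<partial>Q)"
proof (rule LIMSEQ_I)
  have F: "F \<in> L2 Q" using lim by (auto simp: dif_eigen_lim_def)
  let ?Y = "\<lambda>u. \<phi> (F u)"
  have Y: "?Y \<in> L2 Q" by (rule integral_dif_lipschitz(1)[OF F lip])
  have [measurable]: "?Y \<in> borel_measurable Q" "F \<in> borel_measurable Q" using F Y by auto
  let ?N = "\<lambda>f. sqrt (\<integral>u. (f u)\<^sup>2 \<partial>Q)"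
  \<comment> \<open>The coefficient of \<open>?N ?X\<close> in the final estimate, plus 1 to make it
    positive.\<close>
  define C where "C = real n * ?N ?Y + 4 * real n * ?N F + 1"
  have C: "C > 0" unfolding C_def by (intro add_nonneg_pos add_nonneg_nonneg) auto
  fix e :: real assume e: "e > 0"
  obtain Z where Z: "dif_eigen n Z" "(\<integral>u. (F u - Z u)\<^sup>2 \<partial>Q) < (e / C)\<^sup>2"
    using dif_eigen_limD[OF lim, of "(e / C)\<^sup>2"] e C by auto
  have ZL: "Z \<in> L2 Q" using Z by (auto simp: dif_eigen_def)
  let ?X = "\<lambda>u. F u - Z u"
  have X: "?X \<in> L2 Q" by (intro L2_diff F ZL)
  have [measurable]: "Z \<in> borel_measurable Q" using ZL by auto
  have NX: "?N ?X < e / C"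
    using Z(2) e C by (intro real_less_lsqrt) auto
  obtain m\<^sub>0 where m\<^sub>0: "\<And>m. m \<ge> m\<^sub>0 \<Longrightarrow> AE u in Q. real n * Z u = (\<Sum>k<m. dif k Z u)"
    using Z by (auto simp: dif_eigen_def)
  show "\<exists>m\<^sub>0. \<forall>m\<ge>m\<^sub>0. norm ((\<Sum>k<m. \<integral>u. dif k F u * ?Y u \<partial>Q) - real n * (\<integral>u. F u * ?Y u \<partial>Q)) < e"
  proof (intro exI allI impI)
    fix m assume "m \<ge> m\<^sub>0"
    have sumY: "(\<Sum>k<m. \<integral>u. dif k G u * ?Y u \<partial>Q) = (\<integral>u. (\<Sum>k<m. dif k G u) * ?Y u \<partial>Q)" if "G \<in> L2 Q" for G
      using L2_mult_integrable[OF dif_L2[OF that] Y] by (simp add: sum_distrib_right)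
    have "(\<Sum>k<m. \<integral>u. dif k Z u * ?Y u \<partial>Q) = (\<integral>u. (real n * Z u) * ?Y u \<partial>Q)"
      unfolding sumY[OF ZL] using m\<^sub>0[OF \<open>m \<ge> m\<^sub>0\<close>] by (intro integral_cong_AE) auto
    then have sZ: "(\<Sum>k<m. \<integral>u. dif k Z u * ?Y u \<partial>Q) = real n * (\<integral>u. Z u * ?Y u \<partial>Q)"
      by (simp add: mult.assoc)
    have dX: "(\<integral>u. dif k ?X u * ?Y u \<partial>Q) = (\<integral>u. dif k F u * ?Y u \<partial>Q) - (\<integral>u. dif k Z u * ?Y u \<partial>Q)" for k
    proof -
      have "(\<integral>u. dif k ?X u * ?Y u \<partial>Q) = (\<integral>u. dif k F u * ?Y u - dif k Z u * ?Y u \<partial>Q)"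
        using dif_diff[OF F[THEN Q.P.L2_integrable] ZL[THEN Q.P.L2_integrable], of k]
        by (intro integral_cong_AE) (auto simp: left_diff_distrib)
      then show ?thesis
        using L2_mult_integrable[OF dif_L2[OF F] Y] L2_mult_integrable[OF dif_L2[OF ZL] Y] by simp
    qed
    have XY: "(\<integral>u. ?X u * ?Y u \<partial>Q) = (\<integral>u. F u * ?Y u \<partial>Q) - (\<integral>u. Z u * ?Y u \<partial>Q)"
      using L2_mult_integrable[OF F Y] L2_mult_integrable[OF ZL Y] by (simp add: left_diff_distrib)
    have "(\<Sum>k<m. \<integral>u. dif k F u * ?Y u \<partial>Q) - real n * (\<integral>u. F u * ?Y u \<partial>Q) =
        (\<Sum>k<m. \<integral>u. dif k ?X u * ?Y u \<partial>Q) - real n * (\<integral>u. ?X u * ?Y u \<partial>Q)"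
      unfolding dX XY sum_subtractf sZ by (simp add: right_diff_distrib)
    also have "\<bar>\<dots>\<bar> \<le> (\<Sum>k<m. \<bar>\<integral>u. dif k ?X u * ?Y u \<partial>Q\<bar>) + real n * \<bar>\<integral>u. ?X u * ?Y u \<partial>Q\<bar>"
      by (intro order_trans[OF abs_triangle_ineq4] add_mono sum_abs) (simp add: abs_mult)
    also have "\<dots> \<le> (\<Sum>k<m. ?N (dif k ?X) * ?N (dif k ?Y)) + real n * (?N ?X * ?N ?Y)"
    proof (intro add_mono sum_mono mult_left_mono)
      fix k
      \<comment> \<open>Inserting the projection on the second factor as well is what makes the sum
        over \<open>k\<close> converge.\<close>
      show "\<bar>\<integral>u. dif k ?X u * ?Y u \<partial>Q\<bar> \<le> ?N (dif k ?X) * ?N (dif k ?Y)"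
        using L2_Cauchy_Schwarz[OF dif_L2[OF X] dif_L2[OF Y], of k k] integral_dif_mult_dif[OF X Y, of k] by simp
    qed (use L2_Cauchy_Schwarz[OF X Y] in auto)
    also have "(\<Sum>k<m. ?N (dif k ?X) * ?N (dif k ?Y)) \<le> L2_set (\<lambda>k. ?N (dif k ?X)) {..<m} * L2_set (\<lambda>k. ?N (dif k ?Y)) {..<m}"
      using L2_set_mult_ineq[of "\<lambda>k. ?N (dif k ?X)" "\<lambda>k. ?N (dif k ?Y)" "{..<m}"] by simp
    also have "\<dots> \<le> (2 * sqrt n * ?N ?X) * (2 * sqrt n * ?N F)"
    proof (intro mult_mono)
      have "L2_set (\<lambda>k. ?N (dif k ?X)) {..<m} = sqrt (\<Sum>k<m. \<integral>u. (dif k ?X u)\<^sup>2 \<partial>Q)"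
        by (simp add: L2_set_def)
      also have "\<dots> \<le> sqrt (4 * real n * (\<integral>u. (?X u)\<^sup>2 \<partial>Q))"
        by (rule real_sqrt_le_mono[OF dif_eigen_lim_sum_square[OF dif_eigen_lim_diff[OF lim Z(1)]]])
      finally show "L2_set (\<lambda>k. ?N (dif k ?X)) {..<m} \<le> 2 * sqrt n * ?N ?X"
        by (simp add: real_sqrt_mult)
      have "L2_set (\<lambda>k. ?N (dif k ?Y)) {..<m} = sqrt (\<Sum>k<m. \<integral>u. (dif k ?Y u)\<^sup>2 \<partial>Q)"
        by (simp add: L2_set_def)
      also have "\<dots> \<le> sqrt (\<Sum>k<m. \<integral>u. (dif k F u)\<^sup>2 \<partial>Q)"
        by (intro real_sqrt_le_mono sum_mono integral_dif_lipschitz(2)[OF F lip])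
      also have "\<dots> \<le> sqrt (4 * real n * (\<integral>u. (F u)\<^sup>2 \<partial>Q))"
        by (rule real_sqrt_le_mono[OF dif_eigen_lim_sum_square[OF lim]])
      finally show "L2_set (\<lambda>k. ?N (dif k ?Y)) {..<m} \<le> 2 * sqrt n * ?N F"
        by (simp add: real_sqrt_mult)
    qed (auto simp: L2_set_nonneg)
    also have "(2 * sqrt n * ?N ?X) * (2 * sqrt n * ?N F) = 4 * (sqrt n * sqrt n) * ?N F * ?N ?X"
      by (simp add: mult_ac)
    also have "\<dots> + real n * (?N ?X * ?N ?Y) = (C - 1) * ?N ?X"
      by (simp add: C_def algebra_simps)
    also have "\<dots> \<le> C * ?N ?X"
      by (intro mult_right_mono) auto
    also have "\<dots> < C * (e / C)"
      using NX C by (intro mult_strict_left_mono)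
    also have "\<dots> = e" using C by simp
    finally show "norm ((\<Sum>k<m. \<integral>u. dif k F u * ?Y u \<partial>Q) - real n * (\<integral>u. F u * ?Y u \<partial>Q)) < e"
      by simp
  qed
qed

text \<open>Summing the one-coordinate expansions replaces \<open>n\<close> times the expectation of
  \<open>F * \<phi> (F)\<close> by that of \<open>\<phi>' (F) * W\<close>, where \<open>W\<close> is
  the random energy, at the cost of the remainders. What is left is the expectation of
  \<open>\<phi>' (F) * (1 - W / n)\<close>, bounded through
  \<open>\<bar>\<phi>'\<bar> \<le> 1\<close> and Jensen.\<close>

theorem stein_functional_bound:
  fixes \<phi> \<phi>' :: "real \<Rightarrow> real"
  assumes n: "n \<ge> 1" and lim: "dif_eigen_lim n F" and lip: "1-lipschitz_on UNIV \<phi>"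
    and [measurable]: "\<phi>' \<in> borel_measurable borel" and bnd: "\<And>x. \<bar>\<phi>' x\<bar> \<le> 1"
    and taylor: "\<And>x y. \<bar>\<phi> y - \<phi> x - \<phi>' x * (y - x)\<bar> \<le> (y - x)\<^sup>2"
  shows "ennreal \<bar>(\<integral>u. \<phi>' (F u) - F u * \<phi> (F u) \<partial>Q)\<bar> \<le>
    ennreal_sqrt (\<integral>\<^sup>+u. e2ennreal ((1 - enn2ereal (ennreal (1 / real n) *
      (\<Sum>k. \<integral>\<^sup>+w. ennreal ((dif k F (mix (- {k}) u w))\<^sup>2) \<partial>Q)))\<^sup>2) \<partial>Q)
    + ennreal (1 / real n) * (\<Sum>k. rem k F)"
    (is "_ \<le> ennreal_sqrt (\<integral>\<^sup>+u. ?G u \<partial>Q) + _")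
proof -
  have F: "F \<in> L2 Q" using lim by (auto simp: dif_eigen_lim_def)
  have [measurable]: "F \<in> borel_measurable Q" "\<phi> \<in> borel_measurable borel"
    using F lipschitz_on_continuous_on[OF lip] by (auto intro: borel_measurable_continuous_onI)
  note Y = integral_dif_lipschitz(1)[OF F lip]
  define V where "V k = cexp (- {k}) (\<lambda>u. (dif k F u)\<^sup>2)" for k
  have V0: "0 \<le> V k u" for k u by (simp add: V_def cexp_def)
  have Vi: "integrable Q (V k)" for k
    unfolding V_def using dif_L2[OF F] by (intro integrable_cexp) auto
  have [measurable]: "V k \<in> borel_measurable Q" for k using Vi by auto
  have Vsum: "(\<Sum>k<m. \<integral>u. V k u \<partial>Q) \<le> 4 * real n * (\<integral>u. (F u)\<^sup>2 \<partial>Q)" for m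
    using dif_eigen_lim_sum_square[OF lim, of m] integral_cexp[OF dif_L2[OF F, THEN L2D(2)]] by (simp add: V_def)
  have sV: "summable (\<lambda>k. \<integral>u. V k u \<partial>Q)"
    using Vsum V0 by (intro summableI_nonneg_bounded) auto
  \<comment> \<open>Tonelli: the finite total energy forces the pointwise series to be finite almost
    surely.\<close>
  have "(\<integral>\<^sup>+u. (\<Sum>k. ennreal (V k u)) \<partial>Q) = (\<Sum>k. \<integral>\<^sup>+u. ennreal (V k u) \<partial>Q)"
    by (rule nn_integral_suminf) measurable
  also have "\<dots> = (\<Sum>k. ennreal (\<integral>u. V k u \<partial>Q))"
    using Vi V0 by (simp add: nn_integral_eq_integral)
  also have "\<dots> \<noteq> \<top>"
    using sV V0 by (simp add: suminf_ennreal2)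
  finally have "(\<integral>\<^sup>+u. (\<Sum>k. ennreal (V k u)) \<partial>Q) \<noteq> \<infinity>" by simp
  then have "AE u in Q. (\<Sum>k. ennreal (V k u)) \<noteq> \<infinity>"
    by (intro nn_integral_noteq_infinite) measurable
  then have sVu: "AE u in Q. summable (\<lambda>k. V k u)"
    by eventually_elim (use V0 in \<open>auto intro: summable_suminf_not_top\<close>)
  define W where "W u = (\<Sum>k. V k u)" for u
  have [measurable]: "W \<in> borel_measurable Q" unfolding W_def by measurable
  have Wi: "integrable Q W"
    unfolding W_def using sVu sV V0 Vi by (intro integrable_suminf) auto
  have p1: "(\<lambda>m. \<Sum>k<m. \<integral>u. \<phi>' (F u) * V k u \<partial>Q) \<longlonglongrightarrow> (\<integral>u. \<phi>' (F u) * W u \<partial>Q)"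
  proof -
    have i: "integrable Q (\<lambda>u. \<phi>' (F u) * V k u)" for k
      by (rule Bochner_Integration.integrable_bound[OF Vi[of k]])
        (measurable, simp add: abs_mult mult_left_le_one_le bnd V0)
    have "(\<lambda>k. \<integral>u. \<phi>' (F u) * V k u \<partial>Q) sums (\<integral>u. (\<Sum>k. \<phi>' (F u) * V k u) \<partial>Q)"
    proof (rule sums_integral[OF i])
      show "AE u in Q. summable (\<lambda>k. norm (\<phi>' (F u) * V k u))"
        using sVu by eventually_elim (simp add: abs_mult V0 summable_mult)
      show "summable (\<lambda>k. \<integral>u. norm (\<phi>' (F u) * V k u) \<partial>Q)"
      proof (rule summable_comparison_test'[OF sV])
        fix k
        have "(\<integral>u. norm (\<phi>' (F u) * V k u) \<partial>Q) \<le> (\<integral>u. V k u \<partial>Q)"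
          using integrable_norm[OF i[of k]] Vi[of k]
          by (intro integral_mono) (simp_all add: abs_mult V0 mult_left_le_one_le bnd)
        then show "norm (\<integral>u. norm (\<phi>' (F u) * V k u) \<partial>Q) \<le> (\<integral>u. V k u \<partial>Q)" by simp
      qed
    qed
    moreover have "(\<integral>u. (\<Sum>k. \<phi>' (F u) * V k u) \<partial>Q) = (\<integral>u. \<phi>' (F u) * W u \<partial>Q)"
      using sVu by (intro integral_cong_AE) (auto simp: W_def suminf_mult)
    ultimately show ?thesis by (simp add: sums_def)
  qed
  note p2 = dif_eigen_lim_LIMSEQ[OF lim lip]
  have bd: "ennreal \<bar>real n * (\<integral>u. F u * \<phi> (F u) \<partial>Q) - (\<integral>u. \<phi>' (F u) * W u \<partial>Q)\<bar> \<le> (\<Sum>k. rem k F)"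
  proof (rule LIMSEQ_le_const2)
    show "(\<lambda>m. ennreal \<bar>(\<Sum>k<m. \<integral>u. dif k F u * \<phi> (F u) \<partial>Q) - (\<Sum>k<m. \<integral>u. \<phi>' (F u) * V k u \<partial>Q)\<bar>) \<longlonglongrightarrow>
      ennreal \<bar>real n * (\<integral>u. F u * \<phi> (F u) \<partial>Q) - (\<integral>u. \<phi>' (F u) * W u \<partial>Q)\<bar>"
      by (intro tendsto_ennrealI tendsto_rabs tendsto_diff p1 p2)
    have "ennreal \<bar>(\<Sum>k<m. \<integral>u. dif k F u * \<phi> (F u) \<partial>Q) - (\<Sum>k<m. \<integral>u. \<phi>' (F u) * V k u \<partial>Q)\<bar> \<le> (\<Sum>k. rem k F)" for m
    proof -
      have "ennreal \<bar>(\<Sum>k<m. \<integral>u. dif k F u * \<phi> (F u) \<partial>Q) - (\<Sum>k<m. \<integral>u. \<phi>' (F u) * V k u \<partial>Q)\<bar> \<le>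
        ennreal (\<Sum>k<m. \<bar>(\<integral>u. dif k F u * \<phi> (F u) \<partial>Q) - (\<integral>u. \<phi>' (F u) * V k u \<partial>Q)\<bar>)"
        unfolding sum_subtractf[symmetric] by (intro ennreal_leI sum_abs)
      also have "\<dots> \<le> (\<Sum>k<m. rem k F)"
        unfolding V_def by (subst sum_ennreal[symmetric], simp, intro sum_mono
          integral_dif_mult_chain[OF F lip _ bnd taylor]) measurable
      also have "\<dots> \<le> (\<Sum>k. rem k F)"
        by (intro sum_le_suminf) auto
      finally show ?thesis .
    qed
    then show "\<exists>N. \<forall>m\<ge>N. ennreal \<bar>(\<Sum>k<m. \<integral>u. dif k F u * \<phi> (F u) \<partial>Q) - (\<Sum>k<m. \<integral>u. \<phi>' (F u) * V k u \<partial>Q)\<bar> \<le> (\<Sum>k. rem k F)"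
      by blast
  qed
  have i1: "integrable Q (\<lambda>u. \<phi>' (F u))"
    by (rule Bochner_Integration.integrable_bound[of Q "\<lambda>_. 1::real"]) (use bnd in auto)
  note i2 = L2_mult_integrable[OF F Y]
  have i3: "integrable Q (\<lambda>u. \<phi>' (F u) * W u)"
    by (rule Bochner_Integration.integrable_bound[OF Wi])
      (measurable, simp add: abs_mult mult_left_le_one_le bnd)
  have dec: "(\<integral>u. \<phi>' (F u) - F u * \<phi> (F u) \<partial>Q) = (\<integral>u. \<phi>' (F u) * (1 - W u / n) \<partial>Q)
      - (1 / n) * (real n * (\<integral>u. F u * \<phi> (F u) \<partial>Q) - (\<integral>u. \<phi>' (F u) * W u \<partial>Q))"
  proof -
    have "(\<integral>u. \<phi>' (F u) * (1 - W u / n) \<partial>Q) = (\<integral>u. \<phi>' (F u) - (1 / n) * (\<phi>' (F u) * W u) \<partial>Q)"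
      by (simp add: algebra_simps)
    also have "\<dots> = (\<integral>u. \<phi>' (F u) \<partial>Q) - (1 / n) * (\<integral>u. \<phi>' (F u) * W u \<partial>Q)"
      using i1 i3 by simp
    finally show ?thesis using i1 i2 n by (simp add: algebra_simps)
  qed
  \<comment> \<open>On the null set where the energy series diverges the extended-real expression is
    infinite; elsewhere it is a real square.\<close>
  have G: "AE u in Q. ?G u = ennreal ((1 - W u / n)\<^sup>2)"
  proof -
    have "AE u in Q. \<forall>k. (\<lambda>w. dif k F (mix (- {k}) u w)) \<in> L2 Q"
      using AE_L2_mix[OF dif_L2[OF F]] by (simp add: AE_all_countable)
    with sVu show ?thesis
    proof eventually_elim
      case (elim u)
      have "(\<integral>\<^sup>+w. ennreal ((dif k F (mix (- {k}) u w))\<^sup>2) \<partial>Q) = ennreal (V k u)" for k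
        using elim(2) by (subst nn_integral_eq_integral) (auto simp: V_def cexp_def)
      then have "(\<Sum>k. \<integral>\<^sup>+w. ennreal ((dif k F (mix (- {k}) u w))\<^sup>2) \<partial>Q) = ennreal (W u)"
        using elim(1) V0 by (simp add: W_def suminf_ennreal2)
      moreover have "0 \<le> W u" unfolding W_def using elim(1) V0 by (intro suminf_nonneg) auto
      ultimately show ?case
        by (simp add: ennreal_mult[symmetric] enn2ereal_ennreal one_ereal_def e2ennreal_ereal)
    qed
  qed
  have first: "ennreal \<bar>\<integral>u. \<phi>' (F u) * (1 - W u / n) \<partial>Q\<bar> \<le> ennreal_sqrt (\<integral>\<^sup>+u. ?G u \<partial>Q)"
  proof (cases "(\<integral>\<^sup>+u. ?G u \<partial>Q) = \<top>")
    case False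
    have eq: "(\<integral>\<^sup>+u. ?G u \<partial>Q) = (\<integral>\<^sup>+u. ennreal ((1 - W u / n)\<^sup>2) \<partial>Q)"
      using G by (rule nn_integral_cong_AE)
    \<comment> \<open>So far \<open>W\<close> is only integrable; its square integrability is
      exactly the finiteness supposed in this case.\<close>
    have L: "(\<lambda>u. 1 - W u / n) \<in> L2 Q"
      using False eq by (intro L2I integrableI_nonneg) (auto simp: top.not_eq_extremum)
    have L': "(\<lambda>u. \<phi>' (F u) * (1 - W u / n)) \<in> L2 Q"
      by (rule L2_bound[OF L]) (measurable, simp add: abs_mult mult_left_le_one_le bnd)
    have "\<bar>\<integral>u. \<phi>' (F u) * (1 - W u / n) \<partial>Q\<bar>\<^sup>2 \<le> (\<integral>u. (\<phi>' (F u) * (1 - W u / n))\<^sup>2 \<partial>Q)"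
      using Q.P.square_integral_le[OF L'] by simp
    also have "\<dots> \<le> (\<integral>u. (1 - W u / n)\<^sup>2 \<partial>Q)"
      using L2D(2)[OF L] L2D(2)[OF L'] bnd
      by (intro integral_mono) (auto simp: power_mult_distrib mult_left_le_one_le abs_square_le_1)
    finally have "\<bar>\<integral>u. \<phi>' (F u) * (1 - W u / n) \<partial>Q\<bar> \<le> sqrt (\<integral>u. (1 - W u / n)\<^sup>2 \<partial>Q)"
      by (rule real_le_rsqrt)
    moreover have "(\<integral>\<^sup>+u. ?G u \<partial>Q) = ennreal (\<integral>u. (1 - W u / n)\<^sup>2 \<partial>Q)"
      using eq L2D(2)[OF L] by (simp add: nn_integral_eq_integral)
    ultimately show ?thesis
      by (simp add: ennreal_sqrt_def ennreal_leI)
  qed (simp add: ennreal_sqrt_def)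
  have "ennreal \<bar>\<integral>u. \<phi>' (F u) - F u * \<phi> (F u) \<partial>Q\<bar> \<le> ennreal (\<bar>\<integral>u. \<phi>' (F u) * (1 - W u / n) \<partial>Q\<bar> +
      (1 / n) * \<bar>real n * (\<integral>u. F u * \<phi> (F u) \<partial>Q) - (\<integral>u. \<phi>' (F u) * W u \<partial>Q)\<bar>)"
    unfolding dec by (intro ennreal_leI order_trans[OF abs_triangle_ineq4]) (simp add: abs_mult)
  also have "\<dots> = ennreal \<bar>\<integral>u. \<phi>' (F u) * (1 - W u / n) \<partial>Q\<bar> +
      ennreal (1 / n) * ennreal \<bar>real n * (\<integral>u. F u * \<phi> (F u) \<partial>Q) - (\<integral>u. \<phi>' (F u) * W u \<partial>Q)\<bar>"
    by (subst ennreal_mult[symmetric]) (simp_all add: ennreal_plus[symmetric] del: ennreal_plus)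
  also have "\<dots> \<le> ennreal_sqrt (\<integral>\<^sup>+u. ?G u \<partial>Q) + ennreal (1 / n) * (\<Sum>k. rem k F)"
    by (intro add_mono mult_left_mono first bd) auto
  finally show ?thesis .
qed

section \<open>Hoeffding components and convergence of their sums\<close>

lemma integral_cexp_square_le:
  assumes F: "F \<in> L2 Q"
  shows "(\<integral>u. (cexp B F u)\<^sup>2 \<partial>Q) \<le> (\<integral>u. (F u)\<^sup>2 \<partial>Q)"
proof -
  have "(\<integral>u. (cexp B F u)\<^sup>2 \<partial>Q) \<le> (\<integral>u. cexp B (\<lambda>u. (F u)\<^sup>2) u \<partial>Q)"
  proof (rule integral_mono_AE)
    show "AE u in Q. (cexp B F u)\<^sup>2 \<le> cexp B (\<lambda>u. (F u)\<^sup>2) u"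
      using AE_L2_mix[OF F, of B]
      by eventually_elim (simp add: cexp_def Q.P.square_integral_le)
  qed (use cexp_L2[OF F, of B] F in \<open>auto intro: integrable_cexp\<close>)
  also have "\<dots> = (\<integral>u. (F u)\<^sup>2 \<partial>Q)"
    using F by (intro integral_cexp) auto
  finally show ?thesis .
qed

text \<open>
  The completely degenerate part of \<open>F\<close> in the Hoeffding decomposition, i.e. the product over
  \<open>k \<in> S\<close> of the operators \<open>dif k\<close> applied to \<open>cexp S F\<close>.
\<close>

definition hoef :: "nat set \<Rightarrow> ((nat \<Rightarrow> 'a) \<Rightarrow> real) \<Rightarrow> (nat \<Rightarrow> 'a) \<Rightarrow> real" where
  "hoef S F u = (\<Sum>B\<in>Pow S. (- 1) ^ card (S - B) * cexp B F u)"

lemma hoef_L2: "F \<in> L2 Q \<Longrightarrow> hoef S F \<in> L2 Q"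
  unfolding hoef_def[abs_def] by (intro L2_sum L2_cmult cexp_L2)

lemma hoef_diff:
  assumes S: "finite S" and F: "integrable Q F" and G: "integrable Q G"
  shows "AE u in Q. hoef S (\<lambda>u. F u - G u) u = hoef S F u - hoef S G u"
proof -
  have "AE u in Q. \<forall>B\<in>Pow S. cexp B (\<lambda>u. F u - G u) u = cexp B F u - cexp B G u"
    using S by (intro AE_finite_allI cexp_diff[OF F G]) auto
  then show ?thesis
    by eventually_elim (simp add: hoef_def right_diff_distrib sum_subtractf)
qed

text \<open>For \<open>j \<in> S\<close> the subsets of \<open>S\<close> pair off as
  \<open>B\<close> and \<open>insert j B\<close>; integrating out coordinate \<open>j\<close> makes
  the two conditional expectations equal, and their signs are opposite. For
  \<open>j \<notin> S\<close> no term depends on coordinate \<open>j\<close>.\<close>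

lemma cexp_hoef:
  assumes S: "finite S" and F: "integrable Q F"
  shows "AE u in Q. cexp (- {j}) (hoef S F) u = (if j \<in> S then 0 else hoef S F u)"
proof -
  let ?s = "\<lambda>B. (- 1 :: real) ^ card (S - B)"
  have "AE u in Q. cexp (- {j}) (hoef S F) u = (\<Sum>B\<in>Pow S. cexp (- {j}) (\<lambda>u. ?s B * cexp B F u) u)"
    unfolding hoef_def[abs_def] using F
    by (intro cexp_sum integrable_mult_right integrable_cexp)
  moreover have "AE u in Q. \<forall>B\<in>Pow S. cexp (- {j}) (cexp B F) u = cexp (- {j} \<inter> B) F u"
    using S by (intro AE_finite_allI cexp_cexp[OF F]) auto
  ultimately show ?thesis
  proof eventually_elim
    case (elim u)
    have eq: "cexp (- {j}) (hoef S F) u = (\<Sum>B\<in>Pow S. ?s B * cexp (- {j} \<inter> B) F u)"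
      unfolding elim(1) cexp_cmult using elim(2) by (intro sum.cong) auto
    show ?case
    proof (cases "j \<in> S")
      case False
      then have "- {j} \<inter> B = B" if "B \<in> Pow S" for B using that by auto
      then show ?thesis using False unfolding eq hoef_def by (auto intro!: sum.cong)
    next
      case True
      let ?T = "S - {j}"
      have "(\<Sum>B\<in>Pow S. ?s B * cexp (- {j} \<inter> B) F u) = (\<Sum>B\<in>Pow ?T \<union> insert j ` Pow ?T. ?s B * cexp (- {j} \<inter> B) F u)"
        using Pow_insert[of j ?T] insert_Diff[OF True] by simp
      also have "\<dots> = (\<Sum>B\<in>Pow ?T. ?s B * cexp (- {j} \<inter> B) F u) + (\<Sum>B\<in>insert j ` Pow ?T. ?s B * cexp (- {j} \<inter> B) F u)"
        using S by (intro sum.union_disjoint) auto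
      also have "(\<Sum>B\<in>insert j ` Pow ?T. ?s B * cexp (- {j} \<inter> B) F u) = (\<Sum>B\<in>Pow ?T. ?s (insert j B) * cexp (- {j} \<inter> insert j B) F u)"
        by (subst sum.reindex) (auto simp: inj_on_def)
      also have "(\<Sum>B\<in>Pow ?T. ?s B * cexp (- {j} \<inter> B) F u) + \<dots> = (\<Sum>B\<in>Pow ?T. 0)"
        unfolding sum.distrib[symmetric]
      proof (rule sum.cong[OF refl])
        fix B assume B: "B \<in> Pow ?T"
        then have "insert j (S - insert j B) = S - B" using True by auto
        moreover have "card (insert j (S - insert j B)) = Suc (card (S - insert j B))"
          using S by (intro card_insert_disjoint) auto
        ultimately have "card (S - B) = Suc (card (S - insert j B))" by (simp only:)
        moreover have "- {j} \<inter> insert j B = - {j} \<inter> B" by auto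
        ultimately show "?s B * cexp (- {j} \<inter> B) F u + ?s (insert j B) * cexp (- {j} \<inter> insert j B) F u = 0"
          by simp
      qed
      finally show ?thesis using True unfolding eq by simp
    qed
  qed
qed

lemma dif_hoef:
  assumes "finite S" "integrable Q F"
  shows "AE u in Q. dif j (hoef S F) u = (if j \<in> S then hoef S F u else 0)"
  using cexp_hoef[OF assms, of j] by eventually_elim (simp add: dif_def)

text \<open>A degenerate component on \<open>S\<close> is fixed by \<open>dif k\<close> for the
  \<open>n\<close> indices in \<open>S\<close> and annihilated by all others, so the operators add
  up to multiplication by \<open>n\<close>.\<close>

lemma dif_eigen_sum_hoef:
  assumes I: "finite I" "\<And>S. S \<in> I \<Longrightarrow> finite S \<and> card S = n" and H: "\<And>S. S \<in> I \<Longrightarrow> H S \<in> L2 Q"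
  shows "dif_eigen n (\<lambda>u. \<Sum>S\<in>I. c * hoef S (H S) u)"
  unfolding dif_eigen_def
proof (intro conjI exI allI impI)
  have cL2: "(\<lambda>u. c * hoef S (H S) u) \<in> L2 Q" if "S \<in> I" for S
    by (intro L2_cmult hoef_L2 H that)
  then show "(\<lambda>u. \<Sum>S\<in>I. c * hoef S (H S) u) \<in> L2 Q"
    by (rule L2_sum)
  \<comment> \<open>Beyond every index that occurs in a member of \<open>I\<close>.\<close>
  fix m assume m: "m \<ge> Suc (Max (\<Union>I))"
  have sub: "S \<subseteq> {..<m}" if "S \<in> I" for S
  proof
    fix x assume "x \<in> S"
    then have "x \<le> Max (\<Union>I)" using that I by (intro Max_ge) auto
    then show "x \<in> {..<m}" using m by simp
  qed
  have "AE u in Q. \<forall>k\<in>{..<m}. dif k (\<lambda>u. \<Sum>S\<in>I. c * hoef S (H S) u) u = (\<Sum>S\<in>I. c * dif k (hoef S (H S)) u)"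
  proof (rule AE_finite_allI)
    fix k
    have "AE u in Q. cexp (- {k}) (\<lambda>u. \<Sum>S\<in>I. c * hoef S (H S) u) u = (\<Sum>S\<in>I. cexp (- {k}) (\<lambda>u. c * hoef S (H S) u) u)"
      by (intro cexp_sum Q.P.L2_integrable cL2)
    then show "AE u in Q. dif k (\<lambda>u. \<Sum>S\<in>I. c * hoef S (H S) u) u = (\<Sum>S\<in>I. c * dif k (hoef S (H S)) u)"
      by eventually_elim (simp add: dif_def cexp_cmult right_diff_distrib sum_subtractf)
  qed simp
  moreover have "AE u in Q. \<forall>k\<in>{..<m}. \<forall>S\<in>I. dif k (hoef S (H S)) u = (if k \<in> S then hoef S (H S) u else 0)"
    using I by (intro AE_finite_allI dif_hoef Q.P.L2_integrable H) auto
  ultimately show "AE u in Q. real n * (\<Sum>S\<in>I. c * hoef S (H S) u) = (\<Sum>k<m. dif k (\<lambda>u. \<Sum>S\<in>I. c * hoef S (H S) u) u)"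
  proof eventually_elim
    case (elim u)
    have "(\<Sum>k<m. dif k (\<lambda>u. \<Sum>S\<in>I. c * hoef S (H S) u) u) = (\<Sum>k<m. \<Sum>S\<in>I. if k \<in> S then c * hoef S (H S) u else 0)"
      using elim by (auto intro!: sum.cong)
    also have "\<dots> = (\<Sum>S\<in>I. \<Sum>k<m. if k \<in> S then c * hoef S (H S) u else 0)"
      by (rule sum.swap)
    also have "\<dots> = (\<Sum>S\<in>I. real n * (c * hoef S (H S) u))"
    proof (rule sum.cong[OF refl])
      fix S assume S: "S \<in> I"
      have "{..<m} \<inter> S = S" using sub[OF S] by auto
      then show "(\<Sum>k<m. if k \<in> S then c * hoef S (H S) u else 0) = real n * (c * hoef S (H S) u)"
        using I(2)[OF S] by (simp add: sum.inter_restrict[symmetric])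
    qed
    finally show ?case by (simp add: sum_distrib_left)
  qed
qed

text \<open>Equal cardinality provides \<open>j \<in> S - S'\<close>. The selfadjoint
  \<open>dif j\<close> fixes the first factor and kills the second.\<close>

lemma hoef_orthogonal:
  assumes S: "finite S" "finite S'" "card S = card S'" "S \<noteq> S'" and F: "F \<in> L2 Q" and G: "G \<in> L2 Q"
  shows "(\<integral>u. hoef S F u * hoef S' G u \<partial>Q) = 0"
proof -
  have "\<not> S \<subseteq> S'" using S card_subset_eq by blast
  then obtain j where j: "j \<in> S" "j \<notin> S'" by blast
  note F' = hoef_L2[OF F, of S] and G' = hoef_L2[OF G, of S']
  have "(\<integral>u. hoef S F u * hoef S' G u \<partial>Q) = (\<integral>u. dif j (hoef S F) u * hoef S' G u \<partial>Q)"
    using dif_hoef[OF S(1) Q.P.L2_integrable[OF F], of j] j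
    by (intro integral_cong_AE) (use F' G' in measurable, auto)
  also have "\<dots> = (\<integral>u. hoef S F u * dif j (hoef S' G) u \<partial>Q)"
    by (rule dif_adjoint[OF F' G'])
  also have "\<dots> = (\<integral>u. 0 \<partial>Q)"
    using dif_hoef[OF S(2) Q.P.L2_integrable[OF G], of j] j
    by (intro integral_cong_AE) (use F' G' in measurable, auto)
  finally show ?thesis by simp
qed

text \<open>Both factors of \<open>4 ^ card S = 2 ^ card S * 2 ^ card S\<close> count subsets: one
  comes from squaring the sum, the other from adding the contractions.\<close>

lemma integral_hoef_square_le:
  assumes S: "finite S" and F: "F \<in> L2 Q"
  shows "(\<integral>u. (hoef S F u)\<^sup>2 \<partial>Q) \<le> 4 ^ card S * (\<integral>u. (F u)\<^sup>2 \<partial>Q)"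
proof -
  note i = cexp_L2[OF F, THEN L2D(2)]
  have "(\<integral>u. (hoef S F u)\<^sup>2 \<partial>Q) \<le> (\<integral>u. 2 ^ card S * (\<Sum>B\<in>Pow S. (cexp B F u)\<^sup>2) \<partial>Q)"
  proof (rule integral_mono)
    fix u
    have "(hoef S F u)\<^sup>2 \<le> (\<Sum>B\<in>Pow S. ((- 1) ^ card (S - B) * cexp B F u)\<^sup>2) * card (Pow S)"
      unfolding hoef_def by (rule sum_squared_le_sum_of_squares)
    then show "(hoef S F u)\<^sup>2 \<le> 2 ^ card S * (\<Sum>B\<in>Pow S. (cexp B F u)\<^sup>2)"
      using S by (simp add: power_mult_distrib card_Pow mult.commute flip: power_mult)
  qed (use hoef_L2[OF F, of S] i in \<open>auto intro!: integrable_mult_right Bochner_Integration.integrable_sum\<close>)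
  also have "\<dots> = 2 ^ card S * (\<Sum>B\<in>Pow S. \<integral>u. (cexp B F u)\<^sup>2 \<partial>Q)"
    using i by simp
  also have "\<dots> \<le> 2 ^ card S * (\<Sum>B\<in>Pow S. \<integral>u. (F u)\<^sup>2 \<partial>Q)"
    by (intro mult_left_mono sum_mono integral_cexp_square_le F) auto
  also have "\<dots> = 4 ^ card S * (\<integral>u. (F u)\<^sup>2 \<partial>Q)"
    using S by (simp add: card_Pow power_mult_distrib[symmetric] flip: mult.assoc)
  finally show ?thesis .
qed

text \<open>Pythagoras: mixed terms vanish by \<open>hoef_orthogonal\<close>, so the constant does
  not depend on the number of index sets.\<close>

lemma integral_sum_hoef_square_le:
  assumes I: "finite I" "\<And>S. S \<in> I \<Longrightarrow> finite S \<and> card S = n" and H: "\<And>S. S \<in> I \<Longrightarrow> H S \<in> L2 Q"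
  shows "(\<integral>u. (\<Sum>S\<in>I. c * hoef S (H S) u)\<^sup>2 \<partial>Q) \<le> c\<^sup>2 * 4 ^ n * (\<Sum>S\<in>I. \<integral>u. (H S u)\<^sup>2 \<partial>Q)"
proof -
  note i = L2_mult_integrable[OF hoef_L2[OF H] hoef_L2[OF H]]
  have "(\<integral>u. (\<Sum>S\<in>I. c * hoef S (H S) u)\<^sup>2 \<partial>Q) = (\<integral>u. c\<^sup>2 * (\<Sum>S\<in>I. \<Sum>S'\<in>I. hoef S (H S) u * hoef S' (H S') u) \<partial>Q)"
  proof -
    have "(\<Sum>S\<in>I. c * hoef S (H S) u)\<^sup>2 = c\<^sup>2 * (\<Sum>S\<in>I. hoef S (H S) u)\<^sup>2" for u
      by (simp add: sum_distrib_left[symmetric] power_mult_distrib)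
    then show ?thesis by (simp add: power2_eq_square sum_product)
  qed
  also have "\<dots> = c\<^sup>2 * (\<Sum>S\<in>I. \<Sum>S'\<in>I. \<integral>u. hoef S (H S) u * hoef S' (H S') u \<partial>Q)"
    using i by simp
  also have "(\<Sum>S\<in>I. \<Sum>S'\<in>I. \<integral>u. hoef S (H S) u * hoef S' (H S') u \<partial>Q) = (\<Sum>S\<in>I. \<Sum>S'\<in>I. if S = S' then \<integral>u. (hoef S (H S) u)\<^sup>2 \<partial>Q else 0)"
    using I H by (intro sum.cong) (auto simp: power2_eq_square intro!: hoef_orthogonal)
  also have "\<dots> = (\<Sum>S\<in>I. \<integral>u. (hoef S (H S) u)\<^sup>2 \<partial>Q)"
    using I(1) by simp
  also have "c\<^sup>2 * \<dots> \<le> c\<^sup>2 * (\<Sum>S\<in>I. 4 ^ n * (\<integral>u. (H S u)\<^sup>2 \<partial>Q))"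
  proof (intro mult_left_mono sum_mono)
    fix S assume "S \<in> I"
    with integral_hoef_square_le[of S "H S"] I(2) H
    show "(\<integral>u. (hoef S (H S) u)\<^sup>2 \<partial>Q) \<le> 4 ^ n * (\<integral>u. (H S u)\<^sup>2 \<partial>Q)" by auto
  qed simp
  finally show ?thesis by (simp add: sum_distrib_left mult.assoc)
qed

text \<open>Turns almost sure convergence into an L2 estimate. In \<open>chaos_limit\<close>,
  \<open>Y\<close> is 0 for the norm bound and a fixed partial sum for the approximation.\<close>

lemma Fatou_L2:
  assumes T: "\<And>l. T l \<in> L2 Q" and Y: "Y \<in> L2 Q" and lim: "AE u in Q. (\<lambda>l. T l u) \<longlonglongrightarrow> g u"
    and bd: "\<And>l. l \<ge> (m::nat) \<Longrightarrow> (\<integral>u. (T l u - Y u)\<^sup>2 \<partial>Q) \<le> C"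
  shows "(\<integral>\<^sup>+u. ennreal ((g u - Y u)\<^sup>2) \<partial>Q) \<le> ennreal C"
proof -
  have [measurable]: "T l \<in> borel_measurable Q" "Y \<in> borel_measurable Q" for l using T Y by auto
  have "(\<integral>\<^sup>+u. ennreal ((g u - Y u)\<^sup>2) \<partial>Q) = (\<integral>\<^sup>+u. liminf (\<lambda>l. ennreal ((T l u - Y u)\<^sup>2)) \<partial>Q)"
  proof (rule nn_integral_cong_AE)
    show "AE u in Q. ennreal ((g u - Y u)\<^sup>2) = liminf (\<lambda>l. ennreal ((T l u - Y u)\<^sup>2))"
      using lim
    proof eventually_elim
      case (elim u)
      then have "(\<lambda>l. ennreal ((T l u - Y u)\<^sup>2)) \<longlonglongrightarrow> ennreal ((g u - Y u)\<^sup>2)"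
        by (intro tendsto_intros)
      then show ?case by (intro lim_imp_Liminf[symmetric]) simp_all
    qed
  qed
  also have "\<dots> \<le> liminf (\<lambda>l. \<integral>\<^sup>+u. ennreal ((T l u - Y u)\<^sup>2) \<partial>Q)"
    by (rule nn_integral_liminf) measurable
  also have "\<dots> \<le> ennreal C"
  proof (rule Liminf_le)
    show "eventually (\<lambda>l. (\<integral>\<^sup>+u. ennreal ((T l u - Y u)\<^sup>2) \<partial>Q) \<le> ennreal C) sequentially"
      using eventually_ge_at_top[of m]
    proof eventually_elim
      case (elim l)
      then show ?case
        using bd[OF elim] L2_diff[OF T Y, of l, THEN L2D(2)] by (simp add: nn_integral_eq_integral ennreal_leI)
    qed
  qed simp
  finally show ?thesis .
qed

definition nsets :: "nat \<Rightarrow> nat \<Rightarrow> nat set set" where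
  "nsets n m = {S. S \<subseteq> {..<m} \<and> card S = n}"

lemma nsets: "finite (nsets n m)" "S \<in> nsets n m \<Longrightarrow> finite S \<and> card S = n" "m \<le> l \<Longrightarrow> nsets n m \<subseteq> nsets n l"
  by (auto simp: nsets_def intro: finite_subset)

text \<open>The factor \<open>fact n\<close> counts the orderings of an index set, since the
  multiple integral sums over ordered tuples.\<close>

definition chaos :: "nat \<Rightarrow> (nat set \<Rightarrow> (nat \<Rightarrow> 'a) \<Rightarrow> real) \<Rightarrow> nat \<Rightarrow> (nat \<Rightarrow> 'a) \<Rightarrow> real" where
  "chaos n H m u = (\<Sum>S\<in>nsets n m. fact n * hoef S (H S) u)"

lemma chaos_L2:
  assumes "\<And>S. finite S \<Longrightarrow> card S = n \<Longrightarrow> H S \<in> L2 Q"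
  shows "chaos n H m \<in> L2 Q"
  unfolding chaos_def[abs_def] using nsets(2) assms by (intro L2_sum L2_cmult hoef_L2) auto

text \<open>The square sums of the kernels increase to a finite limit, so by orthogonality the tails
  of \<open>chaos\<close> are small in L2. The partial sums themselves are the approximating
  eigenfunctions.\<close>

lemma chaos_limit:
  assumes H: "\<And>S. finite S \<Longrightarrow> card S = n \<Longrightarrow> H S \<in> L2 Q"
    and A: "\<And>m. (\<Sum>S\<in>nsets n m. \<integral>u. (H S u)\<^sup>2 \<partial>Q) \<le> A"
    and lim: "AE u in Q. (\<lambda>m. chaos n H m u) \<longlonglongrightarrow> g u"
  shows "(\<integral>\<^sup>+u. ennreal ((g u)\<^sup>2) \<partial>Q) \<le> ennreal ((fact n)\<^sup>2 * 4 ^ n * A)"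
    and "e > 0 \<Longrightarrow> \<exists>Z. dif_eigen n Z \<and> (\<integral>\<^sup>+u. ennreal ((g u - Z u)\<^sup>2) \<partial>Q) < ennreal e"
proof -
  let ?C = "(fact n)\<^sup>2 * 4 ^ n :: real"
  let ?a = "\<lambda>m. \<Sum>S\<in>nsets n m. \<integral>u. (H S u)\<^sup>2 \<partial>Q"
  note cL2 = chaos_L2[where H=H, OF H]
  have H': "H S \<in> L2 Q" if "S \<in> nsets n m" for S m using nsets(2)[OF that] H by auto
  have sq: "(\<integral>u. (chaos n H l u)\<^sup>2 \<partial>Q) \<le> ?C * ?a l" for l
    unfolding chaos_def by (intro integral_sum_hoef_square_le nsets H')
  have "(\<integral>\<^sup>+u. ennreal ((g u - 0)\<^sup>2) \<partial>Q) \<le> ennreal (?C * A)"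
  proof (rule Fatou_L2[OF cL2 L2_zero lim])
    fix l show "(\<integral>u. (chaos n H l u - 0)\<^sup>2 \<partial>Q) \<le> ?C * A"
      using order_trans[OF sq[of l] mult_left_mono[OF A[of l], of ?C]] by simp
  qed auto
  then show "(\<integral>\<^sup>+u. ennreal ((g u)\<^sup>2) \<partial>Q) \<le> ennreal (?C * A)" by simp
  assume e: "e > 0"
  have diff: "(\<integral>u. (chaos n H l u - chaos n H m u)\<^sup>2 \<partial>Q) \<le> ?C * (?a l - ?a m)" if "m \<le> l" for m l
  proof -
    have "chaos n H l u - chaos n H m u = (\<Sum>S\<in>nsets n l - nsets n m. fact n * hoef S (H S) u)" for u
      unfolding chaos_def using nsets(3)[OF that] by (simp add: sum_diff nsets(1))
    moreover have "?a l - ?a m = (\<Sum>S\<in>nsets n l - nsets n m. \<integral>u. (H S u)\<^sup>2 \<partial>Q)"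
      using nsets(3)[OF that] by (simp add: sum_diff nsets(1))
    ultimately show ?thesis
      using nsets by (simp only:) (intro integral_sum_hoef_square_le, auto intro: H')
  qed
  have "incseq ?a"
    by (intro incseq_SucI sum_mono2 nsets) auto
  from incseq_convergent[OF this, of A] A obtain L where L: "?a \<longlonglongrightarrow> L" "\<And>i. ?a i \<le> L" by auto
  have "(\<lambda>m. ?C * (L - ?a m)) \<longlonglongrightarrow> ?C * (L - L)"
    by (intro tendsto_intros L)
  then have "eventually (\<lambda>m. ?C * (L - ?a m) < e) sequentially"
    using e by (intro order_tendstoD) auto
  then obtain m where m: "?C * (L - ?a m) < e" by (auto simp: eventually_sequentially)
  have "(\<integral>\<^sup>+u. ennreal ((g u - chaos n H m u)\<^sup>2) \<partial>Q) \<le> ennreal (?C * (L - ?a m))"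
  proof (rule Fatou_L2[OF cL2 cL2 lim])
    fix l assume "m \<le> l"
    then have "(\<integral>u. (chaos n H l u - chaos n H m u)\<^sup>2 \<partial>Q) \<le> ?C * (?a l - ?a m)" by (rule diff)
    also have "\<dots> \<le> ?C * (L - ?a m)" using L(2)[of l] by (intro mult_left_mono) auto
    finally show "(\<integral>u. (chaos n H l u - chaos n H m u)\<^sup>2 \<partial>Q) \<le> ?C * (L - ?a m)" .
  qed auto
  also have "\<dots> < ennreal e"
    using m e by (simp add: ennreal_less_iff ennreal_lessI)
  finally have "(\<integral>\<^sup>+u. ennreal ((g u - chaos n H m u)\<^sup>2) \<partial>Q) < ennreal e" .
  moreover have "dif_eigen n (chaos n H m)"
    unfolding chaos_def[abs_def] by (intro dif_eigen_sum_hoef nsets H')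
  ultimately show "\<exists>Z. dif_eigen n Z \<and> (\<integral>\<^sup>+u. ennreal ((g u - Z u)\<^sup>2) \<partial>Q) < ennreal e"
    by blast
qed

end

section \<open>Stein's equation for Lipschitz functions\<close>

lemma int_below_deriv:
  fixes g :: "real \<Rightarrow> real"
  assumes g: "integrable lborel g" and cont: "continuous_on UNIV g"
  shows "((\<lambda>x. LBINT z:{..x}. g z) has_real_derivative g x) (at x)"
proof -
  have si: "set_integrable lborel A g" if "A \<in> sets borel" for A
    unfolding set_integrable_def by (rule integrable_mult_indicator) (use g that in auto)
  \<comment> \<open>Splitting off the fixed part below \<open>x - 1\<close> leaves an integral over
    a compact interval, where the fundamental theorem applies.\<close>
  have eq: "(LBINT z:{..y}. g z) = (LBINT z:{..x - 1}. g z) + integral {x - 1..y} g"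
    if y: "y \<in> {x - 1..x + 1}" for y
  proof -
    have "(LBINT z:{..y}. g z) = (LBINT z:{..x - 1} \<union> {x - 1<..y}. g z)"
      using y by (intro arg_cong2[where f="\<lambda>A. set_lebesgue_integral lborel A"]) auto
    also have "\<dots> = (LBINT z:{..x - 1}. g z) + (LBINT z:{x - 1<..y}. g z)"
      by (intro set_integral_Un si) auto
    also have "(LBINT z:{x - 1<..y}. g z) = (LBINT z:{x - 1..y}. g z)"
      using y interval_integral_Icc[of "x - 1" y g] interval_integral_Ioc[of "x - 1" y g] by simp
    also have "\<dots> = integral {x - 1..y} g"
      by (intro set_borel_integral_eq_integral si) auto
    finally show ?thesis .
  qed
  have "((\<lambda>y. integral {x - 1..y} g) has_real_derivative g x) (at x within {x - 1..x + 1})"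
    by (rule integral_has_real_derivative) (auto intro: continuous_on_subset[OF cont])
  then have "((\<lambda>y. integral {x - 1..y} g) has_real_derivative g x) (at x)"
    by (simp add: at_within_Icc_at)
  then have "((\<lambda>y. (LBINT z:{..x - 1}. g z) + integral {x - 1..y} g) has_real_derivative g x) (at x)"
    by (auto intro!: derivative_eq_intros)
  then show ?thesis
  proof (rule has_field_derivative_transform_within[where d=1])
    fix y :: real assume "dist y x < 1"
    then show "(LBINT z:{..x - 1}. g z) + integral {x - 1..y} g = (LBINT z:{..y}. g z)"
      by (intro eq[symmetric]) (auto simp: dist_real_def)
  qed auto
qed

lemma int_below_above:
  fixes g :: "real \<Rightarrow> real"
  assumes g: "integrable lborel g"
  shows "(LBINT z:{..x}. g z) + (LBINT z:{x<..}. g z) = (\<integral>z. g z \<partial>lborel)"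
proof -
  have si: "set_integrable lborel A g" if "A \<in> sets borel" for A
    unfolding set_integrable_def by (rule integrable_mult_indicator) (use g that in auto)
  have "(LBINT z:{..x} \<union> {x<..}. g z) = (LBINT z:{..x}. g z) + (LBINT z:{x<..}. g z)"
    by (intro set_integral_Un si) auto
  moreover have "{..x} \<union> {x<..} = UNIV" by auto
  ultimately show ?thesis by (simp add: set_lebesgue_integral_def)
qed

lemma int_below_at_top:
  fixes g :: "real \<Rightarrow> real"
  assumes g: "integrable lborel g"
  shows "((\<lambda>x. LBINT z:{..x}. g z) \<longlongrightarrow> (\<integral>z. g z \<partial>lborel)) at_top"
  unfolding set_lebesgue_integral_def
proof (rule integral_dominated_convergence_at_top[where w="\<lambda>z. \<bar>g z\<bar>"])
  show "AE z in lborel. ((\<lambda>x. indicat_real {..x} z *\<^sub>R g z) \<longlongrightarrow> g z) at_top"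
  proof (rule AE_I2)
    fix z :: real
    have "eventually (\<lambda>x. indicat_real {..x} z *\<^sub>R g z = g z) at_top"
      using eventually_ge_at_top[of z] by eventually_elim auto
    then show "((\<lambda>x. indicat_real {..x} z *\<^sub>R g z) \<longlongrightarrow> g z) at_top"
      by (rule tendsto_eventually)
  qed
qed (use g in \<open>auto simp: indicator_def\<close>)

section \<open>The normal density and lower bounds for the Mills ratio\<close>

lemma std_normal_density_le_half: "std_normal_density x \<le> 1 / 2"
proof -
  have "sqrt 4 \<le> sqrt (2 * pi)"
    using pi_gt3 by (intro real_sqrt_le_mono) simp
  then have "2 \<le> sqrt (2 * pi)" by simp
  then have "1 / sqrt (2 * pi) \<le> 1 / 2" by (simp add: field_simps)
  moreover have "exp (- x\<^sup>2 / 2) \<le> 1" by simp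
  ultimately have "1 / sqrt (2 * pi) * exp (- x\<^sup>2 / 2) \<le> 1 / 2 * 1"
    by (intro mult_mono) auto
  then show ?thesis by (simp add: std_normal_density_def)
qed

lemma DERIV_std_normal_density:
  "(std_normal_density has_real_derivative (- x * std_normal_density x)) (at x)"
  unfolding std_normal_density_def[abs_def]
  by (auto intro!: derivative_eq_intros simp: field_simps)

lemma std_normal_density_at_top: "(std_normal_density \<longlongrightarrow> 0) at_top"
proof (rule tendsto_sandwich[where f="\<lambda>_. 0" and h=inverse])
  show "eventually (\<lambda>x. std_normal_density x \<le> inverse x) at_top"
    using eventually_gt_at_top[of "0::real"]
  proof eventually_elim
    case (elim x)
    have "x \<le> 1 + x\<^sup>2 / 2"
      using zero_le_power2[of "x - 1"] by (simp add: power2_eq_square algebra_simps)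
    also have "\<dots> \<le> exp (x\<^sup>2 / 2)" by (rule exp_ge_add_one_self)
    finally have "exp (- x\<^sup>2 / 2) \<le> inverse x"
      using elim by (simp add: exp_minus field_simps)
    moreover have "1 / sqrt (2 * pi) \<le> 1"
      using pi_gt3 by simp
    ultimately have "1 / sqrt (2 * pi) * exp (- x\<^sup>2 / 2) \<le> 1 * inverse x"
      by (intro mult_mono) auto
    then show ?case by (simp add: std_normal_density_def)
  qed
  show "((\<lambda>x. inverse x) \<longlongrightarrow> (0::real)) at_top"
    by (rule tendsto_inverse_0_at_top[OF filterlim_ident])
qed simp_all

lemma integrable_std_normal: "integrable lborel std_normal_density" "(\<integral>x. std_normal_density x \<partial>lborel) = 1"
  using integrable_std_normal_moment[of 0] integral_std_normal_moment_even[of 0] by simp_all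

lemma integrable_std_normal_id:
  "integrable lborel (\<lambda>x. x * std_normal_density x)" "(\<integral>x. x * std_normal_density x \<partial>lborel) = 0"
  using integrable_std_normal_moment[of 1] integral_std_normal_moment_odd[of 0] by (simp_all add: mult.commute)

lemma continuous_std_normal_density: "continuous_on A std_normal_density"
  unfolding std_normal_density_def[abs_def] by (intro continuous_intros) auto

definition std_normal_tail :: "real \<Rightarrow> real" where
  "std_normal_tail x = (LBINT z:{x<..}. std_normal_density z)"

lemma std_normal_tail_eq: "std_normal_tail x = 1 - (LBINT z:{..x}. std_normal_density z)"
  using int_below_above[OF integrable_std_normal(1), of x] integrable_std_normal(2)
  by (simp add: std_normal_tail_def)

text \<open>A function \<open>L\<close> with \<open>x L - L' \<le> 1\<close> is a subsolution of the equation \<open>M' = x M - 1\<close> of the Mills ratio.\<close>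

lemma mills_lower_bound:
  assumes L: "\<And>x. x \<ge> 0 \<Longrightarrow> (L has_real_derivative L' x) (at x)"
    and sub: "\<And>x. x \<ge> 0 \<Longrightarrow> x * L x - L' x \<le> 1"
    and bnd: "\<And>x. x \<ge> 0 \<Longrightarrow> \<bar>L x\<bar> \<le> 1" and x: "x \<ge> 0"
  shows "L x * std_normal_density x \<le> std_normal_tail x"
proof -
  \<comment> \<open>The subsolution inequality makes \<open>?K\<close> decreasing; it tends to 0 at
    infinity, hence is nonnegative.\<close>
  let ?K = "\<lambda>x. std_normal_tail x - L x * std_normal_density x"
  have D: "(?K has_real_derivative (- std_normal_density x - (L' x * std_normal_density x + L x * (- x * std_normal_density x)))) (at x)"
    if "x \<ge> 0" for x
    unfolding std_normal_tail_eq[abs_def]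
    by (auto intro!: derivative_eq_intros L that DERIV_std_normal_density
        int_below_deriv integrable_std_normal continuous_std_normal_density)
  have "?K y \<le> ?K x" if "y \<ge> x" for y
  proof (rule DERIV_nonpos_imp_nonincreasing[OF that])
    fix z assume "x \<le> z" "z \<le> y"
    then have z: "z \<ge> 0" using x by simp
    have "(1 + L' z - z * L z) * std_normal_density z \<ge> 0"
      using sub[OF z] by (intro mult_nonneg_nonneg) auto
    then show "\<exists>d. (?K has_real_derivative d) (at z) \<and> d \<le> 0"
      by (intro exI) (rule conjI[OF D[OF z]], simp add: algebra_simps)
  qed
  then have ev: "eventually (\<lambda>y. ?K y \<le> ?K x) at_top"
    by (rule eventually_mono[OF eventually_ge_at_top])
  have "((\<lambda>y. L y * std_normal_density y) \<longlongrightarrow> 0) at_top"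
  proof (rule Lim_null_comparison[OF _ std_normal_density_at_top])
    show "eventually (\<lambda>y. norm (L y * std_normal_density y) \<le> std_normal_density y) at_top"
      using eventually_ge_at_top[of 0]
      by eventually_elim (simp add: abs_mult mult_left_le_one_le bnd)
  qed
  moreover have "(std_normal_tail \<longlongrightarrow> 1 - 1) at_top"
    unfolding std_normal_tail_eq[abs_def]
    using int_below_at_top[OF integrable_std_normal(1)] by (intro tendsto_intros) (simp add: integrable_std_normal)
  ultimately have "(?K \<longlongrightarrow> 1 - 1 - 0) at_top"
    by (intro tendsto_diff)
  then have "(?K \<longlongrightarrow> 0) at_top" by simp
  from tendsto_upperbound[OF this ev] show ?thesis by simp
qed

text \<open>\<open>x / (1 + x\<^sup>2)\<close> is a subsolution with defect
  \<open>2 / (1 + x\<^sup>2)\<^sup>2\<close>.\<close>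

lemma mills_bound_1:
  assumes "x \<ge> 0"
  shows "x * std_normal_density x \<le> (1 + x\<^sup>2) * std_normal_tail x"
proof -
  have pos: "1 + x\<^sup>2 > 0" for x :: real by (simp add: add_pos_nonneg)
  have "(x / (1 + x\<^sup>2)) * std_normal_density x \<le> std_normal_tail x"
  proof (rule mills_lower_bound[where L'="\<lambda>x. (1 - x\<^sup>2) / (1 + x\<^sup>2)\<^sup>2"])
    fix x :: real assume x: "x \<ge> 0"
    show "((\<lambda>x. x / (1 + x\<^sup>2)) has_real_derivative (1 - x\<^sup>2) / (1 + x\<^sup>2)\<^sup>2) (at x)"
      using pos[of x] by (auto intro!: derivative_eq_intros simp: power2_eq_square)
    define d where "d = 1 + x\<^sup>2"
    have d: "d > 0" "x * x = d - 1" "x\<^sup>2 = d - 1" using pos[of x] by (simp_all add: d_def power2_eq_square)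
    have "x * (x / (1 + x\<^sup>2)) - (1 - x\<^sup>2) / (1 + x\<^sup>2)\<^sup>2 = (d - 1) / d - (2 - d) / d\<^sup>2"
      using d(2,3) by simp
    also have "\<dots> = 1 - 2 / (1 + x\<^sup>2)\<^sup>2"
      unfolding d_def[symmetric] using d(1) by (simp add: field_simps power2_eq_square)
    finally have "x * (x / (1 + x\<^sup>2)) - (1 - x\<^sup>2) / (1 + x\<^sup>2)\<^sup>2 = 1 - 2 / (1 + x\<^sup>2)\<^sup>2" .
    then show "x * (x / (1 + x\<^sup>2)) - (1 - x\<^sup>2) / (1 + x\<^sup>2)\<^sup>2 \<le> 1"
      by simp
    have "x \<le> 1 + x\<^sup>2"
      using zero_le_power2[of "x - 1"] x by (simp add: power2_eq_square algebra_simps)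
    then show "\<bar>x / (1 + x\<^sup>2)\<bar> \<le> 1" using x pos[of x] by simp
  qed fact
  then show ?thesis using pos[of x] by (simp add: field_simps)
qed

text \<open>
  This bound is sharp enough near 0 for the estimate \<open>\<bar>f'\<bar> \<le> 1\<close> of the Stein solution, for which
  the previous one fails.
\<close>

lemma mills_bound_2:
  assumes "x \<ge> 0"
  shows "(x + 2) * std_normal_density x \<le> (x\<^sup>2 + 2 * x + 2) * std_normal_tail x"
proof -
  have pos: "x\<^sup>2 + 2 * x + 2 > 0" if "x \<ge> 0" for x :: real using that by (simp add: add_nonneg_pos)
  \<comment> \<open>Unlike \<open>x / (1 + x\<^sup>2)\<close>, this subsolution does not vanish at
    0. It gives the upper bound \<open>2 / (x\<^sup>2 + 2 * x + 2)\<close> for 1 minus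
    \<open>x\<close> times the Mills ratio.\<close>
  have "((x + 2) / (x\<^sup>2 + 2 * x + 2)) * std_normal_density x \<le> std_normal_tail x"
  proof (rule mills_lower_bound[where L'="\<lambda>x. ((x\<^sup>2 + 2 * x + 2) - (x + 2) * (2 * x + 2)) / (x\<^sup>2 + 2 * x + 2)\<^sup>2"])
    fix x :: real assume x: "x \<ge> 0"
    show "((\<lambda>x. (x + 2) / (x\<^sup>2 + 2 * x + 2)) has_real_derivative
        ((x\<^sup>2 + 2 * x + 2) - (x + 2) * (2 * x + 2)) / (x\<^sup>2 + 2 * x + 2)\<^sup>2) (at x)"
      using pos[OF x] by (auto intro!: derivative_eq_intros simp: power2_eq_square)
    define d where "d = x\<^sup>2 + 2 * x + 2"
    have d: "d > 0" "x * (x + 2) = d - 2" "d - (x + 2) * (2 * x + 2) = (x\<^sup>2 + 2) - 2 * d"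
      using pos[OF x] by (simp_all add: d_def power2_eq_square algebra_simps)
    have "x * ((x + 2) / d) - (d - (x + 2) * (2 * x + 2)) / d\<^sup>2 = (d - 2) / d - ((x\<^sup>2 + 2) - 2 * d) / d\<^sup>2"
      using d(2,3) by simp
    also have "\<dots> = 1 - (x\<^sup>2 + 2) / d\<^sup>2"
      using d(1) by (simp add: field_simps power2_eq_square)
    finally have "x * ((x + 2) / (x\<^sup>2 + 2 * x + 2)) - ((x\<^sup>2 + 2 * x + 2) - (x + 2) * (2 * x + 2)) / (x\<^sup>2 + 2 * x + 2)\<^sup>2
       = 1 - (x\<^sup>2 + 2) / (x\<^sup>2 + 2 * x + 2)\<^sup>2" unfolding d_def .
    then show "x * ((x + 2) / (x\<^sup>2 + 2 * x + 2)) - ((x\<^sup>2 + 2 * x + 2) - (x + 2) * (2 * x + 2)) / (x\<^sup>2 + 2 * x + 2)\<^sup>2 \<le> 1"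
      by simp
    show "\<bar>(x + 2) / (x\<^sup>2 + 2 * x + 2)\<bar> \<le> 1" using x pos[OF x] by simp
  qed fact
  then show ?thesis using pos[OF assms] by (simp add: field_simps)
qed

section \<open>The Stein solution, its symmetry and its linearity\<close>

definition std_normal_mean :: "(real \<Rightarrow> real) \<Rightarrow> real" where
  "std_normal_mean h = (\<integral>z. h z * std_normal_density z \<partial>lborel)"

text \<open>Integrating factor: if p is the density, then p' = - x p, and Stein's equation for f
  becomes (f p)' = (h - E h(N)) p.\<close>

definition stein_sol :: "(real \<Rightarrow> real) \<Rightarrow> real \<Rightarrow> real" where
  "stein_sol h x = (LBINT z:{..x}. (h z - std_normal_mean h) * std_normal_density z) / std_normal_density x"

lemma lipschitz_integrable_std_normal:
  fixes h :: "real \<Rightarrow> real"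
  assumes "C-lipschitz_on UNIV h"
  shows "integrable lborel (\<lambda>z. h z * std_normal_density z)"
proof (rule Bochner_Integration.integrable_bound)
  have [measurable]: "h \<in> borel_measurable borel"
    using lipschitz_on_continuous_on[OF assms] by (rule borel_measurable_continuous_onI)
  show "(\<lambda>z. h z * std_normal_density z) \<in> borel_measurable lborel" by measurable
  show "integrable lborel (\<lambda>z. \<bar>h 0\<bar> * std_normal_density z + C * (std_normal_density z * \<bar>z\<bar>))"
    using integrable_std_normal(1) integrable_std_normal_moment_abs[of 1] by simp
  show "AE z in lborel. norm (h z * std_normal_density z) \<le> norm (\<bar>h 0\<bar> * std_normal_density z + C * (std_normal_density z * \<bar>z\<bar>))"
  proof (rule AE_I2)
    fix z
    have "\<bar>h z - h 0\<bar> \<le> C * \<bar>z\<bar>"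
      using lipschitz_onD[OF assms, of z 0] by (simp add: dist_real_def)
    then have "\<bar>h z\<bar> \<le> \<bar>h 0\<bar> + C * \<bar>z\<bar>" by linarith
    then have "\<bar>h z\<bar> * std_normal_density z \<le> (\<bar>h 0\<bar> + C * \<bar>z\<bar>) * std_normal_density z"
      by (rule mult_right_mono) simp
    moreover have "C \<ge> 0" using assms by (rule lipschitz_on_nonneg)
    ultimately show "norm (h z * std_normal_density z) \<le> norm (\<bar>h 0\<bar> * std_normal_density z + C * (std_normal_density z * \<bar>z\<bar>))"
      by (simp add: abs_mult algebra_simps)
  qed
qed

lemma lipschitz_reflect:
  fixes h :: "real \<Rightarrow> real"
  assumes "C-lipschitz_on UNIV h"
  shows "C-lipschitz_on UNIV (\<lambda>z. - h (- z))"
proof (rule lipschitz_onI)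
  fix x y :: real
  show "dist (- h (- x)) (- h (- y)) \<le> C * dist x y"
    using lipschitz_onD[OF assms, of "- x" "- y"] by (simp add: dist_real_def abs_minus_commute)
qed (rule lipschitz_on_nonneg[OF assms])

context
  fixes h :: "real \<Rightarrow> real" and C :: real
  assumes lip: "C-lipschitz_on UNIV h"
begin

lemma stein_integrand:
  "integrable lborel (\<lambda>z. (h z - std_normal_mean h) * std_normal_density z)"
  "(\<integral>z. (h z - std_normal_mean h) * std_normal_density z \<partial>lborel) = 0"
  "continuous_on UNIV (\<lambda>z. (h z - std_normal_mean h) * std_normal_density z)"
proof -
  note i = lipschitz_integrable_std_normal[OF lip] integrable_std_normal
  show "integrable lborel (\<lambda>z. (h z - std_normal_mean h) * std_normal_density z)"
    using i by (simp add: left_diff_distrib)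
  show "(\<integral>z. (h z - std_normal_mean h) * std_normal_density z \<partial>lborel) = 0"
    using i by (simp add: left_diff_distrib std_normal_mean_def)
  show "continuous_on UNIV (\<lambda>z. (h z - std_normal_mean h) * std_normal_density z)"
    by (intro continuous_intros continuous_std_normal_density lipschitz_on_continuous_on[OF lip])
qed

lemma stein_sol_deriv:
  "(stein_sol h has_real_derivative (x * stein_sol h x + h x - std_normal_mean h)) (at x)"
proof -
  have p: "std_normal_density x \<noteq> 0" using normal_density_pos[of 1 0 x] by linarith
  have "(stein_sol h has_real_derivative
    ((h x - std_normal_mean h) * std_normal_density x * std_normal_density x -
      (LBINT z:{..x}. (h z - std_normal_mean h) * std_normal_density z) * (- x * std_normal_density x)) /
     (std_normal_density x * std_normal_density x)) (at x)"
    unfolding stein_sol_def[abs_def]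
    by (rule DERIV_divide[OF int_below_deriv[OF stein_integrand(1,3)] DERIV_std_normal_density p])
  moreover have "(a * std_normal_density x * std_normal_density x - G * (- x * std_normal_density x)) /
     (std_normal_density x * std_normal_density x) = x * (G / std_normal_density x) + a" for a G
    using p by (simp add: field_simps)
  ultimately show ?thesis
    by (simp only: stein_sol_def[symmetric] add_diff_eq)
qed

text \<open>The integrand has total integral 0. The upper-tail form is the one to which bounds for
  \<open>std_normal_tail\<close> apply when \<open>x \<ge> 0\<close>.\<close>

lemma stein_sol_above:
  "stein_sol h x = - (LBINT z:{x<..}. (h z - std_normal_mean h) * std_normal_density z) / std_normal_density x"
proof -
  have "(LBINT z:{..x}. (h z - std_normal_mean h) * std_normal_density z) =
      - (LBINT z:{x<..}. (h z - std_normal_mean h) * std_normal_density z)"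
    using int_below_above[OF stein_integrand(1), of x] stein_integrand(2) by linarith
  then show ?thesis by (simp only: stein_sol_def)
qed

text \<open>This reflection preserves Lipschitz constants and monotonicity, the outer sign being
  there for the latter. It reduces estimates at negative \<open>x\<close> to nonnegative
  ones.\<close>

lemma stein_sol_reflect:
  "std_normal_mean (\<lambda>z. - h (- z)) = - std_normal_mean h"
  "stein_sol (\<lambda>z. - h (- z)) x = stein_sol h (- x)"
proof -
  have even: "std_normal_density (- z) = std_normal_density z" for z
    by (simp add: std_normal_density_def)
  have refl: "(\<integral>z. g (- z) \<partial>lborel) = (\<integral>z. g z \<partial>lborel)" for g :: "real \<Rightarrow> real"
    using lborel_integral_real_affine[of "-1" g 0] by simp
  show mean: "std_normal_mean (\<lambda>z. - h (- z)) = - std_normal_mean h"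
    using refl[of "\<lambda>z. h z * std_normal_density z"] by (simp add: std_normal_mean_def even)
  have "(LBINT z:{..x}. (- h (- z) - std_normal_mean (\<lambda>z. - h (- z))) * std_normal_density z)
      = (\<integral>z. (\<lambda>y. indicator {- x..} y * (- (h y - std_normal_mean h) * std_normal_density y)) (- z) \<partial>lborel)"
    unfolding mean set_lebesgue_integral_def
    by (intro Bochner_Integration.integral_cong) (auto simp: indicator_def even)
  also have "\<dots> = (\<integral>y. - (indicator {- x..} y * ((h y - std_normal_mean h) * std_normal_density y)) \<partial>lborel)"
    by (subst refl, rule Bochner_Integration.integral_cong) (auto simp: algebra_simps)
  also have "\<dots> = - (LBINT z:{- x..}. (h z - std_normal_mean h) * std_normal_density z)"
    by (simp add: set_lebesgue_integral_def)
  \<comment> \<open>Reflecting a closed lower half line gives a closed upper one, whereas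
    \<open>stein_sol_above\<close> uses the open one; they differ in a null set.\<close>
  also have "(LBINT z:{- x..}. (h z - std_normal_mean h) * std_normal_density z) = (LBINT z:{- x<..}. (h z - std_normal_mean h) * std_normal_density z)"
    unfolding set_lebesgue_integral_def
  proof (rule integral_cong_AE)
    show "AE z in lborel. indicat_real {- x..} z *\<^sub>R ((h z - std_normal_mean h) * std_normal_density z) =
        indicat_real {- x<..} z *\<^sub>R ((h z - std_normal_mean h) * std_normal_density z)"
      using AE_lborel_singleton[of "- x"] by eventually_elim (auto simp: indicator_def)
  qed (use borel_measurable_integrable[OF stein_integrand(1)] in measurable)
  finally show "stein_sol (\<lambda>z. - h (- z)) x = stein_sol h (- x)"
    unfolding stein_sol_above by (simp add: stein_sol_def[of _ x] even)
qed

end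

lemma stein_sol_id_above: "(LBINT z:{x<..}. z * std_normal_density z) = std_normal_density x"
proof -
  \<comment> \<open>The derivative of the density cancels the integrand, so \<open>?g\<close> is
    constant; its limit at infinity is 0.\<close>
  let ?g = "\<lambda>x. (LBINT z:{..x}. z * std_normal_density z) + std_normal_density x"
  have "(?g has_real_derivative (x * std_normal_density x + - x * std_normal_density x)) (at x)" for x
    by (rule DERIV_add[OF int_below_deriv[OF integrable_std_normal_id(1)] DERIV_std_normal_density])
      (intro continuous_intros continuous_std_normal_density)
  then have "\<forall>x. (?g has_real_derivative 0) (at x)" by simp
  from DERIV_isconst_all[OF this] have const: "?g y = ?g x" for y .
  have "(?g \<longlongrightarrow> 0 + 0) at_top"
    using int_below_at_top[OF integrable_std_normal_id(1)] std_normal_density_at_top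
    unfolding integrable_std_normal_id(2) by (rule tendsto_add)
  moreover have "(\<lambda>y. ?g x) = ?g" by (intro ext) (rule const[symmetric])
  ultimately have "((\<lambda>y::real. ?g x) \<longlongrightarrow> 0) at_top"
    by simp
  then have "?g x = 0" by (simp add: tendsto_const_iff)
  with int_below_above[OF integrable_std_normal_id(1), of x] show ?thesis
    by (simp add: integrable_std_normal_id)
qed

lemma stein_sol_id_plus:
  fixes h :: "real \<Rightarrow> real"
  assumes lip: "C-lipschitz_on UNIV h"
  shows "std_normal_mean (\<lambda>z. z + s * h z) = s * std_normal_mean h"
    and "stein_sol (\<lambda>z. z + s * h z) x = - 1 + s * stein_sol h x"
proof -
  note i = lipschitz_integrable_std_normal[OF lip] integrable_std_normal_id integrable_std_normal
  show mean: "std_normal_mean (\<lambda>z. z + s * h z) = s * std_normal_mean h"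
    using i by (simp add: std_normal_mean_def distrib_right mult.assoc)
  have si: "set_integrable lborel {..x} g" if "integrable lborel g" for g :: "real \<Rightarrow> real"
    unfolding set_integrable_def by (rule integrable_mult_indicator) (use that in auto)
  have below: "(LBINT z:{..x}. z * std_normal_density z) = - std_normal_density x"
    using int_below_above[OF integrable_std_normal_id(1), of x]
    by (simp add: integrable_std_normal_id stein_sol_id_above)
  have "(LBINT z:{..x}. (z + s * h z - s * std_normal_mean h) * std_normal_density z) =
      (LBINT z:{..x}. z * std_normal_density z + s * ((h z - std_normal_mean h) * std_normal_density z))"
    by (simp add: algebra_simps)
  also have "\<dots> = (LBINT z:{..x}. z * std_normal_density z) +
      (LBINT z:{..x}. s * ((h z - std_normal_mean h) * std_normal_density z))"
    using stein_integrand(1)[OF lip] integrable_std_normal_id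
    by (intro set_integral_add si integrable_mult_right) auto
  also have "\<dots> = - std_normal_density x + s * (LBINT z:{..x}. (h z - std_normal_mean h) * std_normal_density z)"
    by (simp add: below)
  finally have eq: "(LBINT z:{..x}. (z + s * h z - s * std_normal_mean h) * std_normal_density z) =
      - std_normal_density x + s * (LBINT z:{..x}. (h z - std_normal_mean h) * std_normal_density z)" .
  have "std_normal_density x \<noteq> 0" using normal_density_pos[of 1 0 x] by linarith
  then show "stein_sol (\<lambda>z. z + s * h z) x = - 1 + s * stein_sol h x"
    unfolding stein_sol_def mean eq by (simp add: diff_divide_distrib)
qed

section \<open>Derivative bounds and the solution of Stein's equation\<close>

text \<open>The left-hand side is the derivative of \<open>x f x\<close> for the Stein solution \<open>f\<close>.\<close>

lemma stein_sol_mono_nonneg: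
  fixes h :: "real \<Rightarrow> real"
  assumes lip: "C-lipschitz_on UNIV h" and mono: "mono h" and x: "x \<ge> 0"
  shows "stein_sol h x + x * (x * stein_sol h x + h x - std_normal_mean h) \<le> 0"
proof -
  let ?c = "std_normal_mean h" and ?p = std_normal_density
  have p: "?p x > 0" by (simp add: normal_density_pos)
  have si: "set_integrable lborel A g" if "A \<in> sets borel" "integrable lborel g" for A and g :: "real \<Rightarrow> real"
    unfolding set_integrable_def by (rule integrable_mult_indicator) (use that in auto)
  show ?thesis
  proof (cases "h x \<le> ?c")
    case True
    \<comment> \<open>Below \<open>x\<close> the integrand is nonpositive, hence so are both
      summands of the claim.\<close>
    have "(LBINT z:{..x}. (h z - ?c) * ?p z) \<le> (LBINT z:{..x}. 0)"
    proof (rule set_integral_mono)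
      fix z assume "z \<in> {..x}"
      then have "h z - ?c \<le> 0" using monoD[OF mono, of z x] True by simp
      then show "(h z - ?c) * ?p z \<le> 0" by (intro mult_nonpos_nonneg) auto
    qed (auto intro!: si stein_integrand[OF lip])
    then have "stein_sol h x \<le> 0"
      using p by (simp add: stein_sol_def divide_nonpos_pos)
    moreover have "x * (x * stein_sol h x + h x - ?c) \<le> 0"
      using True x calculation mult_nonneg_nonpos[of x "stein_sol h x"] by (intro mult_nonneg_nonpos) auto
    ultimately show ?thesis by simp
  next
    case False
    \<comment> \<open>Above \<open>x\<close> the integrand is at least its value with
      \<open>h x\<close> in place of \<open>h z\<close>; the Mills bound then offsets the term
      \<open>x * (h x - ?c)\<close>.\<close>
    have "(h x - ?c) * std_normal_tail x = (LBINT z:{x<..}. (h x - ?c) * ?p z)"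
      by (simp add: std_normal_tail_def)
    also have "\<dots> \<le> (LBINT z:{x<..}. (h z - ?c) * ?p z)"
    proof (rule set_integral_mono)
      fix z assume "z \<in> {x<..}"
      then show "(h x - ?c) * ?p z \<le> (h z - ?c) * ?p z"
        using monoD[OF mono, of x z] by (intro mult_right_mono) auto
    qed (auto intro!: si stein_integrand[OF lip] integrable_std_normal)
    finally have "stein_sol h x * ?p x \<le> - ((h x - ?c) * std_normal_tail x)"
      using p by (simp add: stein_sol_above[OF lip])
    then have "(1 + x\<^sup>2) * (stein_sol h x * ?p x) \<le> (1 + x\<^sup>2) * (- ((h x - ?c) * std_normal_tail x))"
      by (intro mult_left_mono) auto
    also have "\<dots> = - (h x - ?c) * ((1 + x\<^sup>2) * std_normal_tail x)" by (simp add: algebra_simps)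
    also have "\<dots> \<le> - (h x - ?c) * (x * ?p x)"
      using mills_bound_1[OF x] False by (intro mult_left_mono_neg) auto
    finally have "(stein_sol h x + x * (x * stein_sol h x + h x - ?c)) * ?p x \<le> 0"
      by (simp add: power2_eq_square algebra_simps)
    then have "(stein_sol h x + x * (x * stein_sol h x + h x - ?c)) * ?p x \<le> 0 * ?p x" by simp
    then show ?thesis by (rule mult_right_le_imp_le[OF _ p])
  qed
qed

lemma stein_sol_mono:
  fixes h :: "real \<Rightarrow> real"
  assumes lip: "C-lipschitz_on UNIV h" and mono: "mono h"
  shows "stein_sol h x + x * (x * stein_sol h x + h x - std_normal_mean h) \<le> 0"
proof (cases "x \<ge> 0")
  case False
  let ?h = "\<lambda>z. - h (- z)"
  have lip': "C-lipschitz_on UNIV ?h"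
    by (rule lipschitz_reflect[OF lip])
  have "mono ?h" using mono by (auto simp: mono_def)
  from stein_sol_mono_nonneg[OF lip' this, of "- x"] False show ?thesis
    unfolding stein_sol_reflect[OF lip] by (simp add: algebra_simps)
qed (rule stein_sol_mono_nonneg[OF lip mono])

text \<open>All quantities are measured by \<open>b\<close>. The derivative times the density is
  \<open>(h x - ?c) * b * ?p x - x * ?r\<close>, with
  \<open>\<bar>h x - ?c\<bar> \<le> x + 2 * ?p x * b\<close> and
  \<open>\<bar>?r\<bar> \<le> ?p x * b\<close>. As the density is at most 1/2, the derivative is
  bounded by \<open>b * (2 * x + b)\<close>, and \<open>mills_bound_2\<close> limits
  \<open>b\<close> enough to make this at most 1.\<close>

lemma stein_sol_deriv_bound_nonneg:
  fixes h :: "real \<Rightarrow> real"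
  assumes lip: "1-lipschitz_on UNIV h" and x: "x \<ge> 0"
  shows "\<bar>x * stein_sol h x + h x - std_normal_mean h\<bar> \<le> 1"
proof -
  let ?c = "std_normal_mean h" and ?p = std_normal_density
  have p: "?p x > 0" by (simp add: normal_density_pos)
  have lipD: "\<bar>h y - h z\<bar> \<le> \<bar>y - z\<bar>" for y z
    using lipschitz_onD[OF lip, of y z] by (simp add: dist_real_def)
  have si: "set_integrable lborel A g" if "A \<in> sets borel" "integrable lborel g" for A and g :: "real \<Rightarrow> real"
    unfolding set_integrable_def by (rule integrable_mult_indicator) (use that in auto)
  note ih = lipschitz_integrable_std_normal[OF lip]
  note ip = integrable_std_normal integrable_std_normal_id
  \<comment> \<open>The mean of the positive part of N - x, divided by the density at
    \<open>x\<close>; see \<open>B\<close>.\<close>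
  define b where "b = 1 - x * std_normal_tail x / ?p x"
  have xt: "x * std_normal_tail x = ?p x * (1 - b)" using p by (simp add: b_def)
  have B: "(LBINT z:{x<..}. (z - x) * ?p z) = ?p x * b"
  proof -
    have "(LBINT z:{x<..}. (z - x) * ?p z) = (LBINT z:{x<..}. z * ?p z - x * ?p z)"
      by (simp add: left_diff_distrib)
    also have "\<dots> = (LBINT z:{x<..}. z * ?p z) - (LBINT z:{x<..}. x * ?p z)"
      using ip by (intro set_integral_diff si) auto
    also have "\<dots> = ?p x - x * std_normal_tail x"
      by (simp add: stein_sol_id_above std_normal_tail_def)
    also have "\<dots> = ?p x * b" using xt by (simp add: algebra_simps)
    finally show ?thesis .
  qed
  have b0: "b \<ge> 0"
  proof -
    have "0 \<le> (LBINT z:{x<..}. (z - x) * ?p z)"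
      unfolding set_lebesgue_integral_def by (intro integral_nonneg_AE AE_I2) (auto simp: indicator_def)
    with B p show ?thesis by (simp add: zero_le_mult_iff)
  qed
  define d where "d = x\<^sup>2 + 2 * x + 2"
  have d: "d > 0" using x by (simp add: d_def add_nonneg_pos)
  have bd: "b * d \<le> 2"
  proof -
    have "x * ((x + 2) * ?p x) \<le> x * (d * std_normal_tail x)"
      unfolding d_def using x by (intro mult_left_mono mills_bound_2) auto
    also have "\<dots> = d * (?p x * (1 - b))" using xt by (simp add: mult_ac)
    finally have "(x * (x + 2)) * ?p x \<le> (d * (1 - b)) * ?p x" by (simp add: mult_ac)
    then have "x * (x + 2) \<le> d * (1 - b)" using p by (simp add: mult_le_cancel_right)
    then show ?thesis by (simp add: d_def power2_eq_square algebra_simps)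
  qed
  \<comment> \<open>The bound is the mean of |x - N|, written as that of x - N plus twice the
    positive part of N - x.\<close>
  have c: "\<bar>h x - ?c\<bar> \<le> x + 2 * (?p x * b)"
  proof -
    have "h x - ?c = (\<integral>z. (h x - h z) * ?p z \<partial>lborel)"
      using ih ip by (simp add: std_normal_mean_def left_diff_distrib)
    also have "\<bar>\<dots>\<bar> \<le> (\<integral>z. \<bar>(h x - h z) * ?p z\<bar> \<partial>lborel)"
      by (rule integral_abs_bound)
    also have "\<dots> \<le> (\<integral>z. (x * ?p z - z * ?p z) + 2 * (indicator {x<..} z * ((z - x) * ?p z)) \<partial>lborel)"
    proof (rule integral_mono)
      have "integrable lborel (\<lambda>z. (h x - h z) * ?p z)"
        using ih ip by (simp add: left_diff_distrib)
      then show "integrable lborel (\<lambda>z. \<bar>(h x - h z) * ?p z\<bar>)" by (rule integrable_abs)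
      have "integrable lborel (\<lambda>z. (z - x) * ?p z)" using ip by (simp add: left_diff_distrib)
      from si[OF _ this, of "{x<..}"]
      show "integrable lborel (\<lambda>z. (x * ?p z - z * ?p z) + 2 * (indicator {x<..} z * ((z - x) * ?p z)))"
        using ip by (simp add: set_integrable_def)
      fix z
      have "\<bar>h x - h z\<bar> * ?p z \<le> ((x - z) + 2 * (indicator {x<..} z * (z - x))) * ?p z"
        using lipD[of x z] by (intro mult_right_mono) (auto simp: indicator_def)
      moreover have "\<bar>(h x - h z) * ?p z\<bar> = \<bar>h x - h z\<bar> * ?p z" by (simp add: abs_mult)
      ultimately show "\<bar>(h x - h z) * ?p z\<bar> \<le> (x * ?p z - z * ?p z) + 2 * (indicator {x<..} z * ((z - x) * ?p z))"
        by (simp only:) (simp add: algebra_simps)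
    qed
    also have "\<dots> = x + 2 * (?p x * b)"
    proof -
      have "integrable lborel (\<lambda>z. (z - x) * ?p z)" using ip by (simp add: left_diff_distrib)
      from si[OF _ this, of "{x<..}"] have "integrable lborel (\<lambda>z. indicator {x<..} z * ((z - x) * ?p z))"
        by (simp add: set_integrable_def)
      with ip B show ?thesis by (simp add: set_lebesgue_integral_def)
    qed
    finally show ?thesis .
  qed
  have R: "\<bar>LBINT z:{x<..}. (h z - h x) * ?p z\<bar> \<le> ?p x * b"
  proof -
    have i: "integrable lborel (\<lambda>z. (h z - h x) * ?p z)" "integrable lborel (\<lambda>z. (z - x) * ?p z)"
      using ih ip by (simp_all add: left_diff_distrib)
    have "\<bar>LBINT z:{x<..}. (h z - h x) * ?p z\<bar> \<le> (\<integral>z. \<bar>indicator {x<..} z *\<^sub>R ((h z - h x) * ?p z)\<bar> \<partial>lborel)"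
      unfolding set_lebesgue_integral_def by (rule integral_abs_bound)
    also have "\<dots> \<le> (\<integral>z. indicator {x<..} z *\<^sub>R ((z - x) * ?p z) \<partial>lborel)"
    proof (rule integral_mono)
      show "integrable lborel (\<lambda>z. \<bar>indicator {x<..} z *\<^sub>R ((h z - h x) * ?p z)\<bar>)"
        using si[OF _ i(1), of "{x<..}"] unfolding set_integrable_def by (intro integrable_abs) auto
      show "integrable lborel (\<lambda>z. indicator {x<..} z *\<^sub>R ((z - x) * ?p z))"
        using si[OF _ i(2), of "{x<..}"] unfolding set_integrable_def by auto
      fix z
      show "\<bar>indicator {x<..} z *\<^sub>R ((h z - h x) * ?p z)\<bar> \<le> indicator {x<..} z *\<^sub>R ((z - x) * ?p z)"
        using lipD[of z x] by (auto simp: indicator_def abs_mult intro!: mult_right_mono)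
    qed
    finally show ?thesis using B by (simp add: set_lebesgue_integral_def)
  qed
  let ?r = "LBINT z:{x<..}. (h z - h x) * ?p z"
  have f: "stein_sol h x * ?p x = - ((h x - ?c) * std_normal_tail x + ?r)"
  proof -
    have i: "integrable lborel (\<lambda>z. (h z - h x) * ?p z)"
      using ih ip by (simp add: left_diff_distrib)
    have "(LBINT z:{x<..}. (h z - ?c) * ?p z) = (LBINT z:{x<..}. (h x - ?c) * ?p z + (h z - h x) * ?p z)"
      by (simp add: algebra_simps)
    also have "\<dots> = (LBINT z:{x<..}. (h x - ?c) * ?p z) + ?r"
      using ip i by (intro set_integral_add si) auto
    finally show ?thesis using p by (simp add: stein_sol_above[OF lip] std_normal_tail_def)
  qed
  have "(x * stein_sol h x + h x - ?c) * ?p x = x * (stein_sol h x * ?p x) + (h x - ?c) * ?p x"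
    by (simp add: algebra_simps)
  also have "\<dots> = (h x - ?c) * (?p x - x * std_normal_tail x) - x * ?r"
    unfolding f by (simp add: algebra_simps)
  also have "\<dots> = ((h x - ?c) * b) * ?p x - x * ?r"
  proof -
    have "?p x - x * std_normal_tail x = b * ?p x" using xt by (simp add: algebra_simps)
    then show ?thesis by (simp only: mult.assoc)
  qed
  also have "\<bar>\<dots>\<bar> \<le> \<bar>((h x - ?c) * b) * ?p x\<bar> + \<bar>x * ?r\<bar>"
    by (rule abs_triangle_ineq4)
  also have "\<dots> \<le> ((x + 2 * (?p x * b)) * b) * ?p x + x * (?p x * b)"
    using c R x b0 p by (simp only: abs_mult) (intro add_mono mult_mono, auto)
  also have "\<dots> = (b * (2 * x + 2 * ?p x * b)) * ?p x"
    by (simp add: algebra_simps)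
  finally have "\<bar>x * stein_sol h x + h x - ?c\<bar> * ?p x \<le> (b * (2 * x + 2 * ?p x * b)) * ?p x"
    using p by (simp add: abs_mult)
  then have "\<bar>x * stein_sol h x + h x - ?c\<bar> \<le> b * (2 * x + 2 * ?p x * b)"
    using p by (simp add: mult_le_cancel_right)
  also have "\<dots> \<le> b * (2 * x + 1 * b)"
    using std_normal_density_le_half[of x] b0 by (intro mult_left_mono add_left_mono mult_right_mono) auto
  also have "\<dots> \<le> 1"
  proof -
    \<comment> \<open>After multiplication by \<open>d\<^sup>2\<close> and with
      \<open>b * d \<le> 2\<close>, the claim reduces to
      \<open>4 * x * d + 4 = d\<^sup>2 - x ^ 4\<close>.\<close>
    have "(b * (2 * x + b)) * d\<^sup>2 = 2 * x * d * (b * d) + (b * d) * (b * d)"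
      by (simp add: power2_eq_square algebra_simps)
    also have "\<dots> \<le> 2 * x * d * 2 + 2 * 2"
      using bd b0 d x by (intro add_mono mult_mono) auto
    also have "\<dots> = d\<^sup>2 - x ^ 4"
      by (simp add: d_def power2_eq_square power4_eq_xxxx algebra_simps)
    also have "\<dots> \<le> 1 * d\<^sup>2" by simp
    finally show ?thesis using d by (simp add: mult_le_cancel_right)
  qed
  finally show ?thesis .
qed

lemma stein_sol_deriv_bound:
  fixes h :: "real \<Rightarrow> real"
  assumes lip: "1-lipschitz_on UNIV h"
  shows "\<bar>x * stein_sol h x + h x - std_normal_mean h\<bar> \<le> 1"
proof (cases "x \<ge> 0")
  case False
  let ?h = "\<lambda>z. - h (- z)"
  have lip': "1-lipschitz_on UNIV ?h"
    by (rule lipschitz_reflect[OF lip])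
  from stein_sol_deriv_bound_nonneg[OF lip', of "- x"] False show ?thesis
    unfolding stein_sol_reflect[OF lip] by (simp add: abs_le_iff algebra_simps)
qed (rule stein_sol_deriv_bound_nonneg[OF lip])

text \<open>As \<open>h\<close> is only Lipschitz, \<phi>' need not be differentiable. Its Lipschitz
  constant 2 is read off Stein's equation instead: \<phi>' is, up to a constant, the sum of
  \<open>x * \<phi> x\<close> and \<open>h\<close>, each 1-Lipschitz. This gives the quadratic
  Taylor error with coefficient 1.\<close>

theorem stein_solution:
  fixes h :: "real \<Rightarrow> real"
  assumes lip: "1-lipschitz_on UNIV h"
  obtains \<phi> \<phi>' :: "real \<Rightarrow> real"
  where "1-lipschitz_on UNIV \<phi>" "continuous_on UNIV \<phi>'" "\<And>x. \<bar>\<phi>' x\<bar> \<le> 1"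
    "\<And>x y. \<bar>\<phi> y - \<phi> x - \<phi>' x * (y - x)\<bar> \<le> (y - x)\<^sup>2"
    "\<And>x. \<phi>' x - x * \<phi> x = h x - std_normal_mean h"
proof
  let ?f = "stein_sol h" and ?c = "std_normal_mean h"
  define f' where "f' x = x * ?f x + h x - ?c" for x
  have D: "(?f has_real_derivative f' x) (at x)" for x
    unfolding f'_def by (rule stein_sol_deriv[OF lip])
  show f'1: "\<bar>f' x\<bar> \<le> 1" for x
    unfolding f'_def by (rule stein_sol_deriv_bound[OF lip])
  show "f' x - x * ?f x = h x - ?c" for x by (simp add: f'_def)
  have lipD: "\<bar>h y - h z\<bar> \<le> \<bar>y - z\<bar>" for y z
    using lipschitz_onD[OF lip, of y z] by (simp add: dist_real_def)
  have contf: "continuous_on UNIV ?f"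
    using D by (meson DERIV_isCont continuous_at_imp_continuous_on)
  show "continuous_on UNIV f'"
    unfolding f'_def[abs_def]
    by (intro continuous_intros lipschitz_on_continuous_on[OF lip] contf)
  show "1-lipschitz_on UNIV ?f"
  proof (rule lipschitz_onI)
    fix x y :: real
    have "norm (?f x - ?f y) \<le> 1 * norm (x - y)"
      by (rule field_differentiable_bound[of UNIV _ f']) (use D f'1 in auto)
    then show "dist (?f x) (?f y) \<le> 1 * dist x y" by (simp add: dist_norm)
  qed simp
  define g' where "g' x = ?f x + x * f' x" for x
  have Dg: "((\<lambda>x. x * ?f x) has_real_derivative g' x) (at x)" for x
    unfolding g'_def by (auto intro!: derivative_eq_intros D)
  \<comment> \<open>Both \<open>id + h\<close> and \<open>id - h\<close> are monotone, and the Stein solution of \<open>id\<close> is the constant \<open>- 1\<close>.\<close>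
  have signed: "- 1 + s * g' x \<le> 0" if s: "\<bar>s\<bar> = 1" for s x
  proof -
    have lip2: "2-lipschitz_on UNIV (\<lambda>z. z + s * h z)"
    proof (rule lipschitz_onI)
      fix y z :: real
      have "\<bar>(y + s * h y) - (z + s * h z)\<bar> \<le> \<bar>y - z\<bar> + \<bar>s * (h y - h z)\<bar>"
        using abs_triangle_ineq[of "y - z" "s * (h y - h z)"] by (simp add: algebra_simps)
      then show "dist (y + s * h y) (z + s * h z) \<le> 2 * dist y z"
        using lipD[of y z] s by (simp add: dist_real_def abs_mult)
    qed simp
    have "mono (\<lambda>z. z + s * h z)"
    proof (rule monoI)
      fix y z :: real assume "y \<le> z"
      moreover have "\<bar>s * (h y - h z)\<bar> \<le> \<bar>y - z\<bar>" using lipD[of y z] s by (simp add: abs_mult)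
      ultimately show "y + s * h y \<le> z + s * h z" by (simp add: abs_le_iff right_diff_distrib)
    qed
    from stein_sol_mono[OF lip2 this, of x] show ?thesis
      unfolding stein_sol_id_plus[OF lip] by (simp add: g'_def f'_def algebra_simps)
  qed
  have g'1: "\<bar>g' x\<bar> \<le> 1" for x
    using signed[of 1 x] signed[of "- 1" x] by (simp add: abs_le_iff)
  have lip': "\<bar>f' y - f' x\<bar> \<le> 2 * \<bar>y - x\<bar>" for x y
  proof -
    have "norm (y * ?f y - x * ?f x) \<le> 1 * norm (y - x)"
      by (rule field_differentiable_bound[of UNIV _ g']) (use Dg g'1 in auto)
    moreover have "f' y - f' x = (y * ?f y - x * ?f x) + (h y - h x)"
      by (simp add: f'_def)
    ultimately show ?thesis
      using lipD[of y x] abs_triangle_ineq[of "y * ?f y - x * ?f x" "h y - h x"] by simp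
  qed
  show "\<bar>?f y - ?f x - f' x * (y - x)\<bar> \<le> (y - x)\<^sup>2" for x y
  proof -
    have *: "s * (?f y - ?f x - f' x * (y - x)) \<le> (y - x)\<^sup>2" if s: "\<bar>s\<bar> = 1" for s
    proof -
      \<comment> \<open>For either sign \<open>s\<close>, the Lipschitz bound on the derivative
        makes \<open>?\<psi>\<close> maximal at \<open>x\<close>, where it vanishes.\<close>
      let ?\<psi> = "\<lambda>y. s * (?f y - ?f x - f' x * (y - x)) - (y - x)\<^sup>2"
      have D\<psi>: "(?\<psi> has_real_derivative (s * (f' y - f' x) - 2 * (y - x))) (at y)" for y
        by (auto intro!: derivative_eq_intros D)
      have b: "\<bar>s * (f' z - f' x)\<bar> \<le> 2 * \<bar>z - x\<bar>" for z
        using lip'[of z x] s by (simp add: abs_mult)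
      have "?\<psi> y \<le> ?\<psi> x"
      proof (cases "x \<le> y")
        case True
        show ?thesis
        proof (rule DERIV_nonpos_imp_nonincreasing[OF True])
          fix z assume "x \<le> z"
          then show "\<exists>d. (?\<psi> has_real_derivative d) (at z) \<and> d \<le> 0"
            using b[of z] by (intro exI) (rule conjI[OF D\<psi>], simp add: abs_le_iff)
        qed
      next
        case False
        then have "y \<le> x" by simp
        then show ?thesis
        proof (rule DERIV_nonneg_imp_nondecreasing)
          fix z assume "z \<le> x"
          then show "\<exists>d. (?\<psi> has_real_derivative d) (at z) \<and> 0 \<le> d"
            using b[of z] by (intro exI) (rule conjI[OF D\<psi>], simp add: abs_le_iff)
        qed
      qed
      then show ?thesis by simp
    qed
    show ?thesis using *[of 1] *[of "- 1"] by (simp add: abs_le_iff)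
  qed
qed

section \<open>Multiple integrals as sums of degenerate kernels\<close>

abbreviation unif :: "real measure" where
  "unif \<equiv> uniform_measure lborel {-1..1}"

interpretation U: iid_product unif
  by (intro iid_product.intro prob_space_uniform_measure) simp_all

lemma sets_Q [measurable_cong]: "sets U.Q = sets (PiM UNIV (\<lambda>_. borel))"
  by (intro sets_PiM_cong) simp_all

lemma space_Q [simp]: "space U.Q = UNIV"
  by (auto simp: space_PiM)

text \<open>The shift carries the uniform law to the \<open>k\<close>-th block with density 1/2.
  Dropping the null endpoints yields the open interval used by \<open>obox\<close>.\<close>

lemma nn_integral_unif_shift:
  assumes [measurable]: "\<phi> \<in> borel_measurable borel"
  shows "(\<integral>\<^sup>+v. \<phi> (2 * real k + 1 + v) \<partial>unif) = (\<integral>\<^sup>+x. \<phi> x * (indicator {2 * real k<..<2 * real k + 2} x / 2) \<partial>lborel)"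
proof -
  have "(\<integral>\<^sup>+v. \<phi> (2 * real k + 1 + v) \<partial>unif) = (\<integral>\<^sup>+v. \<phi> (2 * real k + 1 + v) * indicator {-1..1} v \<partial>lborel) / 2"
    by (subst nn_integral_uniform_measure) auto
  also have "\<dots> = (\<integral>\<^sup>+v. \<phi> (2 * real k + 1 + v) * (indicator {-1..1} v / 2) \<partial>lborel)"
    by (subst nn_integral_divide[symmetric]) (auto simp: ennreal_times_divide)
  also have "\<dots> = (\<integral>\<^sup>+x. \<phi> x * (indicator {2 * real k..2 * real k + 2} x / 2) \<partial>lborel)"
    by (subst nn_integral_real_affine[where c=1 and t="2 * real k + 1"])
      (auto intro!: nn_integral_cong simp: indicator_def)
  also have "\<dots> = (\<integral>\<^sup>+x. \<phi> x * (indicator {2 * real k<..<2 * real k + 2} x / 2) \<partial>lborel)"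
    using AE_lborel_singleton[of "2 * real k"] AE_lborel_singleton[of "2 * real k + 2"]
    by (intro nn_integral_cong_AE, eventually_elim) (auto simp: indicator_def)
  finally show ?thesis .
qed

lemma AE_Q_interval: "AE u in U.Q. \<forall>k. -1 < u k \<and> u k < 1"
proof -
  have "AE v in unif. -1 < v \<and> v < 1"
    using AE_lborel_singleton[of "-1::real"] AE_lborel_singleton[of "1::real"]
    by (intro AE_uniform_measureI) auto
  from U.Q.AE_component[OF UNIV_I this] show ?thesis
    by (simp add: AE_all_countable)
qed

section \<open>Random points in the blocks and integrals over boxes\<close>

definition pt :: "nat \<Rightarrow> nat list \<Rightarrow> (nat \<Rightarrow> real) \<Rightarrow> nat \<Rightarrow> real" where
  "pt q l u = (\<lambda>i\<in>{..<q}. 2 * real (l ! i) + 1 + u (l ! i))"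

text \<open>The boxes are open, so that a point of a box in \<open>Delta\<close> determines the block indices of all coordinates.\<close>

definition obox :: "nat \<Rightarrow> nat list \<Rightarrow> (nat \<Rightarrow> real) set" where
  "obox q l = PiE {..<q} (\<lambda>i. {2 * real (l ! i)<..<2 * real (l ! i) + 2})"

lemma measurable_pt [measurable]: "pt q l \<in> U.Q \<rightarrow>\<^sub>M lebn q"
  unfolding pt_def[abs_def] by (rule measurable_restrict) measurable

lemma sets_obox [measurable]: "obox q l \<in> sets (lebn q)"
  unfolding obox_def by (intro sets_PiM_I_finite) auto

interpretation lebn: product_sigma_finite "\<lambda>_::nat. lborel :: real measure"
  by unfold_locales

text \<open>Distinct block indices make the coordinates of \<open>pt\<close> independent, so both
  sides are the product of the uniform laws on the blocks.\<close>

lemma distr_pt: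
  assumes l: "length l = q" "distinct l"
  shows "distr U.Q (lebn q) (pt q l) = density (lebn q) (\<lambda>x. indicator (obox q l) x / 2 ^ q)"
proof -
  let ?b = "\<lambda>i. {2 * real (l ! i)<..<2 * real (l ! i) + 2}"
  let ?N = "\<lambda>i. density lborel (\<lambda>x. indicator (?b i) x / 2)"
  have N: "emeasure (?N i) (space (?N i)) = 1" for i
  proof -
    have "emeasure (?N i) (space (?N i)) = (\<integral>\<^sup>+x. 1 * (indicator (?b i) x / 2) \<partial>lborel)"
      by (simp add: emeasure_density)
    also have "\<dots> = (\<integral>\<^sup>+v. 1 \<partial>unif)"
      by (subst nn_integral_unif_shift[symmetric]) simp_all
    also have "\<dots> = 1" using U.emeasure_space_1 by simp
    finally show ?thesis .
  qed
  then have pN: "prob_space (?N i)" for i by (rule prob_spaceI)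
  interpret N: product_prob_space ?N "{..<q}"
    by (intro product_prob_space.intro product_sigma_finite.intro product_prob_space_axioms.intro pN prob_space_imp_sigma_finite)
  have d1: "distr U.Q (lebn q) (pt q l) = PiM {..<q} ?N"
  proof (rule N.PiM_eqI)
    fix A assume A: "\<And>i. i \<in> {..<q} \<Longrightarrow> A i \<in> sets (?N i)"
    let ?B = "\<lambda>i. {v. 2 * real (l ! i) + 1 + v \<in> A i}"
    have B: "?B i \<in> sets borel" if "i < q" for i
    proof -
      have "(\<lambda>v. 2 * real (l ! i) + 1 + v) -` A i \<inter> space borel \<in> sets borel"
        using A[of i] that by (intro measurable_sets[where A=borel]) auto
      then show ?thesis by (simp add: vimage_def)
    qed
    have inj: "inj_on ((!) l) {..<q}"
      using l by (simp add: inj_on_nth lessThan_def)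
    have "emeasure (distr U.Q (lebn q) (pt q l)) (PiE {..<q} A) = emeasure U.Q (pt q l -` PiE {..<q} A \<inter> space U.Q)"
      using A by (intro emeasure_distr sets_PiM_I_finite) auto
    also have "pt q l -` PiE {..<q} A \<inter> space U.Q = (\<lambda>\<omega>. \<lambda>i\<in>{..<q}. \<omega> (l ! i)) -` PiE {..<q} ?B \<inter> space U.Q"
      by (auto simp: pt_def PiE_iff)
    also have "emeasure U.Q \<dots> = emeasure (distr U.Q (PiM {..<q} (\<lambda>_. unif)) (\<lambda>\<omega>. \<lambda>i\<in>{..<q}. \<omega> (l ! i))) (PiE {..<q} ?B)"
      using B by (intro emeasure_distr[symmetric] sets_PiM_I_finite measurable_restrict) auto
    also have "distr U.Q (PiM {..<q} (\<lambda>_. unif)) (\<lambda>\<omega>. \<lambda>i\<in>{..<q}. \<omega> (l ! i)) = PiM {..<q} (\<lambda>_. unif)"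
      using inj by (intro distr_PiM_reindex[where M="\<lambda>_. unif"]) (auto intro: U.prob_space_axioms)
    also have "emeasure \<dots> (PiE {..<q} ?B) = (\<Prod>i<q. emeasure unif (?B i))"
      using B by (intro U.Q.emeasure_PiM) auto
    also have "\<dots> = (\<Prod>i<q. emeasure (?N i) (A i))"
    proof (rule prod.cong[OF refl])
      fix i assume i: "i \<in> {..<q}"
      have [measurable]: "A i \<in> sets borel" using A[OF i] by simp
      have "emeasure unif (?B i) = (\<integral>\<^sup>+v. indicator (?B i) v \<partial>unif)"
        by (rule nn_integral_indicator[symmetric]) (use B i in auto)
      also have "\<dots> = (\<integral>\<^sup>+v. indicator (A i) (2 * real (l ! i) + 1 + v) \<partial>unif)"
        by (intro nn_integral_cong) (simp add: indicator_def)
      also have "\<dots> = emeasure (?N i) (A i)"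
        by (subst nn_integral_unif_shift) (auto simp: emeasure_density mult.commute)
      finally show "emeasure unif (?B i) = emeasure (?N i) (A i)" .
    qed
    finally show "emeasure (distr U.Q (lebn q) (pt q l)) (PiE {..<q} A) = (\<Prod>i<q. emeasure (?N i) (A i))" .
  qed (auto intro!: sets_PiM_cong)
  have d2: "density (lebn q) (\<lambda>x. indicator (obox q l) x / 2 ^ q) = PiM {..<q} ?N"
  proof (rule N.PiM_eqI)
    fix A assume A: "\<And>i. i \<in> {..<q} \<Longrightarrow> A i \<in> sets (?N i)"
    then have [measurable]: "PiE {..<q} A \<in> sets (lebn q)" by (intro sets_PiM_I_finite) auto
    have "emeasure (density (lebn q) (\<lambda>x. indicator (obox q l) x / 2 ^ q)) (PiE {..<q} A) =
        (\<integral>\<^sup>+x. indicator (obox q l) x / 2 ^ q * indicator (PiE {..<q} A) x \<partial>lebn q)"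
      by (rule emeasure_density) measurable
    also have "\<dots> = (\<integral>\<^sup>+x. (\<Prod>i<q. indicator (?b i) (x i) / 2 * indicator (A i) (x i)) \<partial>lebn q)"
    proof (rule nn_integral_cong)
      fix x assume x: "x \<in> space (lebn q)"
      have ind: "indicator (PiE {..<q} X) x = (\<Prod>i<q. indicator (X i) (x i) :: ennreal)" for X :: "nat \<Rightarrow> real set"
        using x by (auto simp: indicator_def space_PiM PiE_iff prod.neutral intro!: prod_zero[symmetric])
      have h: "(1 / 2 :: ennreal) ^ q = 1 / 2 ^ q"
        by (simp add: divide_ennreal_def ennreal_inverse_power)
      have "indicator (obox q l) x / 2 ^ q * indicator (PiE {..<q} A) x = (\<Prod>i<q. indicator (?b i) (x i) * (1 / 2) * indicator (A i) (x i) :: ennreal)"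
        unfolding obox_def ind prod.distrib h by (simp add: divide_ennreal_def prod.distrib ennreal_inverse_power)
      then show "(indicator (obox q l) x / 2 ^ q * indicator (PiE {..<q} A) x :: ennreal) = (\<Prod>i<q. indicator (?b i) (x i) / 2 * indicator (A i) (x i))"
        by (simp add: ennreal_times_divide)
    qed
    also have "\<dots> = (\<Prod>i<q. \<integral>\<^sup>+x. indicator (?b i) x / 2 * indicator (A i) x \<partial>lborel)"
    proof (rule lebn.product_nn_integral_prod)
      fix i assume "i \<in> {..<q}"
      then have [measurable]: "A i \<in> sets borel" using A[of i] by simp
      show "(\<lambda>x. indicator (?b i) x / 2 * indicator (A i) x :: ennreal) \<in> borel_measurable lborel" by measurable
    qed simp
    also have "\<dots> = (\<Prod>i<q. emeasure (?N i) (A i))"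
      using A by (intro prod.cong refl emeasure_density[symmetric]) auto
    finally show "emeasure (density (lebn q) (\<lambda>x. indicator (obox q l) x / 2 ^ q)) (PiE {..<q} A) = (\<Prod>i<q. emeasure (?N i) (A i))" .
  qed (auto intro!: sets_PiM_cong)
  show ?thesis unfolding d1 d2 ..
qed

lemma nn_integral_obox:
  assumes l: "length l = q" "distinct l" and [measurable]: "\<phi> \<in> borel_measurable (lebn q)"
  shows "(\<integral>\<^sup>+x. \<phi> x * indicator (obox q l) x \<partial>lebn q) = 2 ^ q * (\<integral>\<^sup>+w. \<phi> (pt q l w) \<partial>U.Q)"
proof -
  have "(\<integral>\<^sup>+w. \<phi> (pt q l w) \<partial>U.Q) = (\<integral>\<^sup>+x. \<phi> x \<partial>distr U.Q (lebn q) (pt q l))"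
    by (intro nn_integral_distr[symmetric]) auto
  also have "\<dots> = (\<integral>\<^sup>+x. indicator (obox q l) x / 2 ^ q * \<phi> x \<partial>lebn q)"
    unfolding distr_pt[OF l] by (rule nn_integral_density) auto
  finally have "2 ^ q * (\<integral>\<^sup>+w. \<phi> (pt q l w) \<partial>U.Q) = (\<integral>\<^sup>+x. 2 ^ q * (indicator (obox q l) x / 2 ^ q * \<phi> x) \<partial>lebn q)"
    by (simp add: nn_integral_cmult)
  also have "\<dots> = (\<integral>\<^sup>+x. \<phi> x * indicator (obox q l) x \<partial>lebn q)"
  proof (rule nn_integral_cong)
    fix x
    have "(2::ennreal) ^ q * (1 / 2 ^ q) = 1"
      by (simp add: ennreal_times_divide ennreal_divide_self power_less_top_ennreal)
    then have "(2::ennreal) ^ q * (1 / 2 ^ q * \<phi> x) = \<phi> x"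
      by (simp add: mult.assoc[symmetric])
    then show "2 ^ q * (indicator (obox q l) x / 2 ^ q * \<phi> x) = \<phi> x * indicator (obox q l) x"
      by (auto simp: indicator_def)
  qed
  finally show ?thesis ..
qed

lemma integral_obox:
  fixes \<phi> :: "(nat \<Rightarrow> real) \<Rightarrow> real"
  assumes l: "length l = q" "distinct l" and [measurable]: "\<phi> \<in> borel_measurable (lebn q)"
  shows "(\<integral>x. \<phi> x * indicator (obox q l) x \<partial>lebn q) = 2 ^ q * (\<integral>w. \<phi> (pt q l w) \<partial>U.Q)"
proof -
  have "(\<integral>w. \<phi> (pt q l w) \<partial>U.Q) = (\<integral>x. \<phi> x \<partial>distr U.Q (lebn q) (pt q l))"
    by (intro integral_distr[symmetric]) auto
  also have "\<dots> = (\<integral>x. \<phi> x \<partial>density (lebn q) (\<lambda>x. ennreal (indicator (obox q l) x / 2 ^ q)))"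
    unfolding distr_pt[OF l]
    by (intro arg_cong2[where f=lebesgue_integral] density_cong AE_I2 refl)
      (auto simp: indicator_def divide_ennreal[symmetric] ennreal_power[symmetric])
  also have "\<dots> = (\<integral>x. (indicator (obox q l) x / 2 ^ q) *\<^sub>R \<phi> x \<partial>lebn q)"
    by (rule integral_density) auto
  finally show ?thesis by (simp add: mult.commute)
qed

lemma AE_lebn_neq: "i < q \<Longrightarrow> AE y in lebn q. y i \<noteq> (c::real)"
proof (rule AE_I)
  assume i: "i < q"
  show "{y \<in> space (lebn q). \<not> y i \<noteq> c} \<subseteq> PiE {..<q} (\<lambda>j. if j = i then {c} else UNIV)"
    by (auto simp: space_PiM PiE_iff extensional_def)
  have "emeasure (lebn q) (PiE {..<q} (\<lambda>j. if j = i then {c} else UNIV)) =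
      (\<Prod>j<q. emeasure lborel (if j = i then {c} else UNIV))"
    by (rule lebn.emeasure_PiM) auto
  also have "\<dots> = 0"
    using i by (intro prod_zero) auto
  finally show "emeasure (lebn q) (PiE {..<q} (\<lambda>j. if j = i then {c} else UNIV)) = 0" .
  show "PiE {..<q} (\<lambda>j. if j = i then {c} else UNIV) \<in> sets (lebn q)"
    by (intro sets_PiM_I_finite) auto
qed

lemma obox_disjoint:
  assumes "y \<in> obox q l" "y \<in> obox q l'" "length l = q" "length l' = q"
  shows "l = l'"
proof (rule nth_equalityI)
  fix i assume "i < length l"
  then have "2 * real (l ! i) < y i" "y i < 2 * real (l ! i) + 2" "2 * real (l' ! i) < y i" "y i < 2 * real (l' ! i) + 2"
    using assms by (auto simp: obox_def PiE_iff)
  then have "real (l ! i) < real (l' ! i) + 1" "real (l' ! i) < real (l ! i) + 1" by linarith+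
  then show "l ! i = l' ! i" by linarith
qed (use assms in simp)

text \<open>The open boxes miss only points of the quadrant having an even integer coordinate, a
  null set.\<close>

lemma AE_lebn_obox:
  "AE y in lebn q. y \<in> PiE {..<q} (\<lambda>_. {0..}) \<longrightarrow> (\<exists>l. length l = q \<and> y \<in> obox q l)"
proof -
  have "AE y in lebn q. \<forall>i\<in>{..<q}. \<forall>k::nat. y i \<noteq> 2 * real k"
    by (intro AE_finite_allI) (auto simp: AE_all_countable intro: AE_lebn_neq)
  then show ?thesis
  proof eventually_elim
    case (elim y)
    show ?case
    proof
      assume y: "y \<in> PiE {..<q} (\<lambda>_. {0..})"
      let ?l = "map (\<lambda>i. nat \<lfloor>y i / 2\<rfloor>) [0..<q]"
      have "2 * real (nat \<lfloor>y i / 2\<rfloor>) < y i \<and> y i < 2 * real (nat \<lfloor>y i / 2\<rfloor>) + 2" if i: "i < q" for i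
      proof -
        have "0 \<le> y i" using y i by (auto simp: PiE_iff)
        then have e: "real (nat \<lfloor>y i / 2\<rfloor>) = of_int \<lfloor>y i / 2\<rfloor>" by simp
        have "of_int \<lfloor>y i / 2\<rfloor> \<le> y i / 2" "y i / 2 < of_int \<lfloor>y i / 2\<rfloor> + 1" by linarith+
        moreover have "y i \<noteq> 2 * real (nat \<lfloor>y i / 2\<rfloor>)" using elim i by auto
        ultimately show ?thesis using e by linarith
      qed
      then have "y \<in> obox q ?l" using y by (auto simp: obox_def PiE_iff)
      then show "\<exists>l. length l = q \<and> y \<in> obox q l" by (intro exI[of _ ?l]) auto
    qed
  qed
qed

lemma obox_subset: "obox q l \<subseteq> PiE {..<q} (\<lambda>_. {0..})"
  unfolding obox_def by (intro PiE_mono) auto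

lemma sets_quadrant [measurable]: "PiE {..<q} (\<lambda>_. {0..}) \<in> sets (lebn q)"
  by (intro sets_PiM_I_finite) auto

lemma AE_obox_unique:
  "AE y in lebn q. if y \<in> PiE {..<q} (\<lambda>_. {0..})
     then \<exists>l\<^sub>0. length l\<^sub>0 = q \<and> (\<forall>l. length l = q \<longrightarrow> (y \<in> obox q l \<longleftrightarrow> l = l\<^sub>0))
     else (\<forall>l. y \<notin> obox q l)"
  using AE_lebn_obox[of q]
proof eventually_elim
  case (elim y)
  show ?case
  proof (cases "y \<in> PiE {..<q} (\<lambda>_. {0..})")
    case True
    then obtain l where "length l = q" "y \<in> obox q l" using elim by blast
    then have "\<forall>l'. length l' = q \<longrightarrow> (y \<in> obox q l' \<longleftrightarrow> l' = l)"
      using obox_disjoint by blast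
    with \<open>length l = q\<close> True show ?thesis by auto
  next
    case False
    then have "y \<notin> obox q l" for l using obox_subset by blast
    with False show ?thesis by auto
  qed
qed

lemma nn_integral_quadrant:
  assumes [measurable]: "\<phi> \<in> borel_measurable (lebn q)"
  shows "(\<integral>\<^sup>+y. \<phi> y * indicator (PiE {..<q} (\<lambda>_. {0..})) y \<partial>lebn q) =
    (\<integral>\<^sup>+l. (\<integral>\<^sup>+y. \<phi> y * indicator (obox q l) y \<partial>lebn q) \<partial>count_space {l. length l = q})"
proof -
  have "(\<integral>\<^sup>+y. \<phi> y * indicator (PiE {..<q} (\<lambda>_. {0..})) y \<partial>lebn q) =
    (\<integral>\<^sup>+y. (\<integral>\<^sup>+l. \<phi> y * indicator (obox q l) y \<partial>count_space {l. length l = q}) \<partial>lebn q)"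
  proof (rule nn_integral_cong_AE)
    show "AE y in lebn q. \<phi> y * indicator (PiE {..<q} (\<lambda>_. {0..})) y =
        (\<integral>\<^sup>+l. \<phi> y * indicator (obox q l) y \<partial>count_space {l. length l = q})"
      using AE_obox_unique[of q]
    proof eventually_elim
      case (elim y)
      show ?case
      proof (cases "y \<in> PiE {..<q} (\<lambda>_. {0..})")
        case True
        with elim obtain l where l: "length l = q" "\<And>l'. length l' = q \<Longrightarrow> (y \<in> obox q l' \<longleftrightarrow> l' = l)"
          by auto
        have "(\<integral>\<^sup>+l'. \<phi> y * indicator (obox q l') y \<partial>count_space {l. length l = q}) =
          (\<integral>\<^sup>+l'. \<phi> y * indicator {l} l' \<partial>count_space {l. length l = q})"
          using l by (intro nn_integral_cong) (auto simp: indicator_def)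
        also have "\<dots> = \<phi> y"
          using l(1) by (subst nn_integral_cmult) (auto simp: emeasure_count_space)
        finally show ?thesis using True by simp
      qed (use elim in \<open>auto simp: indicator_def\<close>)
    qed
  qed
  also have "\<dots> = (\<integral>\<^sup>+l. (\<integral>\<^sup>+y. \<phi> y * indicator (obox q l) y \<partial>lebn q) \<partial>count_space {l. length l = q})"
    by (rule nn_integral_count_space_nn_integral) auto
  finally show ?thesis .
qed

text \<open>Bridge between integrals over counting measure, to which Fubini applies, and the
  unordered sums in the definition of the multiple integral.\<close>

lemma integrable_count_space_summable:
  fixes f :: "'b \<Rightarrow> real"
  assumes "integrable (count_space A) f"
  shows "f summable_on A" "infsum f A = (\<integral>x. f x \<partial>count_space A)"
proof -
  have abs: "Infinite_Set_Sum.abs_summable_on f A"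
    using assms unfolding Infinite_Set_Sum.abs_summable_on_def .
  show "f summable_on A"
    using abs unfolding abs_summable_equivalent[symmetric] by (rule abs_summable_summable)
  show "infsum f A = (\<integral>x. f x \<partial>count_space A)"
    using infsetsum_infsum[OF abs] by (simp add: infsetsum_def)
qed

text \<open>Fubini for counting measure times Lebesgue measure; absolute integrability on the
  product is supplied by \<open>nn_integral_quadrant\<close>.\<close>

lemma integral_quadrant:
  fixes \<psi> :: "(nat \<Rightarrow> real) \<Rightarrow> real"
  assumes \<psi>: "integrable (lebn q) (\<lambda>y. \<psi> y * indicator (PiE {..<q} (\<lambda>_. {0..})) y)"
    and [measurable]: "\<psi> \<in> borel_measurable (lebn q)"
  shows "((\<lambda>l. \<integral>y. \<psi> y * indicator (obox q l) y \<partial>lebn q) has_sum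
    (\<integral>y. \<psi> y * indicator (PiE {..<q} (\<lambda>_. {0..})) y \<partial>lebn q)) {l. length l = q}"
proof -
  let ?L = "count_space {l :: nat list. length l = q}"
  interpret L: sigma_finite_measure ?L
    by (rule sigma_finite_measure_count_space_countable) simp
  interpret lq: sigma_finite_measure "lebn q"
    using lebn.sigma_finite[of "{..<q}"] by simp
  interpret P: pair_sigma_finite ?L "lebn q" ..
  let ?h = "\<lambda>l y. \<psi> y * indicator (obox q l) y"
  have [measurable]: "case_prod ?h \<in> borel_measurable (?L \<Otimes>\<^sub>M lebn q)"
    by (rule measurable_pair_measure_countable1) auto
  have hm: "(\<lambda>z. ennreal (norm (case_prod ?h z))) \<in> borel_measurable (?L \<Otimes>\<^sub>M lebn q)"
    by (rule measurable_compose[OF \<open>case_prod ?h \<in> _\<close>]) measurable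
  have "(\<integral>\<^sup>+z. ennreal (norm (case_prod ?h z)) \<partial>(?L \<Otimes>\<^sub>M lebn q)) =
      (\<integral>\<^sup>+l. \<integral>\<^sup>+y. ennreal (norm (?h l y)) \<partial>lebn q \<partial>?L)"
    using lq.nn_integral_fst[OF hm] by simp
  also have "\<dots> = (\<integral>\<^sup>+l. \<integral>\<^sup>+y. ennreal \<bar>\<psi> y\<bar> * indicator (obox q l) y \<partial>lebn q \<partial>?L)"
    by (intro nn_integral_cong) (auto simp: abs_mult indicator_def)
  also have "\<dots> = (\<integral>\<^sup>+y. ennreal \<bar>\<psi> y\<bar> * indicator (PiE {..<q} (\<lambda>_. {0..})) y \<partial>lebn q)"
    by (rule nn_integral_quadrant[symmetric]) measurable
  also have "\<dots> = (\<integral>\<^sup>+y. ennreal (norm (\<psi> y * indicator (PiE {..<q} (\<lambda>_. {0..})) y)) \<partial>lebn q)"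
    by (intro nn_integral_cong) (auto simp: indicator_def)
  also have "\<dots> < \<infinity>"
    using \<psi> by (simp add: integrable_iff_bounded)
  finally have int: "integrable (?L \<Otimes>\<^sub>M lebn q) (case_prod ?h)"
    by (intro integrableI_bounded) auto
  have iL: "integrable ?L (\<lambda>l. \<integral>y. ?h l y \<partial>lebn q)"
    using P.integrable_fst[OF int] .
  have "(\<integral>l. \<integral>y. ?h l y \<partial>lebn q \<partial>?L) = (\<integral>y. \<integral>l. ?h l y \<partial>?L \<partial>lebn q)"
    using P.Fubini_integral[OF int] ..
  also have "\<dots> = (\<integral>y. \<psi> y * indicator (PiE {..<q} (\<lambda>_. {0..})) y \<partial>lebn q)"
  proof (rule integral_cong_AE)
    show "AE y in lebn q. (\<integral>l. ?h l y \<partial>?L) = \<psi> y * indicator (PiE {..<q} (\<lambda>_. {0..})) y"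
      using AE_obox_unique[of q]
    proof eventually_elim
      case (elim y)
      show ?case
      proof (cases "y \<in> PiE {..<q} (\<lambda>_. {0..})")
        case True
        with elim obtain l where l: "length l = q" "\<And>l'. length l' = q \<Longrightarrow> (y \<in> obox q l' \<longleftrightarrow> l' = l)"
          by auto
        have "(\<integral>l'. ?h l' y \<partial>?L) = (\<integral>l'. \<psi> y * indicator {l} l' \<partial>?L)"
          using l by (intro Bochner_Integration.integral_cong) (auto simp: indicator_def)
        also have "\<dots> = \<psi> y"
          using l(1) by (subst integral_mult_right_zero) (simp add: measure_count_space)
        finally show ?thesis using True by simp
      qed (use elim in \<open>auto simp: indicator_def\<close>)
    qed
    show "(\<lambda>y. \<integral>l. ?h l y \<partial>?L) \<in> borel_measurable (lebn q)"
      using P.integrable_snd[OF int] by auto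
  qed measurable
  finally have eq: "(\<integral>l. \<integral>y. ?h l y \<partial>lebn q \<partial>?L) = \<dots>" .
  show ?thesis
    using has_sum_infsum[OF integrable_count_space_summable(1)[OF iL]]
    unfolding integrable_count_space_summable(2)[OF iL] eq .
qed

section \<open>Expansion of the defining formula into conditional expectations\<close>

text \<open>The argument of \<open>f\<close> in the defining formula of the multiple integral.\<close>

definition jn :: "nat \<Rightarrow> nat \<Rightarrow> nat list \<Rightarrow> (nat \<Rightarrow> real) \<Rightarrow> (nat \<Rightarrow> real) \<Rightarrow> nat \<Rightarrow> real" where
  "jn n r ks u y = (\<lambda>i\<in>{..<n}. if i < r then 2 * real (ks ! i) + 1 + u (ks ! i) else y (i - r))"

lemma measurable_jn:
  assumes "r \<le> n"
  shows "jn n r ks u \<in> lebn (n - r) \<rightarrow>\<^sub>M lebn n"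
  unfolding jn_def[abs_def]
proof (rule measurable_restrict)
  fix i assume i: "i \<in> {..<n}"
  show "(\<lambda>y. if i < r then 2 * real (ks ! i) + 1 + u (ks ! i) else y (i - r)) \<in> lebn (n - r) \<rightarrow>\<^sub>M lborel"
  proof (cases "i < r")
    case False
    then have "i - r \<in> {..<n - r}" using i by auto
    then have "(\<lambda>y. y (i - r)) \<in> lebn (n - r) \<rightarrow>\<^sub>M lborel" by (rule measurable_component_singleton)
    then show ?thesis using False by simp
  qed simp
qed

text \<open>The blocks of \<open>l\<close> are disjoint from \<open>ks\<close>, so evaluated and
  integrated variables can be driven by one sequence: \<open>u\<close> on \<open>set ks\<close>, the
  independent copy \<open>w\<close> elsewhere.\<close>

lemma jn_pt:
  assumes "length ks = r" "length l = n - r" "r \<le> n" "distinct (ks @ l)"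
  shows "jn n r ks u (pt (n - r) l w) = pt n (ks @ l) (mix (set ks) u w)"
proof
  fix i
  consider "i \<ge> n" | "i < r" | "r \<le> i" "i < n" by linarith
  then show "jn n r ks u (pt (n - r) l w) i = pt n (ks @ l) (mix (set ks) u w) i"
  proof cases
    case 3
    then have "l ! (i - r) \<in> set l" using assms by (intro nth_mem) auto
    then have "l ! (i - r) \<notin> set ks" using assms by auto
    then show ?thesis using 3 assms by (auto simp: jn_def pt_def mix_def nth_append)
  qed (use assms in \<open>auto simp: jn_def pt_def mix_def nth_append\<close>)
qed

lemma jn_obox:
  assumes "length ks = r" "r \<le> n" and u: "\<forall>k. -1 < u k \<and> u k < 1" and y: "y \<in> obox (n - r) l"
  shows "jn n r ks u y \<in> obox n (ks @ l)"
proof -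
  have "2 * real ((ks @ l) ! i) < jn n r ks u y i \<and> jn n r ks u y i < 2 * real ((ks @ l) ! i) + 2" if i: "i < n" for i
  proof (cases "i < r")
    case True
    then show ?thesis using i assms(1) u[rule_format, of "ks ! i"] by (simp add: jn_def nth_append)
  next
    case False
    then have "i - r < n - r" using i by auto
    then have "y (i - r) \<in> {2 * real (l ! (i - r))<..<2 * real (l ! (i - r)) + 2}"
      using y by (auto simp: obox_def PiE_iff)
    then show ?thesis using False i assms(1) by (simp add: jn_def nth_append)
  qed
  then show ?thesis by (auto simp: obox_def PiE_iff jn_def)
qed

text \<open>\<open>Delta\<close> uses closed blocks, but a point inside an open block lies in no
  other closed block, so the two index families agree.\<close>

lemma obox_Delta:
  assumes x: "x \<in> obox n k" "x \<in> Delta n" and "length k = n"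
  shows "distinct k"
proof -
  from x(2) obtain k' :: "nat \<Rightarrow> nat" where k': "inj_on k' {..<n}" "x \<in> PiE {..<n} (\<lambda>i. {2 * real (k' i)..2 * real (k' i) + 2})"
    by (auto simp: Delta_def)
  have "k ! i = k' i" if i: "i < n" for i
  proof -
    have "2 * real (k ! i) < x i" "x i < 2 * real (k ! i) + 2" "2 * real (k' i) \<le> x i" "x i \<le> 2 * real (k' i) + 2"
      using x(1) k'(2) i by (auto simp: obox_def PiE_iff)
    then have "real (k ! i) < real (k' i) + 1" "real (k' i) < real (k ! i) + 1" by linarith+
    then show ?thesis by linarith
  qed
  then show ?thesis
    using k'(1) assms(3) by (auto simp: distinct_conv_nth inj_on_def)
qed

lemma pt_permute:
  assumes g: "g \<in> hatL2 n" and k: "distinct k" "distinct k'" "set k = set k'" "length k = n"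
  shows "g (pt n k u) = g (pt n k' u)"
proof -
  have "mset k = mset k'" using k by (simp add: set_eq_iff_mset_eq_distinct)
  then obtain p where p: "p permutes {..<length k'}" "permute_list p k' = k"
    by (rule mset_eq_permutation)
  have len: "length k' = n" using k distinct_card[of k] distinct_card[of k'] by simp
  have "pt n k u = pt n k' u \<circ> p"
  proof
    fix i
    show "pt n k u i = (pt n k' u \<circ> p) i"
    proof (cases "i < n")
      case True
      have "k ! i = k' ! p i"
        using permute_list_nth[OF p(1), of i] True len by (simp add: p(2))
      moreover have "p i < n" using permutes_in_image[OF p(1), of i] True len by simp
      ultimately show ?thesis using True by (simp add: pt_def)
    next
      case False
      then have "p i = i" using p(1) len by (simp add: permutes_def)
      then show ?thesis using False by (simp add: pt_def)
    qed
  qed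
  moreover have "pt n k' u \<in> space (lebn n)" by (simp add: space_PiM pt_def)
  ultimately show ?thesis using g p(1) len by (auto simp: hatL2_def)
qed

text \<open>The boxes are disjoint and each has Lebesgue measure \<open>2 ^ n\<close>. It is applied
  to \<open>\<bar>g\<bar>\<close> for summability and to \<open>g\<^sup>2\<close> for the L2
  theory.\<close>

lemma nn_integral_pt_le:
  assumes [measurable]: "\<phi> \<in> borel_measurable (lebn n)"
  shows "2 ^ n * (\<integral>\<^sup>+k. (\<integral>\<^sup>+u. \<phi> (pt n k u) \<partial>U.Q) \<partial>count_space {k. length k = n \<and> distinct k}) \<le> (\<integral>\<^sup>+x. \<phi> x \<partial>lebn n)"
proof -
  have "2 ^ n * (\<integral>\<^sup>+k. (\<integral>\<^sup>+u. \<phi> (pt n k u) \<partial>U.Q) \<partial>count_space {k. length k = n \<and> distinct k}) =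
      (\<integral>\<^sup>+k. (\<integral>\<^sup>+x. \<phi> x * indicator (obox n k) x \<partial>lebn n) \<partial>count_space {k. length k = n \<and> distinct k})"
    by (subst nn_integral_cmult[symmetric]) (auto intro!: nn_integral_cong nn_integral_obox[symmetric])
  also have "\<dots> \<le> (\<integral>\<^sup>+k. (\<integral>\<^sup>+x. \<phi> x * indicator (obox n k) x \<partial>lebn n) \<partial>count_space {k. length k = n})"
    by (subst (1 2) nn_integral_count_space_indicator) (auto intro!: nn_integral_mono simp: indicator_def)
  also have "\<dots> = (\<integral>\<^sup>+x. \<phi> x * indicator (PiE {..<n} (\<lambda>_. {0..})) x \<partial>lebn n)"
    by (rule nn_integral_quadrant[symmetric]) measurable
  also have "\<dots> \<le> (\<integral>\<^sup>+x. \<phi> x \<partial>lebn n)"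
    by (intro nn_integral_mono) (auto simp: indicator_def)
  finally show ?thesis .
qed

text \<open>
  The first list indexes the coordinates evaluated at the random points, the second one the blocks of
  the integration variables.
\<close>

definition split_lists :: "nat \<Rightarrow> nat \<Rightarrow> (nat list \<times> nat list) set" where
  "split_lists n r = (SIGMA ks:{ks. length ks = r \<and> distinct ks}. {l. length l = n - r \<and> distinct (ks @ l)})"

text \<open>The value at \<open>u\<close> of \<open>cexp (set ks)\<close> of the kernel evaluated
  along \<open>ks @ l\<close>.\<close>

definition pcexp :: "((nat \<Rightarrow> real) \<Rightarrow> real) \<Rightarrow> nat \<Rightarrow> (nat \<Rightarrow> real) \<Rightarrow> nat list \<times> nat list \<Rightarrow> real" where
  "pcexp g n u = (\<lambda>(ks, l). \<integral>w. g (pt n (ks @ l) (mix (set ks) u w)) \<partial>U.Q)"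

text \<open>Integrability of \<open>g\<close> enters here. In expectation the resampling disappears
  by \<open>nn_integral_mix\<close>, and the sum over split lists is at most the L1 norm of
  \<open>g\<close>.\<close>

lemma AE_split_lists_finite:
  assumes [measurable]: "g \<in> borel_measurable (lebn n)" and g: "integrable (lebn n) g" and r: "r \<le> n"
  shows "AE u in U.Q. (\<integral>\<^sup>+x. (\<integral>\<^sup>+w. ennreal \<bar>g (pt n (fst x @ snd x) (mix (set (fst x)) u w))\<bar> \<partial>U.Q) \<partial>count_space (split_lists n r)) \<noteq> \<infinity>"
proof (rule nn_integral_noteq_infinite)
  let ?X = "split_lists n r"
  let ?f = "\<lambda>x u. \<integral>\<^sup>+w. ennreal \<bar>g (pt n (fst x @ snd x) (mix (set (fst x)) u w))\<bar> \<partial>U.Q"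
  have cX: "countable ?X" by (rule countable_subset[OF subset_UNIV]) simp
  have m: "?f x \<in> borel_measurable U.Q" for x :: "nat list \<times> nat list"
    by measurable
  show "(\<lambda>u. \<integral>\<^sup>+x. ?f x u \<partial>count_space ?X) \<in> borel_measurable U.Q"
  proof -
    interpret X: sigma_finite_measure "count_space ?X"
      by (rule sigma_finite_measure_count_space_countable[OF cX])
    have "(\<lambda>(u, x). ?f x u) \<in> borel_measurable (U.Q \<Otimes>\<^sub>M count_space ?X)"
      using m by (subst measurable_pair_swap_iff) (intro measurable_pair_measure_countable1[OF cX], simp)
    then show ?thesis by (rule X.borel_measurable_nn_integral)
  qed
  \<comment> \<open>A distinct list of length \<open>n\<close> splits uniquely at position
    \<open>r\<close>.\<close>
  have inj: "bij_betw (\<lambda>(ks, l). ks @ l) ?X {k. length k = n \<and> distinct k}"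
  proof (rule bij_betw_byWitness[where f'="\<lambda>k. (take r k, drop r k)"])
    show "\<forall>x\<in>?X. (\<lambda>k. (take r k, drop r k)) ((\<lambda>(ks, l). ks @ l) x) = x"
      by (auto simp: split_lists_def)
    show "(\<lambda>(ks, l). ks @ l) ` ?X \<subseteq> {k. length k = n \<and> distinct k}"
      using r by (auto simp: split_lists_def)
    show "(\<lambda>k. (take r k, drop r k)) ` {k. length k = n \<and> distinct k} \<subseteq> ?X"
    proof (rule image_subsetI)
      fix k :: "nat list" assume "k \<in> {k. length k = n \<and> distinct k}"
      then show "(take r k, drop r k) \<in> ?X"
        using r set_take_disj_set_drop_if_distinct[of k r r]
        by (simp add: split_lists_def del: distinct_append)
    qed
  qed simp
  have "(\<integral>\<^sup>+u. (\<integral>\<^sup>+x. ?f x u \<partial>count_space ?X) \<partial>U.Q) = (\<integral>\<^sup>+x. (\<integral>\<^sup>+u. ?f x u \<partial>U.Q) \<partial>count_space ?X)"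
    using m by (intro nn_integral_count_space_nn_integral cX)
  also have "\<dots> = (\<integral>\<^sup>+x. (\<integral>\<^sup>+u. ennreal \<bar>g (pt n ((\<lambda>(ks, l). ks @ l) x) u)\<bar> \<partial>U.Q) \<partial>count_space ?X)"
  proof (rule nn_integral_cong)
    fix x :: "nat list \<times> nat list"
    show "(\<integral>\<^sup>+u. ?f x u \<partial>U.Q) = (\<integral>\<^sup>+u. ennreal \<bar>g (pt n ((\<lambda>(ks, l). ks @ l) x) u)\<bar> \<partial>U.Q)"
      using U.nn_integral_mix[of "\<lambda>u. ennreal \<bar>g (pt n (fst x @ snd x) u)\<bar>" "set (fst x)"]
      by (simp add: case_prod_beta)
  qed
  also have "\<dots> = (\<integral>\<^sup>+k. (\<integral>\<^sup>+u. ennreal \<bar>g (pt n k u)\<bar> \<partial>U.Q) \<partial>count_space {k. length k = n \<and> distinct k})"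
    by (rule nn_integral_bij_count_space[OF inj])
  also have "\<dots> \<le> 2 ^ n * \<dots>"
  proof -
    have "(1::ennreal) \<le> 2 ^ n" by (rule one_le_power) simp
    from mult_right_mono[OF this] show ?thesis by (simp only: mult_1_left zero_le)
  qed
  also have "\<dots> \<le> (\<integral>\<^sup>+x. ennreal \<bar>g x\<bar> \<partial>lebn n)"
    by (rule nn_integral_pt_le) measurable
  also have "\<dots> < \<infinity>"
    using g by (simp add: integrable_iff_bounded)
  finally show "(\<integral>\<^sup>+u. (\<integral>\<^sup>+x. ?f x u \<partial>count_space ?X) \<partial>U.Q) \<noteq> \<infinity>" by simp
qed

lemma abs_integral_le_nn_integral: "ennreal \<bar>\<integral>x. f x \<partial>M\<bar> \<le> (\<integral>\<^sup>+x. ennreal \<bar>f x :: real\<bar> \<partial>M)"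
proof (cases "integrable M f")
  case True
  then show ?thesis using integral_norm_bound_ennreal[OF True] by simp
qed (simp add: not_integrable_integral_eq)

text \<open>
  The half line is cut into the blocks \<open>[2k, 2k+2]\<close>; off the diagonal blocks each deterministic integral
  is the expectation over independent copies of the corresponding coordinates.
\<close>

lemma AE_infsum_formula:
  assumes g: "g \<in> hatL2 n" "integrable (lebn n) g" and r: "r \<le> n"
  shows "AE u in U.Q. pcexp g n u summable_on split_lists n r \<and>
    (\<Sum>\<^sub>\<infinity>ks\<in>{ks. length ks = r \<and> distinct ks}. LINT y:PiE {..<n - r} (\<lambda>_. {0..})|lebn (n - r). g (jn n r ks u y)) =
    2 ^ (n - r) * infsum (pcexp g n u) (split_lists n r)"
proof -
  have mg [measurable]: "g \<in> borel_measurable (lebn n)" using g by (simp add: hatL2_def)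
  have g0: "g x = 0" if "x \<in> space (lebn n)" "x \<notin> Delta n" for x using g(1) that by (auto simp: hatL2_def)
  let ?q = "n - r"
  let ?quad = "PiE {..<?q} (\<lambda>_. {0::real..})"
  show ?thesis
    using AE_split_lists_finite[OF mg g(2) r] AE_Q_interval
  proof eventually_elim
    case (elim u)
    let ?f = "\<lambda>ks l. \<integral>\<^sup>+w. ennreal \<bar>g (pt n (ks @ l) (mix (set ks) u w))\<bar> \<partial>U.Q"
    have K: "(\<integral>\<^sup>+x. ?f (fst x) (snd x) \<partial>count_space (split_lists n r)) < \<infinity>"
      using elim(1) by (simp add: top.not_eq_extremum)
    have int: "integrable (count_space (split_lists n r)) (pcexp g n u)"
    proof (rule integrableI_bounded)
      have "(\<integral>\<^sup>+x. ennreal (norm (pcexp g n u x)) \<partial>count_space (split_lists n r)) \<le> (\<integral>\<^sup>+x. ?f (fst x) (snd x) \<partial>count_space (split_lists n r))"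
        by (intro nn_integral_mono) (auto simp: pcexp_def case_prod_beta abs_integral_le_nn_integral)
      then show "(\<integral>\<^sup>+x. ennreal (norm (pcexp g n u x)) \<partial>count_space (split_lists n r)) < \<infinity>"
        using K by (rule le_less_trans)
    qed simp
    note sm = integrable_count_space_summable(1)[OF int]
    have inner: "(LINT y:?quad|lebn ?q. g (jn n r ks u y)) = 2 ^ ?q * (\<Sum>\<^sub>\<infinity>l\<in>{l. length l = ?q \<and> distinct (ks @ l)}. pcexp g n u (ks, l))"
      if ks: "length ks = r" "distinct ks" for ks
    proof -
      let ?\<psi> = "\<lambda>y. g (jn n r ks u y)"
      have [measurable]: "?\<psi> \<in> borel_measurable (lebn ?q)"
        by (rule measurable_compose[OF measurable_jn[OF r]]) simp
      let ?L = "{l. length l = ?q \<and> distinct (ks @ l)}"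
      \<comment> \<open>A repeated block index puts the point into an open box off
        \<open>Delta\<close>. This uses that all \<open>u k\<close> are strictly inside the
        interval, true almost surely.\<close>
      have zero: "?\<psi> y * indicator (obox ?q l) y = 0"
        if l: "length l = ?q" "\<not> distinct (ks @ l)" for l y
      proof (cases "y \<in> obox ?q l")
        case True
        have "jn n r ks u y \<in> obox n (ks @ l)" by (rule jn_obox[OF ks(1) r elim(2) True])
        moreover have "length (ks @ l) = n" using l ks r by simp
        ultimately have "jn n r ks u y \<notin> Delta n" using obox_Delta l(2) by blast
        moreover have "jn n r ks u y \<in> space (lebn n)" by (simp add: jn_def space_PiM)
        ultimately show ?thesis using g0 by simp
      qed simp
      have "(\<integral>\<^sup>+y. ennreal (norm (?\<psi> y * indicator ?quad y)) \<partial>lebn ?q) = (\<integral>\<^sup>+y. ennreal \<bar>?\<psi> y\<bar> * indicator ?quad y \<partial>lebn ?q)"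
        by (intro nn_integral_cong) (auto simp: indicator_def)
      also have "\<dots> = (\<integral>\<^sup>+l. (\<integral>\<^sup>+y. ennreal \<bar>?\<psi> y\<bar> * indicator (obox ?q l) y \<partial>lebn ?q) \<partial>count_space {l. length l = ?q})"
        by (rule nn_integral_quadrant) measurable
      also have "\<dots> = (\<integral>\<^sup>+l. 2 ^ ?q * ?f ks l \<partial>count_space ?L)"
      proof -
        have "(\<integral>\<^sup>+y. ennreal \<bar>?\<psi> y\<bar> * indicator (obox ?q l) y \<partial>lebn ?q) = (if distinct (ks @ l) then 2 ^ ?q * ?f ks l else 0)"
          if l: "length l = ?q" for l
        proof (cases "distinct (ks @ l)")
          case True
          then show ?thesis using l
            by (subst nn_integral_obox) (simp_all add: jn_pt[OF ks(1) l r True])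
        next
          case False
          have "ennreal \<bar>?\<psi> y\<bar> * indicator (obox ?q l) y = 0" for y
            using zero[OF l False, of y] by (auto simp: indicator_def split: if_splits)
          then have "(\<integral>\<^sup>+y. ennreal \<bar>?\<psi> y\<bar> * indicator (obox ?q l) y \<partial>lebn ?q) = (\<integral>\<^sup>+y. 0 \<partial>lebn ?q)"
            by (intro nn_integral_cong)
          with False show ?thesis by (simp only: if_False nn_integral_const mult_zero_left)
        qed
        then have "(\<integral>\<^sup>+l. (\<integral>\<^sup>+y. ennreal \<bar>?\<psi> y\<bar> * indicator (obox ?q l) y \<partial>lebn ?q) \<partial>count_space {l. length l = ?q}) =
          (\<integral>\<^sup>+l. (if distinct (ks @ l) then 2 ^ ?q * ?f ks l else 0) \<partial>count_space {l. length l = ?q})"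
          by (intro nn_integral_cong) simp
        also have "\<dots> = (\<integral>\<^sup>+l. (if distinct (ks @ l) then 2 ^ ?q * ?f ks l else 0) \<partial>count_space ?L)"
          by (rule nn_integral_count_space_eq) auto
        also have "\<dots> = (\<integral>\<^sup>+l. 2 ^ ?q * ?f ks l \<partial>count_space ?L)"
          by (rule nn_integral_cong) simp
        finally show ?thesis .
      qed
      also have "\<dots> = 2 ^ ?q * (\<integral>\<^sup>+l. ?f ks l \<partial>count_space ?L)"
        by (rule nn_integral_cmult) simp
      also have "\<dots> < \<infinity>"
      proof -
        have "(\<integral>\<^sup>+l. ?f ks l \<partial>count_space ?L) = (\<integral>\<^sup>+x. ?f (fst x) (snd x) \<partial>count_space (Pair ks ` ?L))"
          by (subst nn_integral_bij_count_space[symmetric, where g="Pair ks" and A="?L"])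
            (auto simp: bij_betw_def inj_on_def)
        also have "\<dots> \<le> (\<integral>\<^sup>+x. ?f (fst x) (snd x) \<partial>count_space (split_lists n r))"
          using ks by (subst (1 2) nn_integral_count_space_indicator)
            (auto intro!: nn_integral_mono simp: indicator_def split_lists_def)
        finally have "(\<integral>\<^sup>+l. ?f ks l \<partial>count_space ?L) < \<infinity>" using K by (rule le_less_trans)
        then show ?thesis by (simp add: ennreal_mult_less_top power_less_top_ennreal)
      qed
      finally have "integrable (lebn ?q) (\<lambda>y. ?\<psi> y * indicator ?quad y)"
        by (intro integrableI_bounded) measurable
      note hs = integral_quadrant[OF this]
      have "((\<lambda>l. \<integral>y. ?\<psi> y * indicator (obox ?q l) y \<partial>lebn ?q) has_sum (\<integral>y. ?\<psi> y * indicator ?quad y \<partial>lebn ?q)) ?L"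
      proof (rule has_sum_cong_neutral[THEN iffD1, OF _ _ _ hs])
        fix l assume "l \<in> {l. length l = ?q} - ?L"
        then have "(\<lambda>y. ?\<psi> y * indicator (obox ?q l) y) = (\<lambda>_. 0)"
          by (intro ext zero) auto
        then show "(\<integral>y. ?\<psi> y * indicator (obox ?q l) y \<partial>lebn ?q) = 0"
          by (simp only: Bochner_Integration.integral_zero)
      qed auto
      moreover have "(\<integral>y. ?\<psi> y * indicator (obox ?q l) y \<partial>lebn ?q) = 2 ^ ?q * pcexp g n u (ks, l)" if "l \<in> ?L" for l
        using that by (subst integral_obox) (auto simp: pcexp_def jn_pt[OF ks(1) _ r])
      ultimately have "((\<lambda>l. 2 ^ ?q * pcexp g n u (ks, l)) has_sum (\<integral>y. ?\<psi> y * indicator ?quad y \<partial>lebn ?q)) ?L"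
        by (rule has_sum_cong[THEN iffD1, rotated])
      from infsumI[OF this]
      have "(\<integral>y. ?\<psi> y * indicator ?quad y \<partial>lebn ?q) = 2 ^ ?q * (\<Sum>\<^sub>\<infinity>l\<in>?L. pcexp g n u (ks, l))"
        by (simp only: infsum_cmult_right')
      moreover have "(LINT y:?quad|lebn ?q. ?\<psi> y) = (\<integral>y. ?\<psi> y * indicator ?quad y \<partial>lebn ?q)"
        unfolding set_lebesgue_integral_def real_scaleR_def by (simp only: mult.commute)
      ultimately show ?thesis by (rule trans[rotated])
    qed
    have "(\<Sum>\<^sub>\<infinity>ks\<in>{ks. length ks = r \<and> distinct ks}. LINT y:?quad|lebn ?q. g (jn n r ks u y)) =
      (\<Sum>\<^sub>\<infinity>ks\<in>{ks. length ks = r \<and> distinct ks}. 2 ^ ?q * (\<Sum>\<^sub>\<infinity>l\<in>{l. length l = ?q \<and> distinct (ks @ l)}. pcexp g n u (ks, l)))"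
      by (intro infsum_cong inner) auto
    also have "\<dots> = 2 ^ ?q * (\<Sum>\<^sub>\<infinity>ks\<in>{ks. length ks = r \<and> distinct ks}. \<Sum>\<^sub>\<infinity>l\<in>{l. length l = ?q \<and> distinct (ks @ l)}. pcexp g n u (ks, l))"
      by (rule infsum_cmult_right')
    also have "(\<Sum>\<^sub>\<infinity>ks\<in>{ks. length ks = r \<and> distinct ks}. \<Sum>\<^sub>\<infinity>l\<in>{l. length l = ?q \<and> distinct (ks @ l)}. pcexp g n u (ks, l)) =
        infsum (pcexp g n u) (split_lists n r)"
      using infsum_Sigma_banach[OF sm[unfolded split_lists_def]] unfolding split_lists_def .
    finally show ?case using sm by (intro conjI)
  qed
qed

section \<open>From sums over lists to Hoeffding sums over index sets\<close>

definition split_lists_below :: "nat \<Rightarrow> nat \<Rightarrow> nat \<Rightarrow> (nat list \<times> nat list) set" where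
  "split_lists_below n r m = {(ks, l) \<in> split_lists n r. set ks \<union> set l \<subseteq> {..<m}}"

lemma finite_split_lists_below: "finite (split_lists_below n r m)"
proof (rule finite_subset)
  show "split_lists_below n r m \<subseteq> {ks. set ks \<subseteq> {..<m} \<and> length ks = r} \<times> {l. set l \<subseteq> {..<m} \<and> length l = n - r}"
    by (auto simp: split_lists_below_def split_lists_def)
qed (auto intro: finite_lists_length_eq)

text \<open>Truncations by the largest index eventually contain every finite subset, so the
  unordered sum is also a limit along \<open>m\<close>.\<close>

lemma split_lists_below_LIMSEQ:
  fixes f :: "nat list \<times> nat list \<Rightarrow> real"
  assumes "f summable_on split_lists n r"
  shows "(\<lambda>m. sum f (split_lists_below n r m)) \<longlonglongrightarrow> infsum f (split_lists n r)"
proof -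
  have "filterlim (split_lists_below n r) (finite_subsets_at_top (split_lists n r)) sequentially"
    unfolding filterlim_finite_subsets_at_top
  proof (intro allI impI)
    fix X assume X: "finite X \<and> X \<subseteq> split_lists n r"
    define m\<^sub>0 where "m\<^sub>0 = Suc (Max (\<Union>x\<in>X. set (fst x) \<union> set (snd x)))"
    have sub: "X \<subseteq> split_lists_below n r m" if "m \<ge> m\<^sub>0" for m
    proof
      fix x assume x: "x \<in> X"
      have "k < m" if "k \<in> set (fst x) \<union> set (snd x)" for k
      proof -
        have "k \<le> Max (\<Union>x\<in>X. set (fst x) \<union> set (snd x))"
          using X x that by (intro Max_ge) auto
        then show ?thesis using \<open>m \<ge> m\<^sub>0\<close> by (simp add: m\<^sub>0_def)
      qed
      then show "x \<in> split_lists_below n r m"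
        using X x by (auto simp: split_lists_below_def)
    qed
    show "eventually (\<lambda>m. finite (split_lists_below n r m) \<and> X \<subseteq> split_lists_below n r m \<and> split_lists_below n r m \<subseteq> split_lists n r) sequentially"
      using eventually_ge_at_top[of m\<^sub>0]
    proof eventually_elim
      case (elim m)
      have "split_lists_below n r m \<subseteq> split_lists n r" by (auto simp: split_lists_below_def)
      then show ?case using sub[OF elim] finite_split_lists_below[of n r m] by (intro conjI)
    qed
  qed
  from filterlim_compose[OF has_sum_infsum[OF assms, unfolded has_sum_def] this] show ?thesis .
qed

text \<open>Over a pair \<open>(S, B)\<close> the fibre of the map to index sets consists of an
  ordering of \<open>B\<close> and one of \<open>S - B\<close>, hence has
  \<open>fact r * fact (n - r)\<close> elements.\<close>

lemma sum_split_lists_below: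
  fixes c :: "nat set \<Rightarrow> nat set \<Rightarrow> real"
  assumes r: "r \<le> n"
  shows "(\<Sum>(ks, l)\<in>split_lists_below n r m. c (set ks) (set ks \<union> set l)) =
    fact r * fact (n - r) * (\<Sum>S\<in>U.nsets n m. \<Sum>B | B \<subseteq> S \<and> card B = r. c B S)"
proof -
  let ?X = "split_lists_below n r m"
  let ?T = "SIGMA S:U.nsets n m. {B. B \<subseteq> S \<and> card B = r}"
  let ?g = "\<lambda>(ks, l). (set ks \<union> set l, set ks)"
  let ?c = "\<lambda>(ks, l). c (set ks) (set ks \<union> set l)"
  have finB: "finite {B. B \<subseteq> S \<and> card B = r}" if "S \<in> U.nsets n m" for S
    using U.nsets(2)[OF that] by (auto intro: finite_subset[of _ "Pow S"])
  then have finT: "finite ?T" by (intro finite_SigmaI U.nsets(1))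
  have sub: "?g ` ?X \<subseteq> ?T"
  proof (rule image_subsetI)
    fix x assume x: "x \<in> ?X"
    obtain ks l where kl: "x = (ks, l)" by (cases x)
    have "length ks = r" "length l = n - r" "distinct ks" "distinct (ks @ l)" "set (ks @ l) \<subseteq> {..<m}"
      using x kl by (auto simp: split_lists_below_def split_lists_def)
    then have "card (set ks) = r" "card (set (ks @ l)) = n" "set (ks @ l) \<subseteq> {..<m}"
      using r distinct_card[of ks] distinct_card[of "ks @ l"] by auto
    then show "?g x \<in> ?T" unfolding kl by (simp add: U.nsets_def)
  qed
  have "sum ?c ?X = (\<Sum>y\<in>?T. sum ?c {x \<in> ?X. ?g x = y})"
    by (rule sum.group[OF finite_split_lists_below finT sub, symmetric])
  also have "\<dots> = (\<Sum>y\<in>?T. fact r * fact (n - r) * c (snd y) (fst y))"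
  proof (rule sum.cong[OF refl])
    fix y assume y: "y \<in> ?T"
    obtain S B where yy: "y = (S, B)" by (cases y)
    have SB: "S \<in> U.nsets n m" "B \<subseteq> S" "card B = r" using y yy by auto
    have S: "S \<subseteq> {..<m}" "card S = n" "finite S" "B \<subseteq> S" "card B = r" "finite B"
      using SB U.nsets(2)[OF SB(1)] finite_subset[OF SB(2)] by (simp_all add: U.nsets_def)
    then have cSB: "card (S - B) = n - r" by (simp add: card_Diff_subset)
    have "{x \<in> ?X. ?g x = y} = permutations_of_set B \<times> permutations_of_set (S - B)"
    proof (intro set_eqI iffI)
      fix x assume "x \<in> {x \<in> ?X. ?g x = y}"
      then obtain ks l where x: "x = (ks, l)" "(ks, l) \<in> ?X" "set ks \<union> set l = S" "set ks = B"
        unfolding yy by (cases x) auto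
      then have "distinct ks" "distinct l" "set ks \<inter> set l = {}"
        by (auto simp: split_lists_below_def split_lists_def)
      with x have "set l = S - B" by blast
      then show "x \<in> permutations_of_set B \<times> permutations_of_set (S - B)"
        using x \<open>distinct ks\<close> \<open>distinct l\<close> by (simp add: permutations_of_set_def)
    next
      fix x assume x: "x \<in> permutations_of_set B \<times> permutations_of_set (S - B)"
      then obtain ks l where x: "x = (ks, l)" "set ks = B" "distinct ks" "set l = S - B" "distinct l"
        by (auto simp: permutations_of_set_def)
      then have "length ks = r" "length l = n - r" using S cSB distinct_card[of ks] distinct_card[of l] by auto
      moreover have "B \<union> (S - B) = S" "B \<inter> (S - B) = {}" "B \<subseteq> {..<m}" "S - B \<subseteq> {..<m}"
        using S by auto
      ultimately show "x \<in> {x \<in> ?X. ?g x = y}"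
        unfolding yy using x S by (simp add: split_lists_below_def split_lists_def)
    qed
    moreover have "sum ?c {x \<in> ?X. ?g x = y} = (\<Sum>x\<in>{x \<in> ?X. ?g x = y}. c B S)"
      unfolding yy by (intro sum.cong) auto
    ultimately show "sum ?c {x \<in> ?X. ?g x = y} = fact r * fact (n - r) * c (snd y) (fst y)"
      using S cSB by (simp add: yy card_cartesian_product)
  qed
  also have "\<dots> = fact r * fact (n - r) * (\<Sum>y\<in>?T. c (snd y) (fst y))"
    by (rule sum_distrib_left[symmetric])
  also have "(\<Sum>y\<in>?T. c (snd y) (fst y)) = (\<Sum>S\<in>U.nsets n m. \<Sum>B | B \<subseteq> S \<and> card B = r. c B S)"
    using finB U.nsets(1) by (subst sum.Sigma) (auto simp: case_prod_beta)
  finally show ?thesis .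
qed

text \<open>The subsets in \<open>hoef\<close> are grouped by their size \<open>r\<close>. The
  product of \<open>n choose r\<close> and the number of orderings is \<open>fact n\<close>, which
  explains the binomial coefficients in the multiple integral.\<close>

lemma chaos_eq_split_lists:
  "U.chaos n H m u = (\<Sum>r\<le>n. (-1) ^ (n - r) * real (n choose r) *
     (\<Sum>(ks, l)\<in>split_lists_below n r m. U.cexp (set ks) (H (set ks \<union> set l)) u))"
proof -
  let ?c = "\<lambda>B S. U.cexp B (H S) u"
  have "U.chaos n H m u = (\<Sum>S\<in>U.nsets n m. \<Sum>r\<le>n. fact n * ((-1) ^ (n - r) * (\<Sum>B | B \<subseteq> S \<and> card B = r. ?c B S)))"
    unfolding U.chaos_def
  proof (rule sum.cong[OF refl])
    fix S assume S: "S \<in> U.nsets n m"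
    note fS = U.nsets(2)[OF S]
    have "U.hoef S (H S) u = (\<Sum>r\<le>n. \<Sum>B | B \<in> Pow S \<and> card B = r. (-1) ^ card (S - B) * ?c B S)"
      unfolding U.hoef_def using fS by (intro sum.group[symmetric]) (auto intro: card_mono)
    also have "\<dots> = (\<Sum>r\<le>n. (-1) ^ (n - r) * (\<Sum>B | B \<subseteq> S \<and> card B = r. ?c B S))"
      unfolding sum_distrib_left using fS
      by (intro sum.cong) (auto simp: card_Diff_subset finite_subset)
    finally show "fact n * U.hoef S (H S) u = (\<Sum>r\<le>n. fact n * ((-1) ^ (n - r) * (\<Sum>B | B \<subseteq> S \<and> card B = r. ?c B S)))"
      by (simp add: sum_distrib_left)
  qed
  also have "\<dots> = (\<Sum>r\<le>n. \<Sum>S\<in>U.nsets n m. fact n * ((-1) ^ (n - r) * (\<Sum>B | B \<subseteq> S \<and> card B = r. ?c B S)))"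
    by (rule sum.swap)
  also have "\<dots> = (\<Sum>r\<le>n. (-1) ^ (n - r) * real (n choose r) * (\<Sum>(ks, l)\<in>split_lists_below n r m. ?c (set ks) (set ks \<union> set l)))"
  proof (rule sum.cong[OF refl])
    fix r assume "r \<in> {..n}"
    then have r: "r \<le> n" by simp
    have "real (n choose r) * (fact r * fact (n - r)) = fact n"
      using r by (simp add: binomial_fact)
    then have "(-1) ^ (n - r) * real (n choose r) * (fact r * fact (n - r) * x) = fact n * ((-1) ^ (n - r) * x)" for x :: real
      by (metis (no_types, opaque_lifting) mult.assoc mult.commute)
    then show "(\<Sum>S\<in>U.nsets n m. fact n * ((-1) ^ (n - r) * (\<Sum>B | B \<subseteq> S \<and> card B = r. ?c B S))) =
        (-1) ^ (n - r) * real (n choose r) * (\<Sum>(ks, l)\<in>split_lists_below n r m. ?c (set ks) (set ks \<union> set l))"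
      unfolding sum_split_lists_below[OF r, of ?c] sum_distrib_left[symmetric] by (rule sym)
  qed
  finally show ?thesis .
qed

text \<open>The sorted list is a canonical ordering of \<open>S\<close>; by symmetry of
  \<open>g\<close> every other ordering gives the same value (\<open>pt_permute\<close>).\<close>

definition kern :: "nat \<Rightarrow> ((nat \<Rightarrow> real) \<Rightarrow> real) \<Rightarrow> nat set \<Rightarrow> (nat \<Rightarrow> real) \<Rightarrow> real" where
  "kern n g S u = g (pt n (sorted_list_of_set S) u)"

text \<open>Each of the \<open>n - r\<close> integration variables contributes a factor 2 from its
  block; these cancel the denominators \<open>2 ^ (n - r)\<close>, and the rest is the Hoeffding
  sum.\<close>

theorem AE_mult_int_formula:
  assumes g: "g \<in> hatL2 n" "integrable (lebn n) g"
  shows "AE u in U.Q. (\<lambda>m. U.chaos n (kern n g) m u) \<longlonglongrightarrow> mult_int_formula n g u"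
proof -
  have "AE u in U.Q. \<forall>r\<in>{..n}. pcexp g n u summable_on split_lists n r \<and>
    (\<Sum>\<^sub>\<infinity>ks\<in>{ks. length ks = r \<and> distinct ks}. LINT y:PiE {..<n - r} (\<lambda>_. {0..})|lebn (n - r). g (jn n r ks u y)) =
    2 ^ (n - r) * infsum (pcexp g n u) (split_lists n r)"
    by (intro AE_finite_allI AE_infsum_formula g) auto
  then show ?thesis
  proof eventually_elim
    case (elim u)
    have sym: "(\<Sum>(ks, l)\<in>split_lists_below n r m. U.cexp (set ks) (kern n g (set ks \<union> set l)) u) =
      sum (pcexp g n u) (split_lists_below n r m)" if r: "r \<le> n" for r m
    proof (rule sum.cong[OF refl], clarify)
      fix ks l assume "(ks, l) \<in> split_lists_below n r m"
      then have kl: "length (ks @ l) = n" "distinct (ks @ l)" using r by (auto simp: split_lists_below_def split_lists_def)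
      have "kern n g (set ks \<union> set l) v = g (pt n (ks @ l) v)" for v
        unfolding kern_def using kl
        by (intro pt_permute[OF g(1), symmetric]) auto
      then show "U.cexp (set ks) (kern n g (set ks \<union> set l)) u = pcexp g n u (ks, l)"
        by (simp add: U.cexp_def pcexp_def)
    qed
    have "(\<lambda>m. \<Sum>r\<le>n. (-1) ^ (n - r) * real (n choose r) * sum (pcexp g n u) (split_lists_below n r m))
      \<longlonglongrightarrow> (\<Sum>r\<le>n. (-1) ^ (n - r) * real (n choose r) * infsum (pcexp g n u) (split_lists n r))"
      using elim by (intro tendsto_sum tendsto_mult_left split_lists_below_LIMSEQ) auto
    moreover have "(\<Sum>r\<le>n. (-1) ^ (n - r) * real (n choose r) * sum (pcexp g n u) (split_lists_below n r m)) =
        U.chaos n (kern n g) m u" for m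
      unfolding chaos_eq_split_lists using sym by (intro sum.cong) auto
    moreover have "(\<Sum>r\<le>n. (-1) ^ (n - r) * real (n choose r) * infsum (pcexp g n u) (split_lists n r)) = mult_int_formula n g u"
      unfolding mult_int_formula_def jn_def[symmetric]
    proof (rule sum.cong[OF refl])
      fix r assume r: "r \<in> {..n}"
      show "(-1) ^ (n - r) * real (n choose r) * infsum (pcexp g n u) (split_lists n r) =
        (-1) ^ (n - r) / 2 ^ (n - r) * real (n choose r) *
          (\<Sum>\<^sub>\<infinity>ks\<in>{ks. length ks = r \<and> distinct ks}. LINT y:PiE {..<n - r} (\<lambda>_. {0..})|lebn (n - r). g (jn n r ks u y))"
        unfolding elim[rule_format, OF r, THEN conjunct2] by simp
    qed
    ultimately show ?case by (simp only:)
  qed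
qed

section \<open>Existence of the multiple integral\<close>

text \<open>Riesz-Fischer: Cauchy in L2 implies Cauchy in L1, an almost surely convergent
  subsequence defines \<open>F\<close>, and Fatou gives back convergence in L2 of the whole
  sequence.\<close>

lemma (in prob_space) L2_complete:
  assumes s: "\<And>m. s m \<in> L2 M"
    and cauchy: "\<And>e. e > 0 \<Longrightarrow> \<exists>N. \<forall>i\<ge>N. \<forall>j\<ge>N. (\<integral>x. (s i x - s j x)\<^sup>2 \<partial>M) < e"
  obtains F where "F \<in> L2 M" "(\<lambda>m. \<integral>\<^sup>+x. ennreal ((s m x - F x)\<^sup>2) \<partial>M) \<longlonglongrightarrow> 0"
proof -
  have [measurable]: "s m \<in> borel_measurable M" for m using s by auto
  have d: "(\<lambda>x. s i x - s j x) \<in> L2 M" for i j by (intro L2_diff s)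
  have L1: "(LINT x|M. norm (s i x - s j x)) \<le> sqrt (\<integral>x. (s i x - s j x)\<^sup>2 \<partial>M)" for i j
  proof (rule real_le_rsqrt)
    have "(\<lambda>x. norm (s i x - s j x)) \<in> L2 M" by (rule L2_bound[OF d]) auto
    from square_integral_le[OF this]
    show "(LINT x|M. norm (s i x - s j x))\<^sup>2 \<le> (\<integral>x. (s i x - s j x)\<^sup>2 \<partial>M)" by simp
  qed
  have c1: "\<exists>N. \<forall>i\<ge>N. \<forall>j\<ge>N. (LINT x|M. norm (s i x - s j x)) < e" if e: "e > 0" for e
  proof -
    obtain N where N: "\<And>i j. i \<ge> N \<Longrightarrow> j \<ge> N \<Longrightarrow> (\<integral>x. (s i x - s j x)\<^sup>2 \<partial>M) < e\<^sup>2"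
      using cauchy[of "e\<^sup>2"] e by auto
    have "(LINT x|M. norm (s i x - s j x)) < e" if "i \<ge> N" "j \<ge> N" for i j
    proof -
      have "sqrt (\<integral>x. (s i x - s j x)\<^sup>2 \<partial>M) < e"
        using N[OF that] e by (intro real_less_lsqrt) auto
      with L1[of i j] show ?thesis by linarith
    qed
    then show ?thesis by blast
  qed
  obtain r where r: "strict_mono r" "AE x in M. Cauchy (\<lambda>i. s (r i) x)"
    by (rule cauchy_L1_AE_cauchy_subseq[of M s]) (use c1 L2_integrable[OF s] in auto)
  define F where "F x = lim (\<lambda>i. s (r i) x)" for x
  have [measurable]: "F \<in> borel_measurable M" unfolding F_def by measurable
  have lim: "AE x in M. (\<lambda>i. s (r i) x) \<longlonglongrightarrow> F x"
    using r(2) by eventually_elim (auto simp: F_def Cauchy_convergent_iff convergent_LIMSEQ_iff)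
  have fatou: "(\<integral>\<^sup>+x. ennreal ((s m x - F x)\<^sup>2) \<partial>M) \<le> ennreal e"
    if N: "\<And>i j. i \<ge> N \<Longrightarrow> j \<ge> N \<Longrightarrow> (\<integral>x. (s i x - s j x)\<^sup>2 \<partial>M) < e" and m: "m \<ge> N" for m N e
  proof -
    have "(\<integral>\<^sup>+x. ennreal ((s m x - F x)\<^sup>2) \<partial>M) = (\<integral>\<^sup>+x. liminf (\<lambda>i. ennreal ((s m x - s (r i) x)\<^sup>2)) \<partial>M)"
    proof (rule nn_integral_cong_AE)
      show "AE x in M. ennreal ((s m x - F x)\<^sup>2) = liminf (\<lambda>i. ennreal ((s m x - s (r i) x)\<^sup>2))"
        using lim
      proof eventually_elim
        case (elim x)
        then have "(\<lambda>i. ennreal ((s m x - s (r i) x)\<^sup>2)) \<longlonglongrightarrow> ennreal ((s m x - F x)\<^sup>2)"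
          by (intro tendsto_intros)
        then show ?case by (intro lim_imp_Liminf[symmetric]) simp_all
      qed
    qed
    also have "\<dots> \<le> liminf (\<lambda>i. \<integral>\<^sup>+x. ennreal ((s m x - s (r i) x)\<^sup>2) \<partial>M)"
      by (rule nn_integral_liminf) measurable
    also have "\<dots> \<le> ennreal e"
    proof (rule Liminf_le)
      show "eventually (\<lambda>i. (\<integral>\<^sup>+x. ennreal ((s m x - s (r i) x)\<^sup>2) \<partial>M) \<le> ennreal e) sequentially"
        using eventually_ge_at_top[of N]
      proof eventually_elim
        case (elim i)
        then have "r i \<ge> N" using seq_suble[OF r(1), of i] by linarith
        with N[OF m this] show ?case
          using d[of m "r i", THEN L2D(2)] by (simp add: nn_integral_eq_integral ennreal_leI)
      qed
    qed simp
    finally show ?thesis .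
  qed
  obtain N where N: "\<And>i j. i \<ge> N \<Longrightarrow> j \<ge> N \<Longrightarrow> (\<integral>x. (s i x - s j x)\<^sup>2 \<partial>M) < 1"
    using cauchy[of 1] by auto
  have "(\<integral>\<^sup>+x. ennreal ((s N x - F x)\<^sup>2) \<partial>M) \<le> ennreal 1"
    by (rule fatou[OF N order_refl])
  also have "\<dots> < \<infinity>" by simp
  finally have "(\<integral>\<^sup>+x. ennreal ((s N x - F x)\<^sup>2) \<partial>M) < \<infinity>" .
  then have "(\<lambda>x. s N x - F x) \<in> L2 M"
    by (intro L2I integrableI_nonneg) auto
  from L2_diff[OF s[of N] this] have "F \<in> L2 M" by simp
  moreover have "(\<lambda>m. \<integral>\<^sup>+x. ennreal ((s m x - F x)\<^sup>2) \<partial>M) \<longlonglongrightarrow> 0"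
  proof (rule order_tendstoI)
    fix a :: ennreal assume "a > 0"
    obtain e where e: "e > 0" "ennreal e < a"
    proof (cases a)
      case (real r)
      with \<open>a > 0\<close> show ?thesis by (intro that[of "r / 2"]) (auto simp: ennreal_less_iff)
    qed (auto intro: that[of 1])
    obtain N where N: "\<And>i j. i \<ge> N \<Longrightarrow> j \<ge> N \<Longrightarrow> (\<integral>x. (s i x - s j x)\<^sup>2 \<partial>M) < e"
      using cauchy[OF e(1)] by auto
    show "eventually (\<lambda>m. (\<integral>\<^sup>+x. ennreal ((s m x - F x)\<^sup>2) \<partial>M) < a) sequentially"
      using eventually_ge_at_top[of N] by eventually_elim (rule le_less_trans[OF fatou[OF N] e(2)])
  qed simp
  ultimately show ?thesis using that by blast
qed

lemma nn_integral_count_space_subset: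
  fixes f :: "'a \<Rightarrow> ennreal"
  assumes "A \<subseteq> B"
  shows "(\<integral>\<^sup>+x. f x \<partial>count_space A) \<le> (\<integral>\<^sup>+x. f x \<partial>count_space B)"
  using assms by (subst (1 2) nn_integral_count_space_indicator)
    (auto intro!: nn_integral_mono simp: indicator_def)

lemma measurable_kern [measurable]:
  "g \<in> borel_measurable (lebn n) \<Longrightarrow> kern n g S \<in> borel_measurable U.Q"
  unfolding kern_def[abs_def] by (rule measurable_compose[OF measurable_pt])

text \<open>Each set contributes only its sorted list, so the sum is part of the one over all
  distinct lists.\<close>

lemma nn_integral_kern_square_le:
  assumes [measurable]: "g \<in> borel_measurable (lebn n)"
  shows "(\<Sum>S\<in>U.nsets n m. \<integral>\<^sup>+u. ennreal ((kern n g S u)\<^sup>2) \<partial>U.Q) \<le> (\<integral>\<^sup>+x. ennreal ((g x)\<^sup>2) \<partial>lebn n)"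
proof -
  let ?f = "\<lambda>k. \<integral>\<^sup>+u. ennreal ((g (pt n k u))\<^sup>2) \<partial>U.Q"
  let ?D = "{k :: nat list. length k = n \<and> distinct k}"
  let ?I = "sorted_list_of_set ` U.nsets n m"
  have inj: "inj_on sorted_list_of_set (U.nsets n m)"
  proof (rule inj_onI)
    fix S T assume "S \<in> U.nsets n m" "T \<in> U.nsets n m" "sorted_list_of_set S = sorted_list_of_set T"
    then show "S = T" using U.nsets(2) by (metis sorted_list_of_set.set_sorted_key_list_of_set)
  qed
  have sub: "?I \<subseteq> ?D"
    using U.nsets(2) by auto
  have finI: "finite ?I" using U.nsets(1) by simp
  have "(\<Sum>S\<in>U.nsets n m. \<integral>\<^sup>+u. ennreal ((kern n g S u)\<^sup>2) \<partial>U.Q) = (\<Sum>k\<in>?I. ?f k)"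
    using inj by (simp add: sum.reindex kern_def)
  also have "\<dots> = (\<integral>\<^sup>+k. ?f k \<partial>count_space ?I)"
    using finI by (simp add: nn_integral_count_space_finite)
  also have "\<dots> \<le> (\<integral>\<^sup>+k. ?f k \<partial>count_space ?D)"
    by (rule nn_integral_count_space_subset[OF sub])
  also have "\<dots> \<le> 2 ^ n * \<dots>"
  proof -
    have "(1::ennreal) \<le> 2 ^ n" by (rule one_le_power) simp
    from mult_right_mono[OF this] show ?thesis by (simp only: mult_1_left zero_le)
  qed
  also have "\<dots> \<le> (\<integral>\<^sup>+x. ennreal ((g x)\<^sup>2) \<partial>lebn n)"
    by (rule nn_integral_pt_le) measurable
  finally show ?thesis .
qed

lemma
  assumes g: "g \<in> hatL2 n"
  shows kern_L2: "finite S \<Longrightarrow> card S = n \<Longrightarrow> kern n g S \<in> L2 U.Q"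
    and sum_kern_square_le: "(\<Sum>S\<in>U.nsets n m. \<integral>u. (kern n g S u)\<^sup>2 \<partial>U.Q) \<le> (\<integral>x. (g x)\<^sup>2 \<partial>lebn n)"
proof -
  have [measurable]: "g \<in> borel_measurable (lebn n)" and gi: "integrable (lebn n) (\<lambda>x. (g x)\<^sup>2)"
    using g by (auto simp: hatL2_def)
  have fin: "(\<integral>\<^sup>+x. ennreal ((g x)\<^sup>2) \<partial>lebn n) = ennreal (\<integral>x. (g x)\<^sup>2 \<partial>lebn n)"
    using gi by (intro nn_integral_eq_integral) auto
  show L2: "kern n g S \<in> L2 U.Q" if S: "finite S" "card S = n" for S
  proof (intro L2I integrableI_nonneg)
    \<comment> \<open>\<open>Suc\<close> because \<open>nsets n m\<close> uses indices strictly
      below \<open>m\<close>.\<close>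
    have SN: "S \<in> U.nsets n (Suc (Max S))"
      using S by (auto simp: U.nsets_def less_Suc_eq_le)
    have "(\<integral>\<^sup>+u. ennreal ((kern n g S u)\<^sup>2) \<partial>U.Q) \<le> (\<Sum>S\<in>U.nsets n (Suc (Max S)). \<integral>\<^sup>+u. ennreal ((kern n g S u)\<^sup>2) \<partial>U.Q)"
      using SN U.nsets(1) by (intro member_le_sum) auto
    also have "\<dots> \<le> ennreal (\<integral>x. (g x)\<^sup>2 \<partial>lebn n)"
      using nn_integral_kern_square_le[of g n] fin by simp
    also have "\<dots> < \<infinity>" by simp
    finally show "(\<integral>\<^sup>+u. ennreal ((kern n g S u)\<^sup>2) \<partial>U.Q) < \<infinity>" .
  qed measurable
  have "ennreal (\<Sum>S\<in>U.nsets n m. \<integral>u. (kern n g S u)\<^sup>2 \<partial>U.Q) = (\<Sum>S\<in>U.nsets n m. \<integral>\<^sup>+u. ennreal ((kern n g S u)\<^sup>2) \<partial>U.Q)"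
    using L2[THEN L2D(2)] U.nsets(2) by (subst sum_ennreal[symmetric]) (auto simp: nn_integral_eq_integral intro!: sum.cong)
  also have "\<dots> \<le> ennreal (\<integral>x. (g x)\<^sup>2 \<partial>lebn n)"
    using nn_integral_kern_square_le[of g n] fin by simp
  finally show "(\<Sum>S\<in>U.nsets n m. \<integral>u. (kern n g S u)\<^sup>2 \<partial>U.Q) \<le> (\<integral>x. (g x)\<^sup>2 \<partial>lebn n)"
    by simp
qed

text \<open>An almost sure version of \<open>mult_int_formula\<close> whose measurability is
  immediate, as a limit of measurable functions.\<close>

definition chaos_lim :: "nat \<Rightarrow> ((nat \<Rightarrow> real) \<Rightarrow> real) \<Rightarrow> (nat \<Rightarrow> real) \<Rightarrow> real" where
  "chaos_lim n g u = lim (\<lambda>m. U.chaos n (kern n g) m u)"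

lemma
  assumes g: "g \<in> hatL2 n" "integrable (lebn n) g"
  shows AE_chaos_lim: "AE u in U.Q. mult_int_formula n g u = chaos_lim n g u"
    and chaos_lim_L2: "chaos_lim n g \<in> L2 U.Q"
    and integral_chaos_lim_square_le: "(\<integral>u. (chaos_lim n g u)\<^sup>2 \<partial>U.Q) \<le> (fact n)\<^sup>2 * 4 ^ n * (\<integral>x. (g x)\<^sup>2 \<partial>lebn n)"
    and chaos_lim_approx: "e > 0 \<Longrightarrow> \<exists>Z. U.dif_eigen n Z \<and> (\<integral>u. (chaos_lim n g u - Z u)\<^sup>2 \<partial>U.Q) < e"
proof -
  have [measurable]: "U.chaos n (kern n g) m \<in> borel_measurable U.Q" for m
    using U.chaos_L2[of n "kern n g"] kern_L2[OF g(1)] by auto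
  have [measurable]: "chaos_lim n g \<in> borel_measurable U.Q"
    unfolding chaos_lim_def[abs_def] by measurable
  show eq: "AE u in U.Q. mult_int_formula n g u = chaos_lim n g u"
    using AE_mult_int_formula[OF g] by eventually_elim (simp add: chaos_lim_def limI)
  have lim: "AE u in U.Q. (\<lambda>m. U.chaos n (kern n g) m u) \<longlonglongrightarrow> chaos_lim n g u"
    using AE_mult_int_formula[OF g] eq by eventually_elim simp
  have cl1: "(\<integral>\<^sup>+u. ennreal ((chaos_lim n g u)\<^sup>2) \<partial>U.Q) \<le> ennreal ((fact n)\<^sup>2 * 4 ^ n * (\<integral>x. (g x)\<^sup>2 \<partial>lebn n))"
    by (rule U.chaos_limit(1)[where H="kern n g", OF _ _ lim]) (rule kern_L2[OF g(1)] sum_kern_square_le[OF g(1)], assumption?, assumption?)+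
  have cl2: "\<exists>Z. U.dif_eigen n Z \<and> (\<integral>\<^sup>+u. ennreal ((chaos_lim n g u - Z u)\<^sup>2) \<partial>U.Q) < ennreal e" if "e > 0" for e
    by (rule U.chaos_limit(2)[where H="kern n g", OF _ _ lim that]) (rule kern_L2[OF g(1)] sum_kern_square_le[OF g(1)], assumption?, assumption?)+
  show L: "chaos_lim n g \<in> L2 U.Q"
    using le_less_trans[OF cl1 ennreal_less_top] by (intro L2I integrableI_nonneg) simp_all
  have "ennreal (\<integral>u. (chaos_lim n g u)\<^sup>2 \<partial>U.Q) \<le> ennreal ((fact n)\<^sup>2 * 4 ^ n * (\<integral>x. (g x)\<^sup>2 \<partial>lebn n))"
    using cl1 L2D(2)[OF L] by (simp add: nn_integral_eq_integral)
  then show "(\<integral>u. (chaos_lim n g u)\<^sup>2 \<partial>U.Q) \<le> (fact n)\<^sup>2 * 4 ^ n * (\<integral>x. (g x)\<^sup>2 \<partial>lebn n)"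
    by (subst (asm) ennreal_le_iff) auto
  assume e: "e > 0"
  from cl2[OF e] obtain Z where Z: "U.dif_eigen n Z" "(\<integral>\<^sup>+u. ennreal ((chaos_lim n g u - Z u)\<^sup>2) \<partial>U.Q) < ennreal e"
    by blast
  have "(\<lambda>u. chaos_lim n g u - Z u) \<in> L2 U.Q"
    using L Z(1) by (intro L2_diff) (auto simp: U.dif_eigen_def)
  from L2D(2)[OF this] Z have "(\<integral>u. (chaos_lim n g u - Z u)\<^sup>2 \<partial>U.Q) < e"
    by (simp add: nn_integral_eq_integral ennreal_less_iff)
  with Z(1) show "\<exists>Z. U.dif_eigen n Z \<and> (\<integral>u. (chaos_lim n g u - Z u)\<^sup>2 \<partial>U.Q) < e" by blast
qed

lemma hatL2_diff:
  assumes f: "f \<in> hatL2 n" and g: "g \<in> hatL2 n"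
  shows "(\<lambda>x. f x - g x) \<in> hatL2 n"
proof -
  have "f \<in> L2 (lebn n)" "g \<in> L2 (lebn n)" using assms by (auto simp: hatL2_def L2_def)
  from L2_diff[OF this] have "(\<lambda>x. f x - g x) \<in> L2 (lebn n)" .
  then show ?thesis using assms unfolding hatL2_def L2_def by simp
qed

text \<open>Linearity in the kernel is seen on the partial sums, almost surely for all
  \<open>m\<close> at once, and passes to the limit; the norm bound then applies to
  \<open>f - g\<close>.\<close>

lemma integral_chaos_lim_diff_le:
  assumes f: "f \<in> hatL2 n" "integrable (lebn n) f" and g: "g \<in> hatL2 n" "integrable (lebn n) g"
  shows "(\<integral>u. (chaos_lim n f u - chaos_lim n g u)\<^sup>2 \<partial>U.Q) \<le> (fact n)\<^sup>2 * 4 ^ n * (\<integral>x. (f x - g x)\<^sup>2 \<partial>lebn n)"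
proof -
  let ?h = "\<lambda>x. f x - g x"
  have h: "?h \<in> hatL2 n" "integrable (lebn n) ?h"
    using hatL2_diff[OF f(1) g(1)] f(2) g(2) by auto
  have kd: "kern n ?h S = (\<lambda>u. kern n f S u - kern n g S u)" for S
    by (simp add: kern_def[abs_def])
  have "AE u in U.Q. \<forall>m. \<forall>S\<in>U.nsets n m. U.hoef S (kern n ?h S) u = U.hoef S (kern n f S) u - U.hoef S (kern n g S) u"
    unfolding AE_all_countable kd
    using U.nsets(2) by (intro allI AE_finite_allI U.nsets(1) U.hoef_diff U.Q.P.L2_integrable kern_L2[OF f(1)] kern_L2[OF g(1)]) auto
  then have "AE u in U.Q. chaos_lim n f u - chaos_lim n g u = chaos_lim n ?h u"
    using AE_mult_int_formula[OF f] AE_mult_int_formula[OF g] AE_mult_int_formula[OF h]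
      AE_chaos_lim[OF f] AE_chaos_lim[OF g] AE_chaos_lim[OF h]
  proof eventually_elim
    case (elim u)
    have "(\<lambda>m. U.chaos n (kern n f) m u - U.chaos n (kern n g) m u) \<longlonglongrightarrow> chaos_lim n f u - chaos_lim n g u"
      using elim by (intro tendsto_diff) simp_all
    moreover have "U.chaos n (kern n f) m u - U.chaos n (kern n g) m u = U.chaos n (kern n ?h) m u" for m
      unfolding U.chaos_def sum_subtractf[symmetric] right_diff_distrib[symmetric]
      using elim(1) by (intro sum.cong) auto
    ultimately show ?case using elim LIMSEQ_unique by simp
  qed
  then have "(\<integral>u. (chaos_lim n f u - chaos_lim n g u)\<^sup>2 \<partial>U.Q) = (\<integral>u. (chaos_lim n ?h u)\<^sup>2 \<partial>U.Q)"
    using chaos_lim_L2[OF f] chaos_lim_L2[OF g] chaos_lim_L2[OF h]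
    by (intro integral_cong_AE) (measurable, auto)
  also have "\<dots> \<le> (fact n)\<^sup>2 * 4 ^ n * (\<integral>x. (?h x)\<^sup>2 \<partial>lebn n)"
    by (rule integral_chaos_lim_square_le[OF h])
  finally show ?thesis .
qed

text \<open>Cutting to cubes preserves symmetry and the support condition; finite measure of the
  cube makes the truncation integrable. Every point of \<open>Delta\<close> eventually lies in the
  cubes.\<close>

lemma hatL2_truncate:
  assumes f: "f \<in> hatL2 n"
  defines "g \<equiv> \<lambda>m x. f x * indicator (PiE {..<n} (\<lambda>_. {0..2 * real m})) x"
  shows "g m \<in> hatL2 n" "integrable (lebn n) (g m)"
    and "(\<lambda>m. \<integral>\<^sup>+x. ennreal ((g m x - f x)\<^sup>2) \<partial>lebn n) \<longlonglongrightarrow> 0"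
proof -
  let ?B = "\<lambda>m. PiE {..<n} (\<lambda>_. {0..2 * real m})"
  have [measurable]: "f \<in> borel_measurable (lebn n)" and fi: "integrable (lebn n) (\<lambda>x. (f x)\<^sup>2)"
    and fsym: "\<And>x p. x \<in> space (lebn n) \<Longrightarrow> p permutes {..<n} \<Longrightarrow> f (x \<circ> p) = f x"
    and f0: "\<And>x. x \<in> space (lebn n) \<Longrightarrow> x \<notin> Delta n \<Longrightarrow> f x = 0"
    using f by (auto simp: hatL2_def)
  have fL2: "f \<in> L2 (lebn n)" using fi by (intro L2I) auto
  have [measurable]: "?B m \<in> sets (lebn n)" for m by (intro sets_PiM_I_finite) auto
  have [measurable]: "g m \<in> borel_measurable (lebn n)" for m unfolding g_def by measurable
  have gf: "\<bar>g m x\<bar> \<le> \<bar>f x\<bar>" for m x by (simp add: g_def indicator_def)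
  have gL2: "g m \<in> L2 (lebn n)" for m
    by (rule L2_bound[OF fL2]) (simp_all add: gf)
  have Bsym: "x \<circ> p \<in> ?B m \<longleftrightarrow> x \<in> ?B m" if p: "p permutes {..<n}" and x: "x \<in> space (lebn n)" for x p m
  proof -
    have out: "x i = undefined" if "i \<notin> {..<n}" for i using x that by (auto simp: space_PiM PiE_iff extensional_def)
    have im: "p ` {..<n} = {..<n}" using p by (rule permutes_image)
    have "(\<forall>i\<in>{..<n}. x (p i) \<in> {0..2 * real m}) \<longleftrightarrow> (\<forall>i\<in>p ` {..<n}. x i \<in> {0..2 * real m})" by blast
    moreover have "x (p i) = undefined" if "i \<notin> {..<n}" for i
      using out[OF that] permutes_not_in[OF p that] by simp
    ultimately show ?thesis
      using out unfolding im PiE_iff extensional_def by simp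
  qed
  show "g m \<in> hatL2 n"
    using gL2[of m] fsym f0 Bsym
    by (simp add: hatL2_def L2_def) (simp add: g_def indicator_def)
  have "emeasure (lebn n) (?B m) = (\<Prod>i<n. emeasure lborel {0..2 * real m})"
    by (rule lebn.emeasure_PiM) auto
  also have "\<dots> = ennreal (2 * real m) ^ n" by simp
  also have "\<dots> < \<infinity>" by (simp add: power_less_top_ennreal)
  finally have "integrable (lebn n) (indicator (?B m) :: _ \<Rightarrow> real)" by (simp add: integrable_indicator_iff)
  moreover have "(\<lambda>x. (indicator (?B m) x)\<^sup>2) = (indicator (?B m) :: _ \<Rightarrow> real)"
    by (auto simp: indicator_def)
  ultimately have "(indicator (?B m) :: _ \<Rightarrow> real) \<in> L2 (lebn n)"
    by (intro L2I) simp_all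
  from L2_mult_integrable[OF fL2 this] show "integrable (lebn n) (g m)" by (simp add: g_def)
  have "(\<lambda>m. \<integral>\<^sup>+x. ennreal ((g m x - f x)\<^sup>2) \<partial>lebn n) \<longlonglongrightarrow> (\<integral>\<^sup>+x. 0 \<partial>lebn n)"
  proof (rule nn_integral_dominated_convergence[where w="\<lambda>x. ennreal ((f x)\<^sup>2)"])
    show "AE x in lebn n. ennreal ((g m x - f x)\<^sup>2) \<le> ennreal ((f x)\<^sup>2)" for m
      by (intro AE_I2 ennreal_leI) (simp add: g_def indicator_def)
    show "(\<integral>\<^sup>+x. ennreal ((f x)\<^sup>2) \<partial>lebn n) < \<infinity>"
      using fi by (simp add: nn_integral_eq_integral)
    show "AE x in lebn n. (\<lambda>m. ennreal ((g m x - f x)\<^sup>2)) \<longlonglongrightarrow> 0"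
    proof (rule AE_I2)
      fix x assume x: "x \<in> space (lebn n)"
      show "(\<lambda>m. ennreal ((g m x - f x)\<^sup>2)) \<longlonglongrightarrow> 0"
      proof (cases "x \<in> Delta n")
        case False
        then show ?thesis using f0[OF x] by (simp add: g_def)
      next
        case True
        then obtain k :: "nat \<Rightarrow> nat" where k: "x \<in> PiE {..<n} (\<lambda>i. {2 * real (k i)..2 * real (k i) + 2})"
          by (auto simp: Delta_def)
        \<comment> \<open>A sum as a crude upper bound for all \<open>k i + 1\<close>; it also
          covers \<open>n = 0\<close>.\<close>
        define m\<^sub>0 where "m\<^sub>0 = (\<Sum>i<n. Suc (k i))"
        have "x \<in> ?B m" if m: "m \<ge> m\<^sub>0" for m
        proof -
          have "x i \<in> {0..2 * real m}" if i: "i < n" for i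
          proof -
            have "Suc (k i) \<le> m\<^sub>0"
              unfolding m\<^sub>0_def using i by (intro member_le_sum) auto
            then have "real (k i) + 1 \<le> real m" using m by linarith
            moreover have "2 * real (k i) \<le> x i" "x i \<le> 2 * real (k i) + 2" using k i by (auto simp: PiE_iff)
            ultimately show ?thesis by auto
          qed
          then show ?thesis using k by (auto simp: PiE_iff)
        qed
        then have "eventually (\<lambda>m. ennreal ((g m x - f x)\<^sup>2) = 0) sequentially"
          by (intro eventually_sequentiallyI[of m\<^sub>0]) (simp add: g_def)
        then show ?thesis by (rule tendsto_eventually)
      qed
    qed
  qed measurable
  then show "(\<lambda>m. \<integral>\<^sup>+x. ennreal ((g m x - f x)\<^sup>2) \<partial>lebn n) \<longlonglongrightarrow> 0" by simp
qed

section \<open>Transfer to an arbitrary i.i.d. uniform sequence\<close>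

lemma iid_uniform_distr:
  assumes "prob_space M" and iid: "iid_uniform M X"
  shows "(\<lambda>\<omega> k. X k \<omega>) \<in> M \<rightarrow>\<^sub>M U.Q" and "distr M U.Q (\<lambda>\<omega> k. X k \<omega>) = U.Q"
proof -
  interpret prob_space M by fact
  have ind: "indep_vars (\<lambda>_. borel) X UNIV" and un: "\<And>k. distr M borel (X k) = unif"
    using iid by (auto simp: iid_uniform_def)
  have rv: "X k \<in> M \<rightarrow>\<^sub>M borel" for k using ind by (auto simp: indep_vars_def)
  have m: "(\<lambda>\<omega> k. X k \<omega>) \<in> M \<rightarrow>\<^sub>M PiM UNIV (\<lambda>_. borel)"
    using rv by (intro measurable_PiM_single') (auto simp: space_PiM)
  then show "(\<lambda>\<omega> k. X k \<omega>) \<in> M \<rightarrow>\<^sub>M U.Q"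
    by (simp add: measurable_cong_sets[OF refl sets_Q])
  have "distr M (PiM UNIV (\<lambda>_. borel)) (\<lambda>\<omega>. \<lambda>i\<in>UNIV. X i \<omega>) = U.Q"
    using indep_vars_iff_distr_eq_PiM'[where I=UNIV and M'="\<lambda>_. borel" and X=X] rv ind un by simp
  then have "distr M (PiM UNIV (\<lambda>_. borel)) (\<lambda>\<omega> k. X k \<omega>) = U.Q"
    by (simp add: restrict_UNIV)
  then show "distr M U.Q (\<lambda>\<omega> k. X k \<omega>) = U.Q"
    by (simp cong: distr_cong add: sets_Q)
qed

context
  fixes M :: "'a measure" and X :: "nat \<Rightarrow> 'a \<Rightarrow> real"
  assumes M: "prob_space M" and iid: "iid_uniform M X"
begin

lemma nn_integral_iid:
  assumes [measurable]: "\<phi> \<in> borel_measurable U.Q"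
  shows "(\<integral>\<^sup>+\<omega>. \<phi> (\<lambda>k. X k \<omega>) \<partial>M) = (\<integral>\<^sup>+u. \<phi> u \<partial>U.Q)"
proof -
  have "(\<integral>\<^sup>+u. \<phi> u \<partial>U.Q) = (\<integral>\<^sup>+u. \<phi> u \<partial>distr M U.Q (\<lambda>\<omega> k. X k \<omega>))"
    by (simp only: iid_uniform_distr(2)[OF M iid])
  also have "\<dots> = (\<integral>\<^sup>+\<omega>. \<phi> (\<lambda>k. X k \<omega>) \<partial>M)"
    by (rule nn_integral_distr[OF iid_uniform_distr(1)[OF M iid]]) simp
  finally show ?thesis ..
qed

lemma integrable_iid:
  fixes \<phi> :: "(nat \<Rightarrow> real) \<Rightarrow> real"
  assumes [measurable]: "\<phi> \<in> borel_measurable U.Q"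
  shows "integrable M (\<lambda>\<omega>. \<phi> (\<lambda>k. X k \<omega>)) \<longleftrightarrow> integrable U.Q \<phi>"
proof -
  have "integrable U.Q \<phi> \<longleftrightarrow> integrable (distr M U.Q (\<lambda>\<omega> k. X k \<omega>)) \<phi>"
    by (simp only: iid_uniform_distr(2)[OF M iid])
  also have "\<dots> \<longleftrightarrow> integrable M (\<lambda>\<omega>. \<phi> (\<lambda>k. X k \<omega>))"
    by (rule integrable_distr_eq[OF iid_uniform_distr(1)[OF M iid]]) simp
  finally show ?thesis ..
qed

lemma integral_iid:
  fixes \<phi> :: "(nat \<Rightarrow> real) \<Rightarrow> real"
  assumes [measurable]: "\<phi> \<in> borel_measurable U.Q"
  shows "(\<integral>\<omega>. \<phi> (\<lambda>k. X k \<omega>) \<partial>M) = (\<integral>u. \<phi> u \<partial>U.Q)"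
proof -
  have "(\<integral>u. \<phi> u \<partial>U.Q) = (\<integral>u. \<phi> u \<partial>distr M U.Q (\<lambda>\<omega> k. X k \<omega>))"
    by (simp only: iid_uniform_distr(2)[OF M iid])
  also have "\<dots> = (\<integral>\<omega>. \<phi> (\<lambda>k. X k \<omega>) \<partial>M)"
    by (rule integral_distr[OF iid_uniform_distr(1)[OF M iid]]) simp
  finally show ?thesis ..
qed

lemma AE_iid:
  assumes "AE u in U.Q. P u"
  shows "AE \<omega> in M. P (\<lambda>k. X k \<omega>)"
proof (rule AE_distrD[where f="\<lambda>\<omega> k. X k \<omega>"])
  show "(\<lambda>\<omega> k. X k \<omega>) \<in> M \<rightarrow>\<^sub>M U.Q" by (rule iid_uniform_distr(1)[OF M iid])
  show "AE u in distr M U.Q (\<lambda>\<omega> k. X k \<omega>). P u"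
    unfolding iid_uniform_distr(2)[OF M iid] by fact
qed

lemma nn_integral_mult_int_formula_diff:
  assumes g: "g \<in> hatL2 n" "integrable (lebn n) g" and [measurable]: "F \<in> borel_measurable U.Q"
  shows "(\<integral>\<^sup>+\<omega>. ennreal ((mult_int_formula n g (\<lambda>k. X k \<omega>) - F (\<lambda>k. X k \<omega>))\<^sup>2) \<partial>M) =
    (\<integral>\<^sup>+u. ennreal ((chaos_lim n g u - F u)\<^sup>2) \<partial>U.Q)"
proof -
  have [measurable]: "chaos_lim n g \<in> borel_measurable U.Q" using chaos_lim_L2[OF g] by auto
  have "(\<integral>\<^sup>+\<omega>. ennreal ((mult_int_formula n g (\<lambda>k. X k \<omega>) - F (\<lambda>k. X k \<omega>))\<^sup>2) \<partial>M) =
      (\<integral>\<^sup>+\<omega>. ennreal ((chaos_lim n g (\<lambda>k. X k \<omega>) - F (\<lambda>k. X k \<omega>))\<^sup>2) \<partial>M)"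
    using AE_iid[OF AE_chaos_lim[OF g]] by (intro nn_integral_cong_AE) auto
  also have "\<dots> = (\<integral>\<^sup>+u. ennreal ((chaos_lim n g u - F u)\<^sup>2) \<partial>U.Q)"
    by (rule nn_integral_iid) measurable
  finally show ?thesis .
qed

text \<open>Valid for every representative, so the version selected in \<open>mult_int\<close> is
  irrelevant. \<open>F\<close> is close to some \<open>chaos_lim n (g m)\<close>, which in turn is
  close to an eigenfunction.\<close>

lemma is_mult_int_dif_eigen_lim:
  assumes F: "is_mult_int M X n f F"
  shows "F \<in> L2 U.Q" "U.dif_eigen_lim n F"
proof -
  have [measurable]: "F \<in> borel_measurable U.Q"
    using F by (simp add: is_mult_int_def measurable_cong_sets[OF sets_Q refl])
  show FL: "F \<in> L2 U.Q"
    using F integrable_iid[of "\<lambda>u. (F u)\<^sup>2"] by (intro L2I) (auto simp: is_mult_int_def)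
  from F obtain g where g: "\<And>m. g m \<in> hatL2 n" "\<And>m. integrable (lebn n) (g m)"
    and lim: "(\<lambda>m. \<integral>\<^sup>+\<omega>. ennreal ((mult_int_formula n (g m) (\<lambda>k. X k \<omega>) - F (\<lambda>k. X k \<omega>))\<^sup>2) \<partial>M) \<longlonglongrightarrow> 0"
    by (auto simp: is_mult_int_def)
  show "U.dif_eigen_lim n F"
    unfolding U.dif_eigen_lim_def
  proof (intro conjI FL allI impI)
    fix e :: real assume e: "e > 0"
    \<comment> \<open>Two errors below \<open>e / 4\<close>, each doubled when the square of the sum
      is expanded.\<close>
    then have "ennreal (e / 4) > 0" by simp
    from order_tendstoD(2)[OF lim this] obtain m where
      "(\<integral>\<^sup>+\<omega>. ennreal ((mult_int_formula n (g m) (\<lambda>k. X k \<omega>) - F (\<lambda>k. X k \<omega>))\<^sup>2) \<partial>M) < ennreal (e / 4)"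
      by (auto simp: eventually_sequentially)
    then have m: "(\<integral>\<^sup>+u. ennreal ((chaos_lim n (g m) u - F u)\<^sup>2) \<partial>U.Q) < ennreal (e / 4)"
      by (simp add: nn_integral_mult_int_formula_diff[OF g])
    note L = chaos_lim_L2[OF g(1) g(2), of m]
    have m': "(\<integral>u. (chaos_lim n (g m) u - F u)\<^sup>2 \<partial>U.Q) < e / 4"
      using m L2_diff[OF L FL, THEN L2D(2)] e by (simp add: nn_integral_eq_integral ennreal_less_iff)
    obtain Z where Z: "U.dif_eigen n Z" "(\<integral>u. (chaos_lim n (g m) u - Z u)\<^sup>2 \<partial>U.Q) < e / 4"
      using chaos_lim_approx[OF g(1) g(2), of "e / 4" m] e by auto
    then have ZL: "Z \<in> L2 U.Q" by (simp add: U.dif_eigen_def)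
    have "(\<integral>u. (F u - Z u)\<^sup>2 \<partial>U.Q) \<le> (\<integral>u. 2 * (chaos_lim n (g m) u - F u)\<^sup>2 + 2 * (chaos_lim n (g m) u - Z u)\<^sup>2 \<partial>U.Q)"
    proof (rule integral_mono)
      fix u
      have "(a - b)\<^sup>2 \<le> 2 * (c - a)\<^sup>2 + 2 * (c - b)\<^sup>2" for a b c :: real
        using zero_le_power2[of "2 * c - a - b"] by (simp add: power2_eq_square algebra_simps)
      then show "(F u - Z u)\<^sup>2 \<le> 2 * (chaos_lim n (g m) u - F u)\<^sup>2 + 2 * (chaos_lim n (g m) u - Z u)\<^sup>2" .
    qed (use L2_diff[OF L FL, THEN L2D(2)] L2_diff[OF L ZL, THEN L2D(2)] L2_diff[OF FL ZL, THEN L2D(2)] in simp_all)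
    also have "\<dots> = 2 * (\<integral>u. (chaos_lim n (g m) u - F u)\<^sup>2 \<partial>U.Q) + 2 * (\<integral>u. (chaos_lim n (g m) u - Z u)\<^sup>2 \<partial>U.Q)"
      using L2_diff[OF L FL, THEN L2D(2)] L2_diff[OF L ZL, THEN L2D(2)] by simp
    also have "\<dots> < e" using m' Z(2) by simp
    finally show "\<exists>Z. U.dif_eigen n Z \<and> (\<integral>u. (F u - Z u)\<^sup>2 \<partial>U.Q) < e" using Z(1) by blast
  qed
qed

text \<open>Gives content to the choice in \<open>mult_int\<close>. The kernel estimate makes the
  integrals of the truncations Cauchy, and completeness yields the limit.\<close>

theorem is_mult_int_exists:
  assumes f: "f \<in> hatL2 n"
  shows "\<exists>F. is_mult_int M X n f F"
proof -
  obtain g where g: "\<And>m. g m \<in> hatL2 n" "\<And>m. integrable (lebn n) (g m)"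
    and lim: "(\<lambda>m. \<integral>\<^sup>+x. ennreal ((g m x - f x)\<^sup>2) \<partial>lebn n) \<longlonglongrightarrow> 0"
    by (rule that[OF hatL2_truncate[OF f]])
  have fL: "f \<in> L2 (lebn n)" and gL: "g m \<in> L2 (lebn n)" for m
    using f g(1)[of m] by (auto simp: hatL2_def L2_def)
  have lim': "(\<lambda>m. \<integral>x. (g m x - f x)\<^sup>2 \<partial>lebn n) \<longlonglongrightarrow> 0"
  proof -
    have "(\<lambda>m. ennreal (\<integral>x. (g m x - f x)\<^sup>2 \<partial>lebn n)) \<longlonglongrightarrow> ennreal 0"
      using lim L2_diff[OF gL fL, THEN L2D(2)] by (simp add: nn_integral_eq_integral)
    then show ?thesis by (subst (asm) tendsto_ennreal_iff) auto
  qed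
  let ?C = "(fact n)\<^sup>2 * 4 ^ n :: real"
  note L = chaos_lim_L2[OF g]
  have cauchy: "\<exists>N. \<forall>i\<ge>N. \<forall>j\<ge>N. (\<integral>u. (chaos_lim n (g i) u - chaos_lim n (g j) u)\<^sup>2 \<partial>U.Q) < e" if e: "e > 0" for e
  proof -
    have C: "?C > 0" by simp
    then have "e / (4 * ?C) > 0" using e by simp
    from order_tendstoD(2)[OF lim' this] obtain N where N: "\<And>m. m \<ge> N \<Longrightarrow> (\<integral>x. (g m x - f x)\<^sup>2 \<partial>lebn n) < e / (4 * ?C)"
      by (auto simp: eventually_sequentially)
    have "(\<integral>u. (chaos_lim n (g i) u - chaos_lim n (g j) u)\<^sup>2 \<partial>U.Q) < e" if ij: "i \<ge> N" "j \<ge> N" for i j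
    proof -
      have "(\<integral>u. (chaos_lim n (g i) u - chaos_lim n (g j) u)\<^sup>2 \<partial>U.Q) \<le> ?C * (\<integral>x. (g i x - g j x)\<^sup>2 \<partial>lebn n)"
        by (rule integral_chaos_lim_diff_le[OF g g])
      also have "\<dots> \<le> ?C * (\<integral>x. 2 * (g i x - f x)\<^sup>2 + 2 * (g j x - f x)\<^sup>2 \<partial>lebn n)"
      proof (intro mult_left_mono integral_mono)
        fix x
        have "(a - b)\<^sup>2 \<le> 2 * (a - c)\<^sup>2 + 2 * (b - c)\<^sup>2" for a b c :: real
          using zero_le_power2[of "a + b - 2 * c"] by (simp add: power2_eq_square algebra_simps)
        then show "(g i x - g j x)\<^sup>2 \<le> 2 * (g i x - f x)\<^sup>2 + 2 * (g j x - f x)\<^sup>2" .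
      qed (use L2_diff[OF gL fL, THEN L2D(2)] L2_diff[OF gL gL, THEN L2D(2)] in simp_all)
      also have "\<dots> = ?C * (2 * (\<integral>x. (g i x - f x)\<^sup>2 \<partial>lebn n) + 2 * (\<integral>x. (g j x - f x)\<^sup>2 \<partial>lebn n))"
        using L2_diff[OF gL fL, THEN L2D(2)] by simp
      also have "\<dots> < ?C * (2 * (e / (4 * ?C)) + 2 * (e / (4 * ?C)))"
        using N[OF ij(1)] N[OF ij(2)] C by (intro mult_strict_left_mono) linarith+
      also have "\<dots> = e" using C by (simp add: field_simps)
      finally show ?thesis .
    qed
    then show ?thesis by blast
  qed
  obtain F where F: "F \<in> L2 U.Q" "(\<lambda>m. \<integral>\<^sup>+u. ennreal ((chaos_lim n (g m) u - F u)\<^sup>2) \<partial>U.Q) \<longlonglongrightarrow> 0"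
    using U.Q.P.L2_complete[of "\<lambda>m. chaos_lim n (g m)", OF L cauchy] by blast
  have [measurable]: "F \<in> borel_measurable U.Q" using F by auto
  have "is_mult_int M X n f F"
    unfolding is_mult_int_def
  proof (intro conjI exI[of _ g] allI)
    show "F \<in> borel_measurable (PiM UNIV (\<lambda>_. borel))"
      using \<open>F \<in> borel_measurable U.Q\<close> by (simp add: measurable_cong_sets[OF sets_Q refl])
    show "integrable M (\<lambda>\<omega>. (F (\<lambda>k. X k \<omega>))\<^sup>2)"
      using integrable_iid[of "\<lambda>u. (F u)\<^sup>2"] L2D(2)[OF F(1)] by simp
    show "(\<lambda>m. \<integral>\<^sup>+\<omega>. ennreal ((mult_int_formula n (g m) (\<lambda>k. X k \<omega>) - F (\<lambda>k. X k \<omega>))\<^sup>2) \<partial>M) \<longlonglongrightarrow> 0"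
      using F(2) by (simp add: nn_integral_mult_int_formula_diff[OF g])
    show "(\<lambda>m. L2_norm_sq n (\<lambda>x. g m x - f x)) \<longlonglongrightarrow> 0"
    proof (rule tendsto_sandwich[OF _ _ tendsto_const lim])
      show "eventually (\<lambda>m. L2_norm_sq n (\<lambda>x. g m x - f x) \<le> (\<integral>\<^sup>+x. ennreal ((g m x - f x)\<^sup>2) \<partial>lebn n)) sequentially"
      proof (rule always_eventually, rule allI)
        fix m
        have one: "(1::ennreal) \<le> 2 ^ n" by (rule one_le_power) simp
        have "a / 2 ^ n \<le> a" for a :: ennreal
          using mult_right_mono[OF one, of a] less_le_trans[OF zero_less_one one]
          by (intro divide_le_posI_ennreal) simp_all
        then show "L2_norm_sq n (\<lambda>x. g m x - f x) \<le> (\<integral>\<^sup>+x. ennreal ((g m x - f x)\<^sup>2) \<partial>lebn n)"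
          by (simp add: L2_norm_sq_def)
      qed
    qed simp
  qed (use g in auto)
  then show ?thesis by (intro exI)
qed

end

section \<open>The finite difference operator\<close>

lemma distr_unif_shift:
  "distr unif borel (\<lambda>v. 2 * real k + 1 + v) = density lborel (\<lambda>x. ennreal (indicator {2 * real k<..<2 * real k + 2} x / 2))"
proof (rule measure_eqI)
  fix A assume "A \<in> sets (distr unif borel (\<lambda>v. 2 * real k + 1 + v))"
  then have [measurable]: "A \<in> sets borel" by simp
  have "emeasure (distr unif borel (\<lambda>v. 2 * real k + 1 + v)) A = (\<integral>\<^sup>+x. indicator A x \<partial>distr unif borel (\<lambda>v. 2 * real k + 1 + v))"
    by simp
  also have "\<dots> = (\<integral>\<^sup>+v. indicator A (2 * real k + 1 + v) \<partial>unif)"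
    by (rule nn_integral_distr) measurable
  also have "\<dots> = (\<integral>\<^sup>+x. indicator A x * (indicator {2 * real k<..<2 * real k + 2} x / 2) \<partial>lborel)"
    by (rule nn_integral_unif_shift) measurable
  also have "\<dots> = (\<integral>\<^sup>+x. ennreal (indicator {2 * real k<..<2 * real k + 2} x / 2) * indicator A x \<partial>lborel)"
    by (intro nn_integral_cong) (auto simp: indicator_def divide_ennreal[symmetric])
  also have "\<dots> = emeasure (density lborel (\<lambda>x. ennreal (indicator {2 * real k<..<2 * real k + 2} x / 2))) A"
    by (rule emeasure_density[symmetric]) measurable
  finally show "emeasure (distr unif borel (\<lambda>v. 2 * real k + 1 + v)) A = emeasure (density lborel (\<lambda>x. ennreal (indicator {2 * real k<..<2 * real k + 2} x / 2))) A" .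
qed simp

lemma integral_unif_shift:
  fixes \<phi> :: "real \<Rightarrow> real"
  assumes [measurable]: "\<phi> \<in> borel_measurable borel"
  shows "(\<integral>v. \<phi> (2 * real k + 1 + v) \<partial>unif) = 1 / 2 * (\<integral>x. indicator {2 * real k<..<2 * real k + 2} x * \<phi> x \<partial>lborel)"
proof -
  have "(\<integral>v. \<phi> (2 * real k + 1 + v) \<partial>unif) = (\<integral>x. \<phi> x \<partial>distr unif borel (\<lambda>v. 2 * real k + 1 + v))"
    by (rule integral_distr[symmetric]) measurable
  also have "\<dots> = (\<integral>x. (indicator {2 * real k<..<2 * real k + 2} x / 2) *\<^sub>R \<phi> x \<partial>lborel)"
    unfolding distr_unif_shift by (rule integral_density) auto
  also have "\<dots> = (\<integral>x. 1 / 2 * (indicator {2 * real k<..<2 * real k + 2} x * \<phi> x) \<partial>lborel)"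
    by (intro Bochner_Integration.integral_cong) auto
  finally show ?thesis by simp
qed

lemma measurable_upd [measurable]: "(\<lambda>v. u(k := v)) \<in> borel \<rightarrow>\<^sub>M U.Q"
proof -
  have "(\<lambda>v. (u(k := v)) i) \<in> borel \<rightarrow>\<^sub>M borel" for i
    by (cases "i = k") auto
  then have "(\<lambda>v. u(k := v)) \<in> borel \<rightarrow>\<^sub>M PiM UNIV (\<lambda>_. borel)"
    by (rule measurable_PiM_single') (simp add: space_PiM)
  then show ?thesis
    by (simp add: measurable_cong_sets[OF refl sets_Q])
qed

lemma mix_upd: "mix (- {k}) u w = u(k := w k)"
  by (auto simp: mix_def)

lemma distr_component: "distr U.Q unif (\<lambda>w. w k) = unif"
  by (rule U.Q.PiM_component) simp

lemma nn_integral_component: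
  assumes [measurable]: "\<phi> \<in> borel_measurable borel"
  shows "(\<integral>\<^sup>+w. \<phi> (w k) \<partial>U.Q) = (\<integral>\<^sup>+v. \<phi> v \<partial>unif)"
proof -
  have "(\<integral>\<^sup>+v. \<phi> v \<partial>unif) = (\<integral>\<^sup>+v. \<phi> v \<partial>distr U.Q unif (\<lambda>w. w k))"
    by (simp only: distr_component)
  also have "\<dots> = (\<integral>\<^sup>+w. \<phi> (w k) \<partial>U.Q)"
    by (rule nn_integral_distr) (rule measurable_component_singleton, auto)
  finally show ?thesis ..
qed

lemma integral_component:
  fixes \<phi> :: "real \<Rightarrow> real"
  assumes [measurable]: "\<phi> \<in> borel_measurable borel"
  shows "(\<integral>w. \<phi> (w k) \<partial>U.Q) = (\<integral>v. \<phi> v \<partial>unif)"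
proof -
  have "(\<integral>v. \<phi> v \<partial>unif) = (\<integral>v. \<phi> v \<partial>distr U.Q unif (\<lambda>w. w k))"
    by (simp only: distr_component)
  also have "\<dots> = (\<integral>w. \<phi> (w k) \<partial>U.Q)"
    by (rule integral_distr) (rule measurable_component_singleton, auto)
  finally show ?thesis ..
qed

lemma floor_half:
  assumes "2 * real k \<le> t" "t < 2 * real k + 2"
  shows "\<lfloor>t / 2\<rfloor> = int k"
  using assms by (intro floor_unique) auto

text \<open>Averaging over the closed block of \<open>t\<close> with weight 1/2 is integrating out
  coordinate \<open>k\<close>; \<open>t\<close> runs in a half-open block because
  \<open>\<lfloor>t / 2\<rfloor>\<close> jumps at its right end.\<close>

lemma nabla_eq_dif:
  assumes [measurable]: "F \<in> borel_measurable U.Q" and t: "2 * real k \<le> t" "t < 2 * real k + 2"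
  shows "nabla t F u = U.dif k F (u(k := t - 2 * real k - 1))"
proof -
  let ?\<phi> = "\<lambda>s. F (u(k := s - 2 * real k - 1))"
  have fl: "\<lfloor>t / 2\<rfloor> = int k" by (rule floor_half[OF t])
  have [measurable]: "(\<lambda>v. F (u(k := v))) \<in> borel_measurable borel"
    by (rule measurable_compose[OF measurable_upd]) simp
  have "U.cexp (- {k}) F (u(k := t - 2 * real k - 1)) = (\<integral>w. F (u(k := w k)) \<partial>U.Q)"
    by (simp add: U.cexp_def mix_upd)
  also have "\<dots> = (\<integral>v. F (u(k := v)) \<partial>unif)"
    by (rule integral_component) measurable
  also have "\<dots> = (\<integral>v. ?\<phi> (2 * real k + 1 + v) \<partial>unif)"
    by simp
  also have "\<dots> = 1 / 2 * (\<integral>s. indicator {2 * real k<..<2 * real k + 2} s * ?\<phi> s \<partial>lborel)"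
    by (rule integral_unif_shift) measurable
  also have "(\<integral>s. indicator {2 * real k<..<2 * real k + 2} s * ?\<phi> s \<partial>lborel) = (LBINT s:block t. F (Psi s u))"
    unfolding set_lebesgue_integral_def
  proof (rule integral_cong_AE)
    have eq: "indicator {2 * real k<..<2 * real k + 2} s * ?\<phi> s = indicator (block t) s *\<^sub>R F (Psi s u)"
      if s: "s \<noteq> 2 * real k" "s \<noteq> 2 * real k + 2" for s
    proof (cases "2 * real k < s \<and> s < 2 * real k + 2")
      case True
      then have "\<lfloor>s / 2\<rfloor> = int k" by (intro floor_half) auto
      with True show ?thesis by (simp add: block_def fl Psi_def)
    next
      case False
      with s show ?thesis by (auto simp: block_def fl indicator_def)
    qed
    show "AE s in lborel. indicator {2 * real k<..<2 * real k + 2} s * ?\<phi> s = indicator (block t) s *\<^sub>R F (Psi s u)"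
      using AE_lborel_singleton[of "2 * real k"] AE_lborel_singleton[of "2 * real k + 2"]
      by eventually_elim (rule eq)
    \<comment> \<open>At \<open>s = 2 * k + 2\<close> the map \<open>Psi s\<close> already changes
      coordinate \<open>k + 1\<close>; isolating this point exhibits a measurable function.\<close>
    have "indicator (block t) s *\<^sub>R F (Psi s u) =
      (if s = 2 * real k + 2 then F (Psi (2 * real k + 2) u) else indicator {2 * real k..<2 * real k + 2} s * ?\<phi> s)" for s
    proof (cases "2 * real k \<le> s \<and> s < 2 * real k + 2")
      case True
      then have "\<lfloor>s / 2\<rfloor> = int k" by (intro floor_half) auto
      with True show ?thesis by (simp add: block_def fl Psi_def)
    qed (auto simp: block_def fl indicator_def)
    then have "(\<lambda>s. indicator (block t) s *\<^sub>R F (Psi s u)) =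
      (\<lambda>s. if s = 2 * real k + 2 then F (Psi (2 * real k + 2) u) else indicator {2 * real k..<2 * real k + 2} s * ?\<phi> s)" ..
    moreover have "\<dots> \<in> borel_measurable lborel" by measurable
    ultimately show "(\<lambda>s. indicator (block t) s *\<^sub>R F (Psi s u)) \<in> borel_measurable lborel" by simp
  qed measurable
  finally have "U.cexp (- {k}) F (u(k := t - 2 * real k - 1)) = 1 / 2 * (LBINT s:block t. F (Psi s u))" .
  then show ?thesis
    by (simp add: nabla_def U.dif_def Psi_def fl)
qed

text \<open>Each block has length 2 and \<open>unif\<close> has mass 1, whence the factor 2. The
  integrand depends on \<open>k\<close> because the replaced coordinate changes from block to
  block.\<close>

lemma nn_integral_half_line:
  assumes \<psi>: "\<And>k. \<psi> k \<in> borel_measurable borel"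
    and \<Phi>: "\<And>k t. 2 * real k \<le> t \<Longrightarrow> t < 2 * real k + 2 \<Longrightarrow> \<Phi> t = \<psi> k (t - 2 * real k - 1)"
  shows "(\<integral>\<^sup>+t\<in>{0..}. \<Phi> t \<partial>lborel) = (\<Sum>k. 2 * (\<integral>\<^sup>+v. \<psi> k v \<partial>unif))"
proof -
  let ?I = "\<lambda>k. {2 * real k..<2 * real k + 2}"
  have [measurable]: "(\<lambda>t. \<psi> k (t - 2 * real k - 1)) \<in> borel_measurable borel" for k
    by (rule measurable_compose[OF _ \<psi>]) measurable
  have disj: "k = nat \<lfloor>t / 2\<rfloor>" if "t \<in> ?I k" for k t
    using floor_half[of k t] that by simp
  have "\<Phi> t * indicator {0..} t = (\<Sum>k. \<psi> k (t - 2 * real k - 1) * indicator (?I k) t)" for t :: real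
  proof (cases "0 \<le> t")
    case True
    let ?k = "nat \<lfloor>t / 2\<rfloor>"
    have "real ?k = of_int \<lfloor>t / 2\<rfloor>" using True by simp
    then have t: "t \<in> ?I ?k" using floor_le_iff[of "t / 2"] by auto linarith+
    have "(\<Sum>k. \<psi> k (t - 2 * real k - 1) * indicator (?I k) t) = (\<Sum>k\<in>{?k}. \<psi> k (t - 2 * real k - 1) * indicator (?I k) t)"
      using disj[of t] by (intro suminf_finite) (auto simp: indicator_def)
    also have "\<dots> = \<psi> ?k (t - 2 * real ?k - 1) * indicator (?I ?k) t"
      by (simp only: sum.insert[OF finite.emptyI] sum.empty empty_iff not_False_eq_True add_0_right)
    also have "\<dots> = \<Phi> t"
      using \<Phi>[of ?k t] t by (simp only: indicator_simps(1)[OF t] mult_1_right atLeastLessThan_iff)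
    finally show ?thesis using True by simp
  next
    case False
    then have "t \<notin> ?I k" for k by auto
    with False show ?thesis by simp
  qed
  then have "(\<integral>\<^sup>+t\<in>{0..}. \<Phi> t \<partial>lborel) = (\<integral>\<^sup>+t. (\<Sum>k. \<psi> k (t - 2 * real k - 1) * indicator (?I k) t) \<partial>lborel)"
    by simp
  also have "\<dots> = (\<Sum>k. \<integral>\<^sup>+t. \<psi> k (t - 2 * real k - 1) * indicator (?I k) t \<partial>lborel)"
    by (rule nn_integral_suminf) measurable
  also have "\<dots> = (\<Sum>k. 2 * (\<integral>\<^sup>+v. \<psi> k v \<partial>unif))"
  proof (rule suminf_cong)
    fix k
    have "(\<integral>\<^sup>+v. \<psi> k v \<partial>unif) = (\<integral>\<^sup>+v. (\<lambda>t. \<psi> k (t - 2 * real k - 1)) (2 * real k + 1 + v) \<partial>unif)"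
      by simp
    also have "\<dots> = (\<integral>\<^sup>+t. \<psi> k (t - 2 * real k - 1) * (indicator {2 * real k<..<2 * real k + 2} t / 2) \<partial>lborel)"
      by (rule nn_integral_unif_shift) measurable
    finally have "2 * (\<integral>\<^sup>+v. \<psi> k v \<partial>unif) = (\<integral>\<^sup>+t. 2 * (\<psi> k (t - 2 * real k - 1) * (indicator {2 * real k<..<2 * real k + 2} t / 2)) \<partial>lborel)"
      by (simp add: nn_integral_cmult)
    also have "\<dots> = (\<integral>\<^sup>+t. \<psi> k (t - 2 * real k - 1) * indicator (?I k) t \<partial>lborel)"
    proof (rule nn_integral_cong_AE)
      have two: "2 * (a * (1 / 2)) = a" for a :: ennreal
        by (simp add: ennreal_times_divide mult.commute[of 2] mult_divide_eq_ennreal)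
      show "AE t in lborel. 2 * (\<psi> k (t - 2 * real k - 1) * (indicator {2 * real k<..<2 * real k + 2} t / 2)) =
          \<psi> k (t - 2 * real k - 1) * indicator (?I k) t"
        using AE_lborel_singleton[of "2 * real k"]
        by eventually_elim (auto simp: indicator_def two)
    qed
    finally show "(\<integral>\<^sup>+t. \<psi> k (t - 2 * real k - 1) * indicator (?I k) t \<partial>lborel) = 2 * (\<integral>\<^sup>+v. \<psi> k v \<partial>unif)" ..
  qed
  finally show ?thesis .
qed

context
  fixes F :: "(nat \<Rightarrow> real) \<Rightarrow> real"
  assumes F [measurable]: "F \<in> borel_measurable U.Q"
begin

lemma measurable_dif_upd [measurable]: "(\<lambda>v. U.dif k F (u(k := v))) \<in> borel_measurable borel"
  by (rule U.measurable_dif[OF F measurable_upd])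

lemma nn_integral_dif_mix:
  assumes [measurable]: "\<phi> \<in> borel_measurable borel"
  shows "(\<integral>\<^sup>+w. \<phi> (U.dif k F (mix (- {k}) u w)) \<partial>U.Q) = (\<integral>\<^sup>+v. \<phi> (U.dif k F (u(k := v))) \<partial>unif)"
  unfolding mix_upd by (rule nn_integral_component) measurable

lemma nn_integral_nabla:
  assumes [measurable]: "\<phi> \<in> borel_measurable borel"
  shows "(\<integral>\<^sup>+t\<in>{0..}. \<phi> (nabla t F u) \<partial>lborel) = (\<Sum>k. 2 * (\<integral>\<^sup>+w. \<phi> (U.dif k F (mix (- {k}) u w)) \<partial>U.Q))"
  unfolding nn_integral_dif_mix[OF assms]
proof (rule nn_integral_half_line)
  fix k t assume "2 * real k \<le> t" "t < 2 * real k + 2"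
  then show "\<phi> (nabla t F u) = \<phi> (U.dif k F (u(k := t - 2 * real k - 1)))"
    by (simp add: nabla_eq_dif[OF F])
qed measurable

lemma nn_integral_block_nabla:
  assumes t: "2 * real k \<le> t" "t < 2 * real k + 2"
  shows "(\<integral>\<^sup>+s\<in>block t. ennreal (\<bar>nabla s F u\<bar>\<^sup>2) \<partial>lborel) = 2 * (\<integral>\<^sup>+w. ennreal ((U.dif k F (mix (- {k}) u w))\<^sup>2) \<partial>U.Q)"
proof -
  have fl: "\<lfloor>t / 2\<rfloor> = int k" by (rule floor_half[OF t])
  \<comment> \<open>The integral over one block is treated as one over the half line whose integrand
    is switched off in every other block.\<close>
  let ?\<psi> = "\<lambda>j v. ennreal ((U.dif j F (u(j := v)))\<^sup>2) * (if j = k then 1 else 0)"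
  have "(\<integral>\<^sup>+s\<in>block t. ennreal (\<bar>nabla s F u\<bar>\<^sup>2) \<partial>lborel) =
      (\<integral>\<^sup>+s\<in>{0..}. ennreal (\<bar>nabla s F u\<bar>\<^sup>2) * indicator {2 * real k..<2 * real k + 2} s \<partial>lborel)"
    using AE_lborel_singleton[of "2 * real k + 2"]
    by (intro nn_integral_cong_AE, eventually_elim) (auto simp: block_def fl indicator_def)
  also have "\<dots> = (\<Sum>j. 2 * (\<integral>\<^sup>+v. ?\<psi> j v \<partial>unif))"
  proof (rule nn_integral_half_line)
    fix j s assume s: "2 * real j \<le> s" "s < 2 * real j + 2"
    have "s \<in> {2 * real k..<2 * real k + 2} \<longleftrightarrow> j = k"
      using floor_half[OF s] floor_half[of k s] s by auto
    then show "ennreal (\<bar>nabla s F u\<bar>\<^sup>2) * indicator {2 * real k..<2 * real k + 2} s = ?\<psi> j (s - 2 * real j - 1)"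
      by (simp add: nabla_eq_dif[OF F s])
  qed measurable
  also have "\<dots> = (\<Sum>j\<in>{k}. 2 * (\<integral>\<^sup>+v. ?\<psi> j v \<partial>unif))"
    by (rule suminf_finite) auto
  also have "\<dots> = 2 * (\<integral>\<^sup>+w. ennreal ((U.dif k F (mix (- {k}) u w))\<^sup>2) \<partial>U.Q)"
    using nn_integral_dif_mix[of "\<lambda>x. ennreal (x\<^sup>2)" k u] by simp
  finally show ?thesis .
qed

lemma half_line_norm_sq_nabla:
  "half_line_norm_sq (\<lambda>t. nabla t F u) = (\<Sum>k. \<integral>\<^sup>+w. ennreal ((U.dif k F (mix (- {k}) u w))\<^sup>2) \<partial>U.Q)"
proof -
  have "half_line_norm_sq (\<lambda>t. nabla t F u) = (\<Sum>k. 2 * (\<integral>\<^sup>+w. ennreal ((U.dif k F (mix (- {k}) u w))\<^sup>2) \<partial>U.Q)) / 2"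
    unfolding half_line_norm_sq_def using nn_integral_nabla[of "\<lambda>x. ennreal (\<bar>x\<bar>\<^sup>2)" u] by simp
  also have "\<dots> = 2 * (\<Sum>k. \<integral>\<^sup>+w. ennreal ((U.dif k F (mix (- {k}) u w))\<^sup>2) \<partial>U.Q) / 2"
    by (simp add: ennreal_suminf_cmult)
  also have "\<dots> = (\<Sum>k. \<integral>\<^sup>+w. ennreal ((U.dif k F (mix (- {k}) u w))\<^sup>2) \<partial>U.Q)"
    by (simp add: mult.commute[of 2] mult_divide_eq_ennreal)
  finally show ?thesis .
qed

lemma nn_integral_nabla_mult:
  "(\<integral>\<^sup>+t\<in>{0..}. ennreal \<bar>nabla t F u\<bar> * (\<integral>\<^sup>+s\<in>block t. ennreal (\<bar>nabla s F u\<bar>\<^sup>2) \<partial>lborel) \<partial>lborel) =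
    (\<Sum>k. 4 * (\<integral>\<^sup>+w. ennreal \<bar>U.dif k F (mix (- {k}) u w)\<bar> * (\<integral>\<^sup>+v. ennreal ((U.dif k F (mix (- {k}) u v))\<^sup>2) \<partial>U.Q) \<partial>U.Q))"
proof -
  let ?b = "\<lambda>k. \<integral>\<^sup>+v. ennreal ((U.dif k F (mix (- {k}) u v))\<^sup>2) \<partial>U.Q"
  have "(\<integral>\<^sup>+t\<in>{0..}. ennreal \<bar>nabla t F u\<bar> * (\<integral>\<^sup>+s\<in>block t. ennreal (\<bar>nabla s F u\<bar>\<^sup>2) \<partial>lborel) \<partial>lborel) =
    (\<Sum>k. 2 * (\<integral>\<^sup>+v. ennreal \<bar>U.dif k F (u(k := v))\<bar> * (2 * ?b k) \<partial>unif))"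
  proof (rule nn_integral_half_line)
    fix k t assume t: "2 * real k \<le> t" "t < 2 * real k + 2"
    show "ennreal \<bar>nabla t F u\<bar> * (\<integral>\<^sup>+s\<in>block t. ennreal (\<bar>nabla s F u\<bar>\<^sup>2) \<partial>lborel) =
        ennreal \<bar>U.dif k F (u(k := t - 2 * real k - 1))\<bar> * (2 * ?b k)"
      unfolding nn_integral_block_nabla[OF t] by (simp add: nabla_eq_dif[OF F t])
  qed measurable
  also have "\<dots> = (\<Sum>k. 4 * (\<integral>\<^sup>+w. ennreal \<bar>U.dif k F (mix (- {k}) u w)\<bar> * ?b k \<partial>U.Q))"
  proof (rule suminf_cong)
    fix k
    have "(\<integral>\<^sup>+v. ennreal \<bar>U.dif k F (u(k := v))\<bar> * (2 * ?b k) \<partial>unif) = (\<integral>\<^sup>+v. 2 * (ennreal \<bar>U.dif k F (u(k := v))\<bar> * ?b k) \<partial>unif)"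
      by (simp add: mult.left_commute)
    also have "\<dots> = 2 * (\<integral>\<^sup>+v. ennreal \<bar>U.dif k F (u(k := v))\<bar> * ?b k \<partial>unif)"
      by (rule nn_integral_cmult) measurable
    also have "(\<integral>\<^sup>+v. ennreal \<bar>U.dif k F (u(k := v))\<bar> * ?b k \<partial>unif) = (\<integral>\<^sup>+w. ennreal \<bar>U.dif k F (mix (- {k}) u w)\<bar> * ?b k \<partial>U.Q)"
      using nn_integral_dif_mix[of "\<lambda>x. ennreal \<bar>x\<bar> * ?b k" k u] by simp
    finally have e: "(\<integral>\<^sup>+v. ennreal \<bar>U.dif k F (u(k := v))\<bar> * (2 * ?b k) \<partial>unif) = 2 * \<dots>" .
    have four: "2 * (2 * y) = 4 * y" for y :: ennreal by (simp flip: mult.assoc)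
    show "2 * (\<integral>\<^sup>+v. ennreal \<bar>U.dif k F (u(k := v))\<bar> * (2 * ?b k) \<partial>unif) =
      4 * (\<integral>\<^sup>+w. ennreal \<bar>U.dif k F (mix (- {k}) u w)\<bar> * ?b k \<partial>U.Q)"
      by (simp only: e four)
  qed
  finally show ?thesis .
qed

lemma suminf_rem:
  assumes n: "n \<ge> 1"
  shows "ennreal (1 / real n) * (\<Sum>k. U.rem k F) =
      ennreal (1 / (2 * real n)) * (\<integral>\<^sup>+u. (\<integral>\<^sup>+t\<in>{0..}. ennreal (\<bar>nabla t F u\<bar> ^ 3) \<partial>lborel) \<partial>U.Q) +
      ennreal (1 / (4 * real n)) * (\<integral>\<^sup>+u. (\<integral>\<^sup>+t\<in>{0..}. ennreal \<bar>nabla t F u\<bar> *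
        (\<integral>\<^sup>+s\<in>block t. ennreal (\<bar>nabla s F u\<bar>\<^sup>2) \<partial>lborel) \<partial>lborel) \<partial>U.Q)"
proof -
  let ?a = "\<lambda>k u. \<integral>\<^sup>+w. ennreal (\<bar>U.dif k F (mix (- {k}) u w)\<bar> ^ 3) \<partial>U.Q"
  let ?b = "\<lambda>k u. \<integral>\<^sup>+w. ennreal \<bar>U.dif k F (mix (- {k}) u w)\<bar> * (\<integral>\<^sup>+v. ennreal ((U.dif k F (mix (- {k}) u v))\<^sup>2) \<partial>U.Q) \<partial>U.Q"
  have [measurable]: "?a k \<in> borel_measurable U.Q" "?b k \<in> borel_measurable U.Q" for k by measurable
  have sc: "(\<integral>\<^sup>+u. (\<Sum>k. c * h k u) \<partial>U.Q) = c * (\<Sum>k. \<integral>\<^sup>+u. h k u \<partial>U.Q)"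
    if [measurable]: "\<And>k. h k \<in> borel_measurable U.Q" for c and h :: "nat \<Rightarrow> (nat \<Rightarrow> real) \<Rightarrow> ennreal"
    by (subst nn_integral_suminf) (auto simp: nn_integral_cmult ennreal_suminf_cmult)
  have 1: "(\<integral>\<^sup>+u. (\<integral>\<^sup>+t\<in>{0..}. ennreal (\<bar>nabla t F u\<bar> ^ 3) \<partial>lborel) \<partial>U.Q) = 2 * (\<Sum>k. \<integral>\<^sup>+u. ?a k u \<partial>U.Q)"
    using nn_integral_nabla[of "\<lambda>x. ennreal (\<bar>x\<bar> ^ 3)"] sc[of ?a 2] by simp
  have 2: "(\<integral>\<^sup>+u. (\<integral>\<^sup>+t\<in>{0..}. ennreal \<bar>nabla t F u\<bar> *
        (\<integral>\<^sup>+s\<in>block t. ennreal (\<bar>nabla s F u\<bar>\<^sup>2) \<partial>lborel) \<partial>lborel) \<partial>U.Q) = 4 * (\<Sum>k. \<integral>\<^sup>+u. ?b k u \<partial>U.Q)"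
    unfolding nn_integral_nabla_mult by (rule sc) measurable
  have c2: "ennreal (1 / (2 * real n)) * (2 * x) = ennreal (1 / real n) * x" for x
  proof -
    have "ennreal (1 / (2 * real n)) * 2 = ennreal (1 / (2 * real n) * 2)"
      by (subst ennreal_mult) auto
    then show ?thesis by (simp flip: mult.assoc)
  qed
  have c4: "ennreal (1 / (4 * real n)) * (4 * x) = ennreal (1 / real n) * x" for x
  proof -
    have "ennreal (1 / (4 * real n)) * 4 = ennreal (1 / (4 * real n) * 4)"
      by (subst ennreal_mult) auto
    then show ?thesis by (simp flip: mult.assoc)
  qed
  have "(\<Sum>k. U.rem k F) = (\<Sum>k. (\<integral>\<^sup>+u. ?a k u \<partial>U.Q) + (\<integral>\<^sup>+u. ?b k u \<partial>U.Q))"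
    by (simp add: U.rem_def)
  also have "\<dots> = (\<Sum>k. \<integral>\<^sup>+u. ?a k u \<partial>U.Q) + (\<Sum>k. \<integral>\<^sup>+u. ?b k u \<partial>U.Q)"
    by (rule suminf_add[symmetric]) auto
  finally show ?thesis
    unfolding 1 2 c2 c4 by (simp add: distrib_left)
qed

text \<open>Measurability in \<open>u\<close> is read off the series over \<open>k\<close>, which
  bypasses joint measurability of \<open>nabla\<close> in \<open>t\<close> and
  \<open>u\<close>.\<close>

lemma measurable_nn_integral_nabla:
  "(\<lambda>u. \<integral>\<^sup>+t\<in>{0..}. ennreal (\<bar>nabla t F u\<bar> ^ 3) \<partial>lborel) \<in> borel_measurable U.Q"
  "(\<lambda>u. \<integral>\<^sup>+t\<in>{0..}. ennreal \<bar>nabla t F u\<bar> * (\<integral>\<^sup>+s\<in>block t. ennreal (\<bar>nabla s F u\<bar>\<^sup>2) \<partial>lborel) \<partial>lborel) \<in> borel_measurable U.Q"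
  "(\<lambda>u. half_line_norm_sq (\<lambda>t. nabla t F u)) \<in> borel_measurable U.Q"
proof -
  show "(\<lambda>u. \<integral>\<^sup>+t\<in>{0..}. ennreal (\<bar>nabla t F u\<bar> ^ 3) \<partial>lborel) \<in> borel_measurable U.Q"
    using nn_integral_nabla[of "\<lambda>x. ennreal (\<bar>x\<bar> ^ 3)"] by simp
  show "(\<lambda>u. \<integral>\<^sup>+t\<in>{0..}. ennreal \<bar>nabla t F u\<bar> * (\<integral>\<^sup>+s\<in>block t. ennreal (\<bar>nabla s F u\<bar>\<^sup>2) \<partial>lborel) \<partial>lborel) \<in> borel_measurable U.Q"
    unfolding nn_integral_nabla_mult by measurable
  show "(\<lambda>u. half_line_norm_sq (\<lambda>t. nabla t F u)) \<in> borel_measurable U.Q"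
    unfolding half_line_norm_sq_nabla by measurable
qed

end

theorem proposition3p4:
  fixes M :: "'a measure" and U :: "nat \<Rightarrow> 'a \<Rightarrow> real"
    and P :: "'b measure" and N :: "'b \<Rightarrow> real"
    and n :: nat and f :: "(nat \<Rightarrow> real) \<Rightarrow> real"
  assumes "prob_space M" and "iid_uniform M U"
    and "prob_space P" and "distributed P lborel N std_normal_density"
    and "n \<ge> 1" and "f \<in> hatL2 n"
  defines "In \<equiv> mult_int M U n f"
  defines "D \<equiv> \<lambda>t \<omega>. nabla t In (\<lambda>k. U k \<omega>)"
  shows "wasserstein_dist M (\<lambda>\<omega>. In (\<lambda>k. U k \<omega>)) P N \<le>
      ennreal_sqrt (\<integral>\<^sup>+\<omega>. e2ennreal
        ((1 - enn2ereal (ennreal (1 / real n) * half_line_norm_sq (\<lambda>t. D t \<omega>)))\<^sup>2) \<partial>M)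
    + ennreal (1 / (2 * real n)) *
        (\<integral>\<^sup>+\<omega>. (\<integral>\<^sup>+t\<in>{0..}. ennreal (\<bar>D t \<omega>\<bar> ^ 3) \<partial>lborel) \<partial>M)
    + ennreal (1 / (4 * real n)) *
        (\<integral>\<^sup>+\<omega>. (\<integral>\<^sup>+t\<in>{0..}. ennreal \<bar>D t \<omega>\<bar> *
          (\<integral>\<^sup>+s\<in>block t. ennreal (\<bar>D s \<omega>\<bar>\<^sup>2) \<partial>lborel) \<partial>lborel) \<partial>M)"
proof -
  note M = assms(1) and iid = assms(2) and n = assms(5)
  have In: "is_mult_int M U n f In"
    unfolding In_def mult_int_def by (rule someI_ex[OF is_mult_int_exists[OF M iid assms(6)]])
  note L2 = is_mult_int_dif_eigen_lim(1)[OF M iid In] and lim = is_mult_int_dif_eigen_lim(2)[OF M iid In]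
  have InQ [measurable]: "In \<in> borel_measurable U.Q" using L2 by auto
  note nm = measurable_nn_integral_nabla[OF InQ]
  note [measurable] = nm(3)
  have em: "(\<lambda>u. e2ennreal ((1 - enn2ereal (ennreal (1 / real n) * half_line_norm_sq (\<lambda>t. nabla t In u)))\<^sup>2))
      \<in> borel_measurable U.Q"
    unfolding power2_eq_square by measurable
  let ?B = "ennreal_sqrt (\<integral>\<^sup>+u. e2ennreal
        ((1 - enn2ereal (ennreal (1 / real n) * half_line_norm_sq (\<lambda>t. nabla t In u)))\<^sup>2) \<partial>U.Q)
    + ennreal (1 / (2 * real n)) *
        (\<integral>\<^sup>+u. (\<integral>\<^sup>+t\<in>{0..}. ennreal (\<bar>nabla t In u\<bar> ^ 3) \<partial>lborel) \<partial>U.Q)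
    + ennreal (1 / (4 * real n)) *
        (\<integral>\<^sup>+u. (\<integral>\<^sup>+t\<in>{0..}. ennreal \<bar>nabla t In u\<bar> *
          (\<integral>\<^sup>+s\<in>block t. ennreal (\<bar>nabla s In u\<bar>\<^sup>2) \<partial>lborel) \<partial>lborel) \<partial>U.Q)"
  have bound: "ennreal \<bar>(\<integral>\<omega>. h (In (\<lambda>k. U k \<omega>)) \<partial>M) - (\<integral>\<omega>. h (N \<omega>) \<partial>P)\<bar> \<le> ?B"
    if h: "1-lipschitz_on UNIV h" for h :: "real \<Rightarrow> real"
  proof -
    have [measurable]: "h \<in> borel_measurable borel"
      using lipschitz_on_continuous_on[OF h] by (rule borel_measurable_continuous_onI)
    obtain \<phi> \<phi>' where \<phi>: "1-lipschitz_on UNIV \<phi>" "continuous_on UNIV \<phi>'" "\<And>x. \<bar>\<phi>' x\<bar> \<le> 1"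
      "\<And>x y. \<bar>\<phi> y - \<phi> x - \<phi>' x * (y - x)\<bar> \<le> (y - x)\<^sup>2"
      "\<And>x. \<phi>' x - x * \<phi> x = h x - std_normal_mean h"
      using stein_solution[OF h] by metis
    have \<phi>'m: "\<phi>' \<in> borel_measurable borel" using \<phi>(2) by (rule borel_measurable_continuous_onI)
    have "(\<integral>\<omega>. h (N \<omega>) \<partial>P) = (\<integral>x. std_normal_density x * h x \<partial>lborel)"
      by (rule distributed_integral[OF assms(4), symmetric]) auto
    then have mean: "(\<integral>\<omega>. h (N \<omega>) \<partial>P) = std_normal_mean h"
      by (simp add: std_normal_mean_def mult.commute)
    have hi: "integrable U.Q (\<lambda>u. h (In u))"
      using U.integral_dif_lipschitz(1)[OF L2 h] by (rule U.Q.P.L2_integrable)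
    have "(\<integral>\<omega>. h (In (\<lambda>k. U k \<omega>)) \<partial>M) = (\<integral>u. h (In u) \<partial>U.Q)"
      by (rule integral_iid[OF M iid]) measurable
    \<comment> \<open>Under the product law, Stein's equation turns the error for \<open>h\<close>
      into the functional bounded before, with a bound that no longer involves
      \<open>h\<close>.\<close>
    then have "(\<integral>\<omega>. h (In (\<lambda>k. U k \<omega>)) \<partial>M) - (\<integral>\<omega>. h (N \<omega>) \<partial>P) = (\<integral>u. h (In u) - std_normal_mean h \<partial>U.Q)"
      using hi U.Q.P.prob_space by (simp add: mean)
    also have "\<dots> = (\<integral>u. \<phi>' (In u) - In u * \<phi> (In u) \<partial>U.Q)"
      by (simp only: \<phi>(5))
    finally have eq: "(\<integral>\<omega>. h (In (\<lambda>k. U k \<omega>)) \<partial>M) - (\<integral>\<omega>. h (N \<omega>) \<partial>P) = \<dots>" .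
    show ?thesis
      using U.stein_functional_bound[OF n lim \<phi>(1) \<phi>'m \<phi>(3,4)]
      unfolding eq half_line_norm_sq_nabla[OF InQ] suminf_rem[OF InQ n] add.assoc .
  qed
  have "wasserstein_dist M (\<lambda>\<omega>. In (\<lambda>k. U k \<omega>)) P N \<le> ?B"
    unfolding wasserstein_dist_def by (rule SUP_least) (use bound in simp)
  also have "?B = ennreal_sqrt (\<integral>\<^sup>+\<omega>. e2ennreal
        ((1 - enn2ereal (ennreal (1 / real n) * half_line_norm_sq (\<lambda>t. D t \<omega>)))\<^sup>2) \<partial>M)
    + ennreal (1 / (2 * real n)) *
        (\<integral>\<^sup>+\<omega>. (\<integral>\<^sup>+t\<in>{0..}. ennreal (\<bar>D t \<omega>\<bar> ^ 3) \<partial>lborel) \<partial>M)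
    + ennreal (1 / (4 * real n)) *
        (\<integral>\<^sup>+\<omega>. (\<integral>\<^sup>+t\<in>{0..}. ennreal \<bar>D t \<omega>\<bar> *
          (\<integral>\<^sup>+s\<in>block t. ennreal (\<bar>D s \<omega>\<bar>\<^sup>2) \<partial>lborel) \<partial>lborel) \<partial>M)"
    unfolding D_def
    by (intro arg_cong2[where f="(+)"] arg_cong2[where f="(*)"] arg_cong[where f=ennreal_sqrt] refl
        nn_integral_iid[OF M iid em, symmetric] nn_integral_iid[OF M iid nm(1), symmetric]
        nn_integral_iid[OF M iid nm(2), symmetric])
  finally show ?thesis .
qed

end
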